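(* Let $M$ be a transitive model of $\mathsf{ZF}+\mathsf{SVC}$. Then there are (in $M$) cardinals $\phi\leq\psi\leq\chi_0\leq\Omega$, a cardinal $\psi^*\geq\psi$, a cardinal $\chi$ with $\chi_0\leq\chi\leq\chi_0^+$, a set $C$ of cardinals $\mu$ with $\phi\leq\mu<\chi_0$, and classes $\mathfrak{D}$ and $\mathfrak{C}$ with $\mathfrak{D}\subseteq\{\langle\lambda,\kappa\rangle\mid \lambda,\kappa \text{ cardinals},\ \psi\leq\lambda\leq\kappa\leq\chi,\ \psi^*\leq\kappa\}$ and $\mathfrak{C}\subseteq\{\langle\lambda,\lambda^+\rangle\mid\lambda \text{ a cardinal},\ \mathrm{cf}(\lambda)\in C,\ \lambda<\Omega\}$, such that $\mathrm{Spec}_\aleph(M)=\mathrm{Suc}\cup\mathfrak{D}\cup\mathfrak{C}\cup\mathfrak{U}$, where $\mathrm{Suc}=\{\langle\lambda^+,\lambda^+\rangle\mid\lambda \text{ a cardinal}\}$ and $\mathfrak{U}=\{\langle\lambda,\lambda^+\rangle\mid \lambda\text{ a cardinal},\ \mathrm{cf}(\lambda)\in C,\ \lambda\geq\Omega\}$ (all cardinals, successors and cofinalities computed in $M$).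
   Context: For a set $X$, the Hartogs number $\aleph(X)$ is the least ordinal $\alpha$ such that there is no injection $\alpha\to X$, and the Lindenbaum number $\aleph^*(X)$ is the least ordinal $\alpha>0$ such that there is no surjection $X\to\alpha$. The Hartogs–Lindenbaum spectrum of a model $M$ of $\mathsf{ZF}$ is $\mathrm{Spec}_\aleph(M)=\{\langle\lambda,\kappa\rangle\mid M\vDash\exists X\,(\aleph(X)=\lambda\wedge\aleph^*(X)=\kappa)\}$. $\mathsf{SVC}$ (small violations of choice) is the statement: there is a set $S$ such that for every set $X$ there is an ordinal $\eta$ and a surjection $\eta\times S\to X$. Cardinals are well-ordered cardinals; $\lambda^+$ is the cardinal successor. *)

theory Defs
  imports Main
begin

text \<open>
  First-order formulas of set theory, with natural numbers as variables. Throughout,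
  \<open>E x y\<close> is read ``\<open>x\<close> is an element of \<open>y\<close>''.
\<close>

datatype fm =
    Mem nat nat
  | Eql nat nat
  | Neg fm
  | Conj fm fm
  | All nat fm

primrec sat :: "('v \<Rightarrow> 'v \<Rightarrow> bool) \<Rightarrow> 'v set \<Rightarrow> (nat \<Rightarrow> 'v) \<Rightarrow> fm \<Rightarrow> bool" where
  "sat E M s (Mem i j) \<longleftrightarrow> E (s i) (s j)"
| "sat E M s (Eql i j) \<longleftrightarrow> s i = s j"
| "sat E M s (Neg p) \<longleftrightarrow> \<not> sat E M s p"
| "sat E M s (Conj p q) \<longleftrightarrow> sat E M s p \<and> sat E M s q"
| "sat E M s (All i p) \<longleftrightarrow> (\<forall>x\<in>M. sat E M (s(i := x)) p)"

text \<open>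
  A transitive model lives in an ambient universe of sets. The universe is the whole type
  \<open>'v\<close> with an extensional well-founded membership relation; \<open>M\<close> may be a set or a
  proper class of that universe (\<open>M = UNIV\<close> included).
\<close>

definition membership_universe :: "('v \<Rightarrow> 'v \<Rightarrow> bool) \<Rightarrow> bool" where
  "membership_universe E \<longleftrightarrow> (\<forall>x y. (\<forall>z. E z x \<longleftrightarrow> E z y) \<longrightarrow> x = y) \<and> wfp E"

definition transitive_class :: "('v \<Rightarrow> 'v \<Rightarrow> bool) \<Rightarrow> 'v set \<Rightarrow> bool" where
  "transitive_class E M \<longleftrightarrow> (\<forall>x\<in>M. \<forall>y. E y x \<longrightarrow> y \<in> M)"

text \<open>
  Everything in the following context is computed in the structure \<open>(M, E)\<close>: all
  quantifiers over sets are relativized to \<open>M\<close>.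
\<close>

context
  fixes E :: "'v \<Rightarrow> 'v \<Rightarrow> bool"  (infix "\<epsilon>" 50)
    and M :: "'v set"
begin

definition is_empty :: "'v \<Rightarrow> bool" where
  "is_empty x \<longleftrightarrow> (\<forall>z\<in>M. \<not> z \<epsilon> x)"

definition is_subset :: "'v \<Rightarrow> 'v \<Rightarrow> bool" where
  "is_subset x y \<longleftrightarrow> (\<forall>z\<in>M. z \<epsilon> x \<longrightarrow> z \<epsilon> y)"

definition is_upair :: "'v \<Rightarrow> 'v \<Rightarrow> 'v \<Rightarrow> bool" where
  "is_upair a b p \<longleftrightarrow> (\<forall>z\<in>M. z \<epsilon> p \<longleftrightarrow> z = a \<or> z = b)"

text \<open>Kuratowski pairs: \<open>p = {{a}, {a, b}}\<close>.\<close>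

definition is_pair :: "'v \<Rightarrow> 'v \<Rightarrow> 'v \<Rightarrow> bool" where
  "is_pair a b p \<longleftrightarrow>
     (\<exists>u\<in>M. \<exists>v\<in>M. is_upair a a u \<and> is_upair a b v \<and> is_upair u v p)"

definition is_product :: "'v \<Rightarrow> 'v \<Rightarrow> 'v \<Rightarrow> bool" where
  "is_product a b c \<longleftrightarrow>
     (\<forall>p\<in>M. p \<epsilon> c \<longleftrightarrow> (\<exists>x\<in>M. \<exists>y\<in>M. x \<epsilon> a \<and> y \<epsilon> b \<and> is_pair x y p))"

definition has_value :: "'v \<Rightarrow> 'v \<Rightarrow> 'v \<Rightarrow> bool" where
  "has_value f x y \<longleftrightarrow> (\<exists>p\<in>M. p \<epsilon> f \<and> is_pair x y p)"

definition is_function :: "'v \<Rightarrow> 'v \<Rightarrow> 'v \<Rightarrow> bool" where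
  "is_function f a b \<longleftrightarrow>
     (\<forall>p\<in>M. p \<epsilon> f \<longrightarrow> (\<exists>x\<in>M. \<exists>y\<in>M. x \<epsilon> a \<and> y \<epsilon> b \<and> is_pair x y p)) \<and>
     (\<forall>x\<in>M. x \<epsilon> a \<longrightarrow> (\<exists>!y. y \<in> M \<and> has_value f x y))"

definition is_injection :: "'v \<Rightarrow> 'v \<Rightarrow> 'v \<Rightarrow> bool" where
  "is_injection f a b \<longleftrightarrow> is_function f a b \<and>
     (\<forall>x\<in>M. \<forall>x'\<in>M. \<forall>y\<in>M. has_value f x y \<and> has_value f x' y \<longrightarrow> x = x')"

definition is_surjection :: "'v \<Rightarrow> 'v \<Rightarrow> 'v \<Rightarrow> bool" where
  "is_surjection f a b \<longleftrightarrow> is_function f a b \<and>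
     (\<forall>y\<in>M. y \<epsilon> b \<longrightarrow> (\<exists>x\<in>M. x \<epsilon> a \<and> has_value f x y))"

definition is_bijection :: "'v \<Rightarrow> 'v \<Rightarrow> 'v \<Rightarrow> bool" where
  "is_bijection f a b \<longleftrightarrow> is_injection f a b \<and> is_surjection f a b"

definition is_transitive_set :: "'v \<Rightarrow> bool" where
  "is_transitive_set x \<longleftrightarrow> (\<forall>y\<in>M. y \<epsilon> x \<longrightarrow> is_subset y x)"

definition wellordered_by_mem :: "'v \<Rightarrow> bool" where
  "wellordered_by_mem x \<longleftrightarrow>
     (\<forall>a\<in>M. a \<epsilon> x \<longrightarrow> \<not> a \<epsilon> a) \<and>
     (\<forall>a\<in>M. \<forall>b\<in>M. \<forall>c\<in>M. a \<epsilon> x \<and> b \<epsilon> x \<and> c \<epsilon> x \<and> a \<epsilon> b \<and> b \<epsilon> c \<longrightarrow> a \<epsilon> c) \<and>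
     (\<forall>a\<in>M. \<forall>b\<in>M. a \<epsilon> x \<and> b \<epsilon> x \<longrightarrow> a \<epsilon> b \<or> a = b \<or> b \<epsilon> a) \<and>
     (\<forall>s\<in>M. is_subset s x \<and> \<not> is_empty s \<longrightarrow>
        (\<exists>m\<in>M. m \<epsilon> s \<and> (\<forall>y\<in>M. y \<epsilon> s \<longrightarrow> m = y \<or> m \<epsilon> y)))"

definition is_ordinal :: "'v \<Rightarrow> bool" where
  "is_ordinal x \<longleftrightarrow> is_transitive_set x \<and> wellordered_by_mem x"

definition ord_le :: "'v \<Rightarrow> 'v \<Rightarrow> bool" where
  "ord_le a b \<longleftrightarrow> a \<epsilon> b \<or> a = b"

definition is_least_ordinal :: "('v \<Rightarrow> bool) \<Rightarrow> 'v \<Rightarrow> bool" where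
  "is_least_ordinal P a \<longleftrightarrow>
     is_ordinal a \<and> P a \<and> (\<forall>b\<in>M. is_ordinal b \<and> P b \<longrightarrow> ord_le a b)"

text \<open>Cardinals are initial ordinals, the finite ones included.\<close>

definition is_cardinal :: "'v \<Rightarrow> bool" where
  "is_cardinal k \<longleftrightarrow>
     is_ordinal k \<and> (\<forall>a\<in>M. a \<epsilon> k \<longrightarrow> \<not> (\<exists>f\<in>M. is_bijection f a k))"

definition is_card_succ :: "'v \<Rightarrow> 'v \<Rightarrow> bool" where
  "is_card_succ l k \<longleftrightarrow> is_least_ordinal (\<lambda>a. is_cardinal a \<and> l \<epsilon> a) k"

definition is_cofinal_map :: "'v \<Rightarrow> 'v \<Rightarrow> 'v \<Rightarrow> bool" where
  "is_cofinal_map f a l \<longleftrightarrow> is_function f a l \<and>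
     (\<forall>b\<in>M. b \<epsilon> l \<longrightarrow> (\<exists>x\<in>M. \<exists>y\<in>M. x \<epsilon> a \<and> has_value f x y \<and> ord_le b y))"

definition is_cf :: "'v \<Rightarrow> 'v \<Rightarrow> bool" where
  "is_cf l m \<longleftrightarrow> is_least_ordinal (\<lambda>a. \<exists>f\<in>M. is_cofinal_map f a l) m"

definition is_hartogs :: "'v \<Rightarrow> 'v \<Rightarrow> bool" where
  "is_hartogs X l \<longleftrightarrow> is_least_ordinal (\<lambda>a. \<not> (\<exists>f\<in>M. is_injection f a X)) l"

definition is_lindenbaum :: "'v \<Rightarrow> 'v \<Rightarrow> bool" where
  "is_lindenbaum X k \<longleftrightarrow>
     is_least_ordinal (\<lambda>a. \<not> is_empty a \<and> \<not> (\<exists>f\<in>M. is_surjection f X a)) k"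

definition ax_extensionality :: bool where
  "ax_extensionality \<longleftrightarrow>
     (\<forall>x\<in>M. \<forall>y\<in>M. (\<forall>z\<in>M. z \<epsilon> x \<longleftrightarrow> z \<epsilon> y) \<longrightarrow> x = y)"

definition ax_foundation :: bool where
  "ax_foundation \<longleftrightarrow>
     (\<forall>x\<in>M. \<not> is_empty x \<longrightarrow> (\<exists>y\<in>M. y \<epsilon> x \<and> \<not> (\<exists>z\<in>M. z \<epsilon> x \<and> z \<epsilon> y)))"

definition ax_pairing :: bool where
  "ax_pairing \<longleftrightarrow>
     (\<forall>x\<in>M. \<forall>y\<in>M. \<exists>p\<in>M. is_upair x y p)"

definition ax_union :: bool where
  "ax_union \<longleftrightarrow>
     (\<forall>x\<in>M. \<exists>u\<in>M. \<forall>z\<in>M. z \<epsilon> u \<longleftrightarrow> (\<exists>y\<in>M. y \<epsilon> x \<and> z \<epsilon> y))"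

definition ax_power_set :: bool where
  "ax_power_set \<longleftrightarrow>
     (\<forall>x\<in>M. \<exists>p\<in>M. \<forall>z\<in>M. z \<epsilon> p \<longleftrightarrow> is_subset z x)"

definition ax_infinity :: bool where
  "ax_infinity \<longleftrightarrow>
     (\<exists>w\<in>M. (\<exists>e\<in>M. is_empty e \<and> e \<epsilon> w) \<and>
        (\<forall>x\<in>M. x \<epsilon> w \<longrightarrow> (\<exists>y\<in>M. y \<epsilon> w \<and> (\<forall>z\<in>M. z \<epsilon> y \<longleftrightarrow> z \<epsilon> x \<or> z = x))))"

text \<open>In the two schemes the assignment \<open>s\<close> supplies the parameters.\<close>

definition ax_separation :: bool where
  "ax_separation \<longleftrightarrow>
     (\<forall>p s. range s \<subseteq> M \<longrightarrow>
        (\<forall>a\<in>M. \<exists>b\<in>M. \<forall>x\<in>M. x \<epsilon> b \<longleftrightarrow> x \<epsilon> a \<and> sat E M (s(0 := x)) p))"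

definition ax_replacement :: bool where
  "ax_replacement \<longleftrightarrow>
     (\<forall>p s. range s \<subseteq> M \<longrightarrow>
        (\<forall>a\<in>M.
           (\<forall>x\<in>M. \<forall>y\<in>M. \<forall>z\<in>M. x \<epsilon> a \<and>
              sat E M (s(0 := x, 1 := y)) p \<and> sat E M (s(0 := x, 1 := z)) p \<longrightarrow> y = z) \<longrightarrow>
           (\<exists>b\<in>M. \<forall>y\<in>M. y \<epsilon> b \<longleftrightarrow>
              (\<exists>x\<in>M. x \<epsilon> a \<and> sat E M (s(0 := x, 1 := y)) p))))"

definition ZF_model :: bool where
  "ZF_model \<longleftrightarrow>
     ax_extensionality \<and>
     ax_foundation \<and>
     ax_pairing \<and>
     ax_union \<and>
     ax_power_set \<and>
     ax_infinity \<and>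
     ax_separation \<and>
     ax_replacement"

definition SVC :: bool where
  "SVC \<longleftrightarrow>
     (\<exists>S\<in>M. \<forall>X\<in>M. \<exists>h\<in>M. is_ordinal h \<and>
        (\<exists>c\<in>M. is_product h S c \<and> (\<exists>f\<in>M. is_surjection f c X)))"

text \<open>
  Classes of ordered pairs are represented as sets of meta-level pairs of elements of \<open>M\<close>.
  A class of the model is one that is definable over \<open>(M, E)\<close> with parameters from \<open>M\<close>.
\<close>

definition pair_class :: "('v \<times> 'v) set \<Rightarrow> bool" where
  "pair_class A \<longleftrightarrow>
     (\<exists>p s. range s \<subseteq> M \<and>
        A = {(x, y). x \<in> M \<and> y \<in> M \<and> sat E M (s(0 := x, 1 := y)) p})"

definition Spec_aleph :: "('v \<times> 'v) set" where
  "Spec_aleph = {(l, k). l \<in> M \<and> k \<in> M \<and> (\<exists>X\<in>M. is_hartogs X l \<and> is_lindenbaum X k)}"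

definition Suc_pairs :: "('v \<times> 'v) set" where
  "Suc_pairs = {(k, k) | k. k \<in> M \<and> (\<exists>l\<in>M. is_cardinal l \<and> is_card_succ l k)}"

definition cf_pairs :: "'v \<Rightarrow> ('v \<times> 'v) set" where
  "cf_pairs C = {(l, k). l \<in> M \<and> k \<in> M \<and> is_cardinal l \<and> is_card_succ l k \<and>
                         (\<exists>m\<in>M. is_cf l m \<and> m \<epsilon> C)}"

end

end

theory Submission
  imports Defs
begin

text \<open>
  Let \<open>S\<^sub>0\<close> witness \<open>SVC\<close> and \<open>S = P(S\<^sub>0)\<close>; then every set injects into \<open>\<eta> \<times> S\<close> for some
  ordinal \<open>\<eta>\<close>. Fix an infinite cardinal \<open>\<nu>\<close> that does not inject into \<open>P(S)\<close>. A set \<open>X\<close> can be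
  presented as a subset of \<open>\<mu> \<times> S\<close> with \<open>\<mu>\<close> a cardinal and all sections \<open>X\<^sub>\<alpha>\<close> nonempty. A
  well-orderable quotient of a section has type below \<open>\<nu>\<close>, so by Hessenberg's theorem
  \<open>\<aleph>\<^sup>*(X) = \<mu>\<^sup>+\<close> if \<open>\<mu> \<ge> \<nu>\<close>, and \<open>\<aleph>\<^sup>*(X) \<le> \<nu>\<^sup>+\<close> otherwise. There are fewer than \<open>\<nu>\<close>
  different sections, so for \<open>\<mu> > \<nu>\<close> the classes of equal sections have unbounded order
  types below \<open>\<mu>\<close>; hence \<open>\<aleph>(X) \<in> {\<mu>, \<mu>\<^sup>+}\<close>. If \<open>\<aleph>(X) = \<mu>\<close>, then \<open>cf(\<mu>) < \<nu>\<close>, and the unions of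
  the sections with long classes form a decreasing \<open>cf(\<mu>)\<close>-sequence of nonempty subsets of
  \<open>S\<close> without a choice function. Conversely, spreading such a \<open>\<tau>\<close>-sequence over any
  cardinal \<open>\<mu> > \<nu>\<close> of cofinality \<open>\<tau>\<close> yields a set with Hartogs number \<open>\<mu>\<close> and Lindenbaum number
  \<open>\<mu>\<^sup>+\<close>. So \<open>C\<close> is the set of those \<open>\<tau> < \<nu>\<close>, and \<open>\<chi>\<^sub>0 = \<chi> = \<Omega> = \<nu>\<^sup>+\<close>, \<open>\<phi> = \<psi> = \<psi>\<^sup>* = 0\<close> work.

  All sets are produced by separation and replacement for predicates on environments that are
  definable with parameters; foundation and induction are used externally, where they hold for
  arbitrary predicates because membership is well-founded.
\<close>

section \<open>Definability over a structure\<close>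

text \<open>Two kinds of data meet in \<open>Power S\<close>: sections are subsets of
  \<open>S\<close>, and a map from a section onto an ordinal is coded by its fibres, again subsets
  of \<open>S\<close>. So one condition on \<open>nu\<close> bounds both the number of distinct
  sections and every well-orderable quotient of a section. The obstacle is that such bounds hold
  fibre by fibre, and no choice is available to glue the witnessing injections. The remedy is to
  replace an injection of a fibre by the order positions of its points, which are given uniformly;
  all other selections are least ordinals or unique objects. Choiceless sequences measure the
  failure that is left: when every class of indices with equal sections is bounded in \<mu>, an
  embedding of \<mu> into \<open>X\<close> has to pick a point from each of cf(\<mu>) many tails,
  and the tails can be arranged to decrease. The step from \<open>nu\<close> to its successor in the
  constants comes from sets with at most \<open>nu\<close> indices, whose Lindenbaum number can only
  be bounded by that successor; all pairs up to this bound are put into \<open>DD\<close>.\<close>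

primrec rename_fm :: "(nat \<Rightarrow> nat) \<Rightarrow> fm \<Rightarrow> fm" where
  "rename_fm r (Mem i j) = Mem (r i) (r j)"
| "rename_fm r (Eql i j) = Eql (r i) (r j)"
| "rename_fm r (Neg p) = Neg (rename_fm r p)"
| "rename_fm r (Conj p q) = Conj (rename_fm r p) (rename_fm r q)"
| "rename_fm r (All i p) = All (r i) (rename_fm r p)"

text \<open>Bound variables are renamed too. Capture is impossible for injective \<open>r\<close>:
  an update at \<open>r i\<close> is seen through \<open>r\<close> only at \<open>i\<close>.\<close>

lemma sat_rename_fm: "inj r \<Longrightarrow> sat E M s (rename_fm r p) \<longleftrightarrow> sat E M (\<lambda>i. s (r i)) p"
proof (induction p arbitrary: s)
  case (All i p)
  have "(\<lambda>k. (s(r i := x)) (r k)) = (\<lambda>k. s (r k))(i := x)" for x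
    using All.prems by (auto simp: inj_def fun_eq_iff)
  with All show ?case by simp
qed auto

definition interleave :: "(nat \<Rightarrow> 'a) \<Rightarrow> (nat \<Rightarrow> 'a) \<Rightarrow> nat \<Rightarrow> 'a" where
  "interleave s c n = (if even n then s (n div 2) else c (n div 2))"

lemma interleave_simps [simp]:
  "interleave s c (2 * i) = s i" "interleave s c (Suc (2 * i)) = c i"
  "interleave s c 0 = s 0" "interleave s c (Suc 0) = c 0" "interleave s c 2 = s 1"
  by (simp_all add: interleave_def)

lemma interleave_eqI:
  assumes "\<And>i. t (2 * i) = s i" and "\<And>i. t (Suc (2 * i)) = c i"
  shows "interleave s c = t"
proof
  fix n
  show "interleave s c n = t n"
    using assms(1)[of "n div 2"] assms(2)[of "n div 2"]
    by (cases "even n") (auto simp: interleave_def elim!: oddE)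
qed

text \<open>
  Environments are de Bruijn style: \<open>s 0\<close> is the innermost variable. Parameters are
  kept in a second sequence \<open>c\<close>, stored at the odd variables of the formula.
\<close>

definition definable :: "('v \<Rightarrow> 'v \<Rightarrow> bool) \<Rightarrow> 'v set \<Rightarrow> ((nat \<Rightarrow> 'v) \<Rightarrow> bool) \<Rightarrow> bool" where
  "definable E M P \<longleftrightarrow> (\<exists>p c. range c \<subseteq> M \<and>
     (\<forall>s. range s \<subseteq> M \<longrightarrow> (sat E M (interleave s c) p \<longleftrightarrow> P s)))"

definition definable_term :: "('v \<Rightarrow> 'v \<Rightarrow> bool) \<Rightarrow> 'v set \<Rightarrow> ((nat \<Rightarrow> 'v) \<Rightarrow> 'v) \<Rightarrow> bool" where
  "definable_term E M t \<longleftrightarrow> (\<forall>s. range s \<subseteq> M \<longrightarrow> t s \<in> M) \<and>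
     definable E M (\<lambda>s. s 0 = t (\<lambda>n. s (Suc n)))"

lemma definable_rename:
  assumes "definable E M P" and "inj r"
  shows "definable E M (\<lambda>s. P (\<lambda>n. s (r n)))"
proof -
  obtain p c where c: "range c \<subseteq> M"
    and p: "\<And>s. range s \<subseteq> M \<Longrightarrow> sat E M (interleave s c) p \<longleftrightarrow> P s"
    using assms(1) by (auto simp: definable_def)
  \<comment> \<open>Only the variables of the environment, at even places, are moved; the parameters
    stay at their odd places, so \<open>c\<close> is kept.\<close>
  define q where "q n = (if even n then 2 * r (n div 2) else n)" for n
  have "inj q"
  proof (rule injI)
    fix m n assume eq: "q m = q n"
    have par: "even (q k) \<longleftrightarrow> even k" for k by (simp add: q_def)
    have "even m \<longleftrightarrow> even n" using par[of m] par[of n] eq by simp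
    moreover have "m div 2 = n div 2" if "even m" "even n"
      using eq that assms(2) by (simp add: q_def inj_eq)
    ultimately show "m = n"
      using eq by (cases "even m") (auto simp: q_def elim!: evenE)
  qed
  have "(\<lambda>i. interleave s c (q i)) = interleave (\<lambda>n. s (r n)) c" for s
    by (rule interleave_eqI[symmetric]) (auto simp: q_def)
  then have "sat E M (interleave s c) (rename_fm q p) \<longleftrightarrow> P (\<lambda>n. s (r n))" if "range s \<subseteq> M" for s
    using p[of "\<lambda>n. s (r n)"] that by (auto simp: sat_rename_fm[OF \<open>inj q\<close>] image_subset_iff)
  with c show ?thesis unfolding definable_def by blast
qed

lemma definable_cong:
  assumes "definable E M P" and "\<And>s. range s \<subseteq> M \<Longrightarrow> P s \<longleftrightarrow> Q s"
  shows "definable E M Q"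
  using assms unfolding definable_def by metis

named_theorems dfb

lemma definable_not [dfb]: "definable E M P \<Longrightarrow> definable E M (\<lambda>s. \<not> P s)"
  unfolding definable_def by (metis sat.simps(3))

lemma definable_conj [dfb]:
  assumes "definable E M P" and "definable E M Q"
  shows "definable E M (\<lambda>s. P s \<and> Q s)"
proof -
  obtain p c where c: "range c \<subseteq> M"
    and p: "\<And>s. range s \<subseteq> M \<Longrightarrow> sat E M (interleave s c) p \<longleftrightarrow> P s"
    using assms(1) by (auto simp: definable_def)
  obtain q d where d: "range d \<subseteq> M"
    and q: "\<And>s. range s \<subseteq> M \<Longrightarrow> sat E M (interleave s d) q \<longleftrightarrow> Q s"
    using assms(2) by (auto simp: definable_def)
  \<comment> \<open>The two formulas bring separate parameter sequences. \<open>r k\<close> sends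
    parameter \<open>i\<close> to slot \<open>2 * i + k\<close> and fixes the environment, so each
    formula reads its own half of \<open>interleave c d\<close>.\<close>
  define r where "r k n = (if even n then n else Suc (2 * (2 * (n div 2) + k)))" for k n :: nat
  have inj: "inj (r k)" for k
  proof (rule injI)
    fix m n assume eq: "r k m = r k n"
    show "m = n"
      using eq by (auto simp: r_def split: if_splits) presburger+
  qed
  let ?e = "interleave c d"
  have "(\<lambda>i. interleave s ?e (r 0 i)) = interleave s c" for s
    by (rule interleave_eqI[symmetric]) (auto simp: r_def interleave_def)
  moreover have "(\<lambda>i. interleave s ?e (r 1 i)) = interleave s d" for s
    by (rule interleave_eqI[symmetric]) (auto simp: r_def interleave_def)
  ultimately have "sat E M (interleave s ?e) (Conj (rename_fm (r 0) p) (rename_fm (r 1) q))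
      \<longleftrightarrow> P s \<and> Q s" if "range s \<subseteq> M" for s
    using p q that by (auto simp: sat_rename_fm[OF inj])
  moreover have "range ?e \<subseteq> M"
    using c d by (auto simp: interleave_def)
  ultimately show ?thesis unfolding definable_def by blast
qed

lemma definable_all [dfb]:
  assumes "definable E M (\<lambda>s. P (\<lambda>n. s (Suc n)) (s 0))"
  shows "definable E M (\<lambda>s. \<forall>x\<in>M. P s x)"
proof -
  obtain p c where c: "range c \<subseteq> M"
    and p: "\<And>s. range s \<subseteq> M \<Longrightarrow> sat E M (interleave s c) p \<longleftrightarrow> P (\<lambda>n. s (Suc n)) (s 0)"
    using assms(1) by (auto simp: definable_def)
  \<comment> \<open>The quantified variable needs a place that the outer environment does not
    occupy. Place 1, the first parameter slot, is freed by shifting the parameters by one slot; the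
    outer variables move down to close the gap at 0.\<close>
  define r where "r n = (if n = 0 then 1 else if even n then n - 2 else n + 2)" for n :: nat
  have "inj r"
  proof (rule injI)
    fix m n assume eq: "r m = r n"
    show "m = n"
      using eq by (cases "even m"; cases "even n") (auto simp: r_def split: if_splits elim!: oddE evenE; presburger)+
  qed
  define d where "d = case_nat (c 0) c"
  have shift: "(\<lambda>i. ((interleave s d)(1 := x)) (r i)) = interleave (case_nat x s) c" for s x
  proof (rule interleave_eqI[symmetric])
    fix i
    show "((interleave s d)(1 := x)) (r (2 * i)) = case_nat x s i"
      by (cases i) (auto simp: r_def interleave_def)
    show "((interleave s d)(1 := x)) (r (Suc (2 * i))) = c i"
      by (auto simp: r_def d_def interleave_def)
  qed
  have "sat E M (interleave s d) (All 1 (rename_fm r p)) \<longleftrightarrow> (\<forall>x\<in>M. P s x)" if "range s \<subseteq> M" for s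
  proof -
    have "range (case_nat x s) \<subseteq> M" if "x \<in> M" for x
      using that \<open>range s \<subseteq> M\<close> by (auto simp: image_subset_iff split: nat.splits)
    then show ?thesis
      using p[of "case_nat _ s"] by (simp add: sat_rename_fm[OF \<open>inj r\<close>] shift[simplified])
  qed
  moreover have "range d \<subseteq> M"
    using c by (auto simp: d_def image_subset_iff split: nat.splits)
  ultimately show ?thesis unfolding definable_def by blast
qed

lemma definable_imp [dfb]:
  "definable E M P \<Longrightarrow> definable E M Q \<Longrightarrow> definable E M (\<lambda>s. P s \<longrightarrow> Q s)"
  using definable_not[OF definable_conj[of E M P "\<lambda>s. \<not> Q s"]] definable_not[of E M Q] by simp

lemma definable_disj [dfb]:
  "definable E M P \<Longrightarrow> definable E M Q \<Longrightarrow> definable E M (\<lambda>s. P s \<or> Q s)"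
  using definable_imp[OF definable_not, of E M P Q] by (simp add: imp_conv_disj)

lemma definable_iff [dfb]:
  "definable E M P \<Longrightarrow> definable E M Q \<Longrightarrow> definable E M (\<lambda>s. P s \<longleftrightarrow> Q s)"
  using definable_conj[OF definable_imp[of E M P Q] definable_imp[of E M Q P]]
  by (simp add: iff_conv_conj_imp)

lemma definable_ex [dfb]:
  "definable E M (\<lambda>s. P (\<lambda>n. s (Suc n)) (s 0)) \<Longrightarrow> definable E M (\<lambda>s. \<exists>x\<in>M. P s x)"
  using definable_not[OF definable_all[where P = "\<lambda>s x. \<not> P s x", OF definable_not]]
  by simp

lemma definable_Suc: "definable E M P \<Longrightarrow> definable E M (\<lambda>s. P (\<lambda>n. s (Suc n)))"
  by (rule definable_rename) auto

lemma definable_vars: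
  assumes "m \<in> M"
  shows "definable E M (\<lambda>s. E (s i) (s j))" "definable E M (\<lambda>s. s i = s j)"
proof -
  show "definable E M (\<lambda>s. E (s i) (s j))" unfolding definable_def
    by (rule exI[of _ "Mem (2*i) (2*j)"], rule exI[of _ "\<lambda>_. m"]) (use assms in auto)
  show "definable E M (\<lambda>s. s i = s j)" unfolding definable_def
    by (rule exI[of _ "Eql (2*i) (2*j)"], rule exI[of _ "\<lambda>_. m"]) (use assms in auto)
qed

lemma definable_term_in: "definable_term E M t \<Longrightarrow> range s \<subseteq> M \<Longrightarrow> t s \<in> M"
  by (auto simp: definable_term_def)

lemma definable_term_const: "c \<in> M \<Longrightarrow> definable_term E M (\<lambda>s. c)"
  unfolding definable_term_def definable_def
  by (auto intro!: exI[of _ "Eql 0 1"] exI[of _ "\<lambda>_. c"])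

text \<open>Substitution avoids syntax: a new quantified variable is required to equal the value of
  the term, and this equation is definable by the definition of a term.\<close>

lemma definable_subst1:
  assumes P: "definable E M (\<lambda>s. P (s 0))" and t: "definable_term E M t"
  shows "definable E M (\<lambda>s. P (t s))"
proof -
  have "definable E M (\<lambda>s. \<exists>x\<in>M. x = t s \<and> P x)"
    using t by (intro definable_ex definable_conj P) (auto simp: definable_term_def)
  then show ?thesis
    by (rule definable_cong) (use definable_term_in[OF t] in auto)
qed

lemma definable_subst2:
  assumes R: "definable E M (\<lambda>s. R (s 0) (s 1))"
    and t: "definable_term E M t" and u: "definable_term E M u"
  shows "definable E M (\<lambda>s. R (t s) (u s))"
proof -
  let ?r = "\<lambda>n. case n of 0 \<Rightarrow> 0 | Suc n \<Rightarrow> Suc (Suc n)"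
  have "inj ?r"
    by (auto simp: inj_def split: nat.splits)
  then have "definable E M (\<lambda>s. s 0 = t (\<lambda>n. s (Suc (Suc n))))"
    using definable_rename[OF conjunct2[OF t[unfolded definable_term_def]], of ?r] by simp
  moreover have "definable E M (\<lambda>s. s (Suc 0) = u (\<lambda>n. s (Suc (Suc n))))"
    using definable_Suc[OF conjunct2[OF u[unfolded definable_term_def]]] by simp
  ultimately have "definable E M (\<lambda>s. \<exists>y\<in>M. \<exists>x\<in>M. x = t s \<and> y = u s \<and> R x y)"
    using R by (intro definable_ex definable_conj) auto
  then show ?thesis
    by (rule definable_cong) (use definable_term_in[OF t] definable_term_in[OF u] in auto)
qed

lemma definable_term_nonempty: "definable_term E M t \<Longrightarrow> \<exists>m. m \<in> M"
  by (auto simp: definable_term_def definable_def)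

lemma definable_mem [dfb]:
  assumes "definable_term E M t" and "definable_term E M u"
  shows "definable E M (\<lambda>s. E (t s) (u s))"
  using definable_term_nonempty[OF assms(1)] definable_subst2[of E M E, OF definable_vars(1) assms] by blast

lemma definable_eq [dfb]:
  assumes "definable_term E M t" and "definable_term E M u"
  shows "definable E M (\<lambda>s. t s = u s)"
  using definable_term_nonempty[OF assms(1)] definable_subst2[of E M "(=)", OF definable_vars(2) assms] by blast

lemma definable_term_subst:
  assumes F: "definable_term E M (\<lambda>s. F (s 0))" and t: "definable_term E M t"
  shows "definable_term E M (\<lambda>s. F (t s))"
  unfolding definable_term_def
proof (intro conjI allI impI)
  fix s :: "nat \<Rightarrow> 'a" assume "range s \<subseteq> M"
  then have "range (\<lambda>_::nat. t s) \<subseteq> M" using definable_term_in[OF t] by auto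
  from definable_term_in[OF F this] show "F (t s) \<in> M" .
next
  let ?r = "\<lambda>n. case n of 0 \<Rightarrow> 1 | Suc 0 \<Rightarrow> 0 | Suc (Suc n) \<Rightarrow> Suc (Suc n)"
  have "inj ?r"
    by (auto simp: inj_def split: nat.splits)
  have "definable E M (\<lambda>s. s 0 = F (s 1))"
    using F by (simp add: definable_term_def)
  then have F': "definable E M (\<lambda>s. s 1 = F (s 0))"
    using definable_rename[OF _ \<open>inj ?r\<close>, of E M "\<lambda>s. s 0 = F (s 1)"] by simp
  let ?q = "\<lambda>n. case n of 0 \<Rightarrow> 0 | Suc n \<Rightarrow> Suc (Suc n)"
  have "inj ?q"
    by (auto simp: inj_def split: nat.splits)
  then have "definable E M (\<lambda>s. s 0 = t (\<lambda>n. s (Suc (Suc n))))"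
    using definable_rename[OF conjunct2[OF t[unfolded definable_term_def]], of ?q] by simp
  then have "definable E M (\<lambda>s. \<exists>x\<in>M. x = t (\<lambda>n. s (Suc n)) \<and> s 0 = F x)"
    using F' by (intro definable_ex definable_conj) auto
  then show "definable E M (\<lambda>s. s 0 = F (t (\<lambda>n. s (Suc n))))"
    by (rule definable_cong) (auto intro!: definable_term_in[OF t])
qed

lemma definable_term_var:
  "m \<in> M \<Longrightarrow> definable_term E M (\<lambda>s. s n)"
  by (auto simp: definable_term_def intro: definable_vars)

section \<open>Basic set theory inside a transitive model\<close>

locale zf_universe =
  fixes E :: "'v \<Rightarrow> 'v \<Rightarrow> bool"  (infix "\<epsilon>" 50)
    and M :: "'v set"
  assumes universe: "membership_universe E"
    and transitive: "transitive_class E M"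
    and zf: "ZF_model E M"
begin

abbreviation D :: "((nat \<Rightarrow> 'v) \<Rightarrow> bool) \<Rightarrow> bool" where "D \<equiv> definable E M"
abbreviation T :: "((nat \<Rightarrow> 'v) \<Rightarrow> 'v) \<Rightarrow> bool" where "T \<equiv> definable_term E M"

text \<open>Members as an external set, so that images, injectivity and bijections can be expressed
  with the HOL constants. For \<open>a\<close> in \<open>M\<close> all these members lie in
  \<open>M\<close>, because \<open>M\<close> is transitive.\<close>

definition El :: "'v \<Rightarrow> 'v set" where "El a = {x. x \<epsilon> a}"

lemma mem_El [simp]: "x \<in> El a \<longleftrightarrow> x \<epsilon> a"
  by (simp add: El_def)

lemma El_inject: "El a = El b \<longleftrightarrow> a = b"
  using universe by (auto simp: membership_universe_def El_def)

lemma wf_mem: "wfp E"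
  using universe by (simp add: membership_universe_def)

lemma mem_irrefl [simp]: "\<not> x \<epsilon> x"
  using wf_mem by (induction x rule: wfp_induct_rule) blast+

lemma mem_asym: "x \<epsilon> y \<Longrightarrow> \<not> y \<epsilon> x"
  using wf_mem by (induction x arbitrary: y rule: wfp_induct_rule) blast+

lemma mem_M: "x \<epsilon> a \<Longrightarrow> a \<in> M \<Longrightarrow> x \<in> M"
  using transitive by (auto simp: transitive_class_def)

definition emp :: 'v where "emp = (SOME x. x \<in> M \<and> El x = {})"

lemma emp_M [simp]: "emp \<in> M" and El_emp [simp]: "El emp = {}"
proof -
  obtain e where "e \<in> M" "is_empty E M e"
    using zf by (auto simp: ZF_model_def ax_infinity_def)
  then have "e \<in> M \<and> El e = {}"
    using mem_M by (auto simp: is_empty_def)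
  then have "emp \<in> M \<and> El emp = {}"
    unfolding emp_def by (rule someI)
  then show "emp \<in> M" "El emp = {}" by auto
qed

lemma not_mem_emp [simp]: "\<not> x \<epsilon> emp"
  using El_emp by (metis empty_iff mem_El)

lemma is_empty_iff: "a \<in> M \<Longrightarrow> is_empty E M a \<longleftrightarrow> a = emp"
  using mem_M by (auto simp: is_empty_def El_inject[symmetric] set_eq_iff)

lemma T_var [dfb]: "T (\<lambda>s. s n)"
  by (rule definable_term_var[OF emp_M])

lemma T_const: "c \<in> M \<Longrightarrow> T (\<lambda>s. c)"
  by (rule definable_term_const)

lemma T_emp [dfb]: "T (\<lambda>s. emp)"
  by (simp add: T_const)

lemma T_Suc: "T t \<Longrightarrow> T (\<lambda>s. t (\<lambda>n. s (Suc n)))"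
proof -
  let ?q = "\<lambda>n. case n of 0 \<Rightarrow> 0 | Suc n \<Rightarrow> Suc (Suc n)"
  have "inj ?q"
    by (auto simp: inj_def split: nat.splits)
  assume t: "T t"
  then have "D (\<lambda>s. s 0 = t (\<lambda>n. s (Suc (Suc n))))"
    using definable_rename[OF conjunct2[OF t[unfolded definable_term_def]] \<open>inj ?q\<close>] by simp
  with t show ?thesis
    by (simp add: definable_term_def image_subset_iff)
qed

text \<open>Weakening by a variable just outside the innermost one. It is used when a predicate
  occurs below one more quantifier, as in uniqueness statements.\<close>

lemma D_Suc2:
  assumes "D (\<lambda>s. P (\<lambda>n. s (Suc n)) (s 0))" shows "D (\<lambda>s. P (\<lambda>n. s (Suc (Suc n))) (s 0))"
proof -
  let ?q = "\<lambda>n. case n of 0 \<Rightarrow> 0 | Suc n \<Rightarrow> Suc (Suc n)"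
  have "inj ?q"
    by (auto simp: inj_def split: nat.splits)
  from definable_rename[OF assms this] show ?thesis by simp
qed

lemma D_ball [dfb]:
  assumes "T t" and "D (\<lambda>s. P (\<lambda>n. s (Suc n)) (s 0))"
  shows "D (\<lambda>s. \<forall>x\<in>El (t s). P s x)"
proof -
  have "D (\<lambda>s. \<forall>x\<in>M. x \<epsilon> t s \<longrightarrow> P s x)"
    by (intro dfb T_Suc assms)
  then show ?thesis
    by (rule definable_cong) (use mem_M definable_term_in[OF assms(1)] in auto)
qed

lemma D_bex [dfb]:
  assumes "T t" and "D (\<lambda>s. P (\<lambda>n. s (Suc n)) (s 0))"
  shows "D (\<lambda>s. \<exists>x\<in>El (t s). P s x)"
  using definable_not[OF D_ball[of t "\<lambda>s x. \<not> P s x"]] assms definable_not by auto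

lemma D_ex1 [dfb]:
  assumes "D (\<lambda>s. P (\<lambda>n. s (Suc n)) (s 0))"
  shows "D (\<lambda>s. \<exists>!x. x \<in> M \<and> P s x)"
proof -
  have "D (\<lambda>s. \<exists>x\<in>M. P s x \<and> (\<forall>y\<in>M. P s y \<longrightarrow> y = x))"
    by (intro dfb assms D_Suc2[where P = P])
  then show ?thesis
    by (rule definable_cong) metis
qed

lemma D_let:
  assumes "D (\<lambda>s. P (\<lambda>n. s (Suc n)) (s 0))" and "T t"
  shows "D (\<lambda>s. P s (t s))"
proof -
  have "D (\<lambda>s. \<exists>x\<in>M. x = t s \<and> P s x)"
    by (intro dfb T_Suc assms)
  then show ?thesis
    by (rule definable_cong) (use definable_term_in[OF assms(2)] in auto)
qed

text \<open>Definite description, totalised by the junk value \<^term>\<open>emp\<close> so that it is always definable.\<close>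

definition the_M :: "('v \<Rightarrow> bool) \<Rightarrow> 'v" where
  "the_M P = (if \<exists>!v. v \<in> M \<and> P v then THE v. v \<in> M \<and> P v else emp)"

lemma the_M_M [simp]: "the_M P \<in> M"
  using theI'[of "\<lambda>v. v \<in> M \<and> P v"] by (auto simp: the_M_def)

lemma the_M_eq: "P a \<Longrightarrow> a \<in> M \<Longrightarrow> (\<And>b. b \<in> M \<Longrightarrow> P b \<Longrightarrow> b = a) \<Longrightarrow> the_M P = a"
  unfolding the_M_def by (subst if_P, blast, rule the_equality, blast+)

lemma T_the_M [dfb]:
  assumes "D (\<lambda>s. P (\<lambda>n. s (Suc n)) (s 0))"
  shows "T (\<lambda>s. the_M (P s))"
  unfolding definable_term_def
proof (intro conjI allI impI)
  have "D (\<lambda>s. if \<exists>!v. v \<in> M \<and> P (\<lambda>n. s (Suc n)) v then P (\<lambda>n. s (Suc n)) (s 0) else s 0 = emp)"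
    unfolding if_bool_eq_conj by (intro dfb assms D_Suc2[where P = P])
  then show "D (\<lambda>s. s 0 = the_M (P (\<lambda>n. s (Suc n))))"
  proof (rule definable_cong)
    fix s :: "nat \<Rightarrow> 'v" assume "range s \<subseteq> M"
    then have "s 0 \<in> M" by auto
    then show "(if \<exists>!v. v \<in> M \<and> P (\<lambda>n. s (Suc n)) v then P (\<lambda>n. s (Suc n)) (s 0) else s 0 = emp)
      \<longleftrightarrow> s 0 = the_M (P (\<lambda>n. s (Suc n)))"
      using theI_unique[of "\<lambda>v. v \<in> M \<and> P (\<lambda>n. s (Suc n)) v" "s 0"]
      by (cases "\<exists>!v. v \<in> M \<and> P (\<lambda>n. s (Suc n)) v") (simp_all add: the_M_def)
  qed
qed auto

lemma T_if [dfb]: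
  assumes "D P" and "T t" and "T u"
  shows "T (\<lambda>s. if P s then t s else u s)"
  unfolding definable_term_def
proof (intro conjI allI impI)
  have "D (\<lambda>s. (P (\<lambda>n. s (Suc n)) \<longrightarrow> s 0 = t (\<lambda>n. s (Suc n))) \<and>
              (\<not> P (\<lambda>n. s (Suc n)) \<longrightarrow> s 0 = u (\<lambda>n. s (Suc n))))"
    by (intro dfb T_Suc assms definable_Suc)
  then show "D (\<lambda>s. s 0 = (if P (\<lambda>n. s (Suc n)) then t (\<lambda>n. s (Suc n)) else u (\<lambda>n. s (Suc n))))"
    by (rule definable_cong) auto
qed (use assms definable_term_in in auto)

text \<open>Class functions and predicates are HOL functions on the whole type; only their behaviour
  on \<open>M\<close> is tied to a formula. Parameters enter as HOL constants from \<open>M\<close>,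
  through \<open>T_const\<close>.\<close>

definition dfn :: "('v \<Rightarrow> 'v) \<Rightarrow> bool" where "dfn F \<longleftrightarrow> T (\<lambda>s. F (s 0))"
definition dpred :: "('v \<Rightarrow> bool) \<Rightarrow> bool" where "dpred P \<longleftrightarrow> D (\<lambda>s. P (s 0))"
definition drel :: "('v \<Rightarrow> 'v \<Rightarrow> bool) \<Rightarrow> bool" where "drel R \<longleftrightarrow> D (\<lambda>s. R (s 0) (s 1))"

lemma dfn_app: "dfn F \<Longrightarrow> T t \<Longrightarrow> T (\<lambda>s. F (t s))"
  unfolding dfn_def by (rule definable_term_subst)

lemma dpred_app: "dpred P \<Longrightarrow> T t \<Longrightarrow> D (\<lambda>s. P (t s))"
  unfolding dpred_def by (rule definable_subst1)

lemma drel_app: "drel R \<Longrightarrow> T t \<Longrightarrow> T u \<Longrightarrow> D (\<lambda>s. R (t s) (u s))"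
  unfolding drel_def by (rule definable_subst2)

lemma dfn_M: "dfn F \<Longrightarrow> x \<in> M \<Longrightarrow> F x \<in> M"
  unfolding dfn_def by (drule definable_term_in[where s = "\<lambda>_. x"]) auto

lemma dfn_comp: "dfn F \<Longrightarrow> dfn G \<Longrightarrow> dfn (\<lambda>x. F (G x))"
  using dfn_app[of F "\<lambda>s. G (s 0)"] by (simp add: dfn_def)

text \<open>Adapts the layout of variables to that of the axiom schemes: in an interleaved
  environment the second argument sits at place 2, the schemes expect it at 1, and swapping these
  places repairs this.\<close>

lemma drel_formula:
  assumes "drel R"
  obtains p s where "range s \<subseteq> M"
    "\<And>x y. x \<in> M \<Longrightarrow> y \<in> M \<Longrightarrow> sat E M (s(0 := x, 1 := y)) p \<longleftrightarrow> R x y"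
proof -
  obtain p c where c: "range c \<subseteq> M"
    and p: "\<And>s. range s \<subseteq> M \<Longrightarrow> sat E M (interleave s c) p \<longleftrightarrow> R (s 0) (s 1)"
    using assms by (auto simp: drel_def definable_def)
  define r :: "nat \<Rightarrow> nat" where "r n = (if n = 1 then 2 else if n = 2 then 1 else n)" for n
  have "inj r" by (auto simp: inj_def r_def split: if_splits)
  let ?s = "\<lambda>n. interleave (\<lambda>_. emp) c (r n)"
  have "(\<lambda>i. (?s(0 := x, 1 := y)) (r i)) = interleave ((\<lambda>_. emp)(0 := x, 1 := y)) c" for x y
    by (rule interleave_eqI[symmetric]) (auto simp: r_def interleave_def)
  then have "sat E M (?s(0 := x, 1 := y)) (rename_fm r p) \<longleftrightarrow> R x y" if "x \<in> M" "y \<in> M" for x y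
    using p[of "(\<lambda>_. emp)(0 := x, 1 := y)"] that by (simp add: sat_rename_fm[OF \<open>inj r\<close>] image_subset_iff)
  moreover have "range ?s \<subseteq> M"
    using c by (auto simp: interleave_def)
  ultimately show thesis using that by blast
qed

text \<open>Comprehension as a total operation: for a class that is not a set the value is
  \<open>emp\<close>. It is thus a definable term without conditions, and existence is supplied
  separately through \<open>El_mkset\<close>.\<close>

definition mkset :: "('v \<Rightarrow> bool) \<Rightarrow> 'v" where
  "mkset P = the_M (\<lambda>a. \<forall>x\<in>M. x \<epsilon> a \<longleftrightarrow> P x)"

lemma mkset_M [simp]: "mkset P \<in> M"
  by (simp add: mkset_def)

lemma T_mkset [dfb]:
  assumes "D (\<lambda>s. P (\<lambda>n. s (Suc n)) (s 0))"
  shows "T (\<lambda>s. mkset (P s))"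
  unfolding mkset_def by (intro dfb D_Suc2[where P = P] assms)

lemma El_mkset:
  assumes "b \<in> M" and "\<And>x. x \<epsilon> b \<longleftrightarrow> x \<in> M \<and> P x"
  shows "El (mkset P) = {x\<in>M. P x}"
proof -
  have "mkset P = b"
    unfolding mkset_def
    by (rule the_M_eq) (use assms mem_M in \<open>auto simp: El_inject[symmetric] set_eq_iff\<close>)
  then show ?thesis by (simp add: El_def assms(2))
qed

lemma El_sep:
  assumes "dpred P" and "a \<in> M"
  shows "El (mkset (\<lambda>x. x \<epsilon> a \<and> P x)) = {x\<in>El a. P x}"
proof -
  have "drel (\<lambda>x y. P x)"
    using assms(1) by (simp add: drel_def dpred_def)
  then obtain p s where s: "range s \<subseteq> M"
    and p: "\<And>x y. x \<in> M \<Longrightarrow> y \<in> M \<Longrightarrow> sat E M (s(0 := x, 1 := y)) p \<longleftrightarrow> P x"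
    by (rule drel_formula) blast
  have "sat E M (s(0 := x)) p \<longleftrightarrow> P x" if "x \<in> M" for x
    using p[OF that, of "s 1"] s by (auto simp: fun_upd_idem)
  moreover have "ax_separation E M"
    using zf by (simp add: ZF_model_def)
  from this[unfolded ax_separation_def, THEN spec[of _ p], THEN spec[of _ s], THEN mp, OF s,
      THEN bspec, OF assms(2)]
  obtain b where "b \<in> M" "\<forall>x\<in>M. x \<epsilon> b \<longleftrightarrow> x \<epsilon> a \<and> sat E M (s(0 := x)) p"
    by blast
  ultimately show ?thesis
    using assms(2) mem_M by (subst El_mkset[of b]) auto
qed

lemma El_img:
  assumes "dfn F" and "a \<in> M"
  shows "El (mkset (\<lambda>y. \<exists>x\<in>El a. y = F x)) = F ` El a"
proof -
  have "drel (\<lambda>x y. y = F x)"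
    unfolding drel_def by (rule dfb dfn_app[OF assms(1)])+
  then obtain p s where s: "range s \<subseteq> M"
    and p: "\<And>x y. x \<in> M \<Longrightarrow> y \<in> M \<Longrightarrow> sat E M (s(0 := x, 1 := y)) p \<longleftrightarrow> y = F x"
    by (rule drel_formula) blast
  have fn: "\<forall>x\<in>M. \<forall>y\<in>M. \<forall>z\<in>M. x \<epsilon> a \<and>
              sat E M (s(0 := x, 1 := y)) p \<and> sat E M (s(0 := x, 1 := z)) p \<longrightarrow> y = z"
    using p by simp
  have "ax_replacement E M"
    using zf by (simp add: ZF_model_def)
  from this[unfolded ax_replacement_def, THEN spec[of _ p], THEN spec[of _ s], THEN mp, OF s,
      THEN bspec, OF assms(2), THEN mp, OF fn]
  obtain b where b: "b \<in> M" "\<forall>y\<in>M. y \<epsilon> b \<longleftrightarrow> (\<exists>x\<in>M. x \<epsilon> a \<and> sat E M (s(0 := x, 1 := y)) p)"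
    by blast
  have "El (mkset (\<lambda>y. \<exists>x\<in>El a. y = F x)) = {y\<in>M. \<exists>x\<in>El a. y = F x}"
    by (rule El_mkset[OF b(1)]) (metis b assms(2) mem_El mem_M p)
  also have "\<dots> = F ` El a"
    using dfn_M[OF assms(1)] mem_M[OF _ assms(2)] by auto
  finally show ?thesis .
qed

section \<open>Pairs\<close>

lemma ex_upair: "a \<in> M \<Longrightarrow> b \<in> M \<Longrightarrow> \<exists>p\<in>M. El p = {a, b}"
proof -
  assume ab: "a \<in> M" "b \<in> M"
  then obtain p where "p \<in> M" "is_upair E M a b p"
    using zf by (auto simp: ZF_model_def ax_pairing_def)
  then have "El p = {a, b}"
    using ab mem_M by (auto simp: is_upair_def)
  with \<open>p \<in> M\<close> show ?thesis by blast
qed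

lemma is_upair_iff: "a \<in> M \<Longrightarrow> b \<in> M \<Longrightarrow> p \<in> M \<Longrightarrow> is_upair E M a b p \<longleftrightarrow> El p = {a, b}"
  using mem_M by (auto simp: is_upair_def)

lemma is_subset_iff: "a \<in> M \<Longrightarrow> is_subset E M a b \<longleftrightarrow> El a \<subseteq> El b"
  using mem_M by (auto simp: is_subset_def)

definition pair :: "'v \<Rightarrow> 'v \<Rightarrow> 'v" where
  "pair a b = the_M (\<lambda>p. is_pair E M a b p)"

lemma is_pair_iff:
  assumes "a \<in> M" "b \<in> M" "p \<in> M" shows "is_pair E M a b p \<longleftrightarrow> p = pair a b"
proof -
  have *: "is_pair E M a b p \<longleftrightarrow> (\<exists>u\<in>M. \<exists>v\<in>M. El u = {a} \<and> El v = {a, b} \<and> El p = {u, v})"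
    if "p \<in> M" for p
    using that assms by (simp add: is_pair_def is_upair_iff)
  obtain u v where "u \<in> M" "El u = {a}" "v \<in> M" "El v = {a, b}"
    using ex_upair[OF assms(1,1)] ex_upair[OF assms(1,2)] by auto
  moreover then obtain q where "q \<in> M" "El q = {u, v}"
    using ex_upair by blast
  ultimately have q: "is_pair E M a b q" "q \<in> M"
    using * by blast+
  have "p = p'" if "is_pair E M a b p" "is_pair E M a b p'" "p \<in> M" "p' \<in> M" for p p'
    using that * by (metis El_inject)
  then show ?thesis
    using q assms the_M_eq[of "is_pair E M a b" q] unfolding pair_def by metis
qed

lemma pair_M [simp]: "pair a b \<in> M"
  by (simp add: pair_def)

lemma pair_inject [simp]:
  assumes "a \<in> M" "b \<in> M" "a' \<in> M" "b' \<in> M"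
  shows "pair a b = pair a' b' \<longleftrightarrow> a = a' \<and> b = b'"
proof
  assume eq: "pair a b = pair a' b'"
  have "is_pair E M a b (pair a b)" "is_pair E M a' b' (pair a b)"
    using assms eq is_pair_iff by auto
  then obtain u v u' v' where "El u = {a}" "El v = {a, b}" "El (pair a b) = {u, v}"
    "El u' = {a'}" "El v' = {a', b'}" "El (pair a b) = {u', v'}"
    using assms by (auto simp: is_pair_def is_upair_iff)
  then show "a = a' \<and> b = b'"
    by (metis doubleton_eq_iff insert_absorb2)
qed auto

lemma D_subst3:
  assumes R: "D (\<lambda>s. R (s 0) (s 1) (s 2))" and t: "T t" and u: "T u" and v: "T v"
  shows "D (\<lambda>s. R (t s) (u s) (v s))"
proof -
  have "D (\<lambda>s. R (s 0) (s (Suc 0)) (s (Suc (Suc 0))))"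
    using R by (simp add: numeral_2_eq_2)
  then have "D (\<lambda>s. R (t (\<lambda>n. s (Suc (Suc n)))) (s 0) (s 1))"
    using D_let[of "\<lambda>s x. R x (s 0) (s 1)", OF _ T_Suc[OF T_Suc[OF t]]] by simp
  then have "D (\<lambda>s. R (t (\<lambda>n. s (Suc n))) (u (\<lambda>n. s (Suc n))) (s 0))"
    using D_let[of "\<lambda>s x. R (t (\<lambda>n. s (Suc n))) x (s 0)", OF _ T_Suc[OF u]] by simp
  then show ?thesis
    using D_let[of "\<lambda>s x. R (t s) (u s) x", OF _ v] by simp
qed

lemma T_subst2:
  assumes F: "T (\<lambda>s. F (s 0) (s 1))" and t: "T t" and u: "T u"
  shows "T (\<lambda>s. F (t s) (u s))"
  unfolding definable_term_def
proof (intro conjI allI impI)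
  fix s :: "nat \<Rightarrow> 'v" assume "range s \<subseteq> M"
  then have "range (case_nat (t s) (\<lambda>_. u s)) \<subseteq> M"
    using definable_term_in[OF t] definable_term_in[OF u] by (auto split: nat.splits)
  from definable_term_in[OF F this] show "F (t s) (u s) \<in> M" by simp
next
  have "D (\<lambda>s. s 0 = F (s 1) (s 2))"
    using F by (simp add: definable_term_def numeral_2_eq_2)
  then show "D (\<lambda>s. s 0 = F (t (\<lambda>n. s (Suc n))) (u (\<lambda>n. s (Suc n))))"
    using D_subst3[of "\<lambda>z x y. z = F x y", OF _ T_var T_Suc[OF t] T_Suc[OF u]] by simp
qed

section \<open>Definability of the notions computed in the model\<close>

lemma D_is_empty [dfb]: "T t \<Longrightarrow> D (\<lambda>s. is_empty E M (t s))"
  by (rule dpred_app[of "is_empty E M"]) (unfold dpred_def is_empty_def, (rule dfb)+)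

lemma D_is_subset [dfb]: "T t \<Longrightarrow> T u \<Longrightarrow> D (\<lambda>s. is_subset E M (t s) (u s))"
  by (rule drel_app[of "is_subset E M"]) (unfold drel_def is_subset_def, (rule dfb)+)

lemma D_is_upair [dfb]: "T t \<Longrightarrow> T u \<Longrightarrow> T v \<Longrightarrow> D (\<lambda>s. is_upair E M (t s) (u s) (v s))"
  by (rule D_subst3[of "is_upair E M"]) (unfold is_upair_def, (rule dfb)+)

lemma D_is_pair [dfb]: "T t \<Longrightarrow> T u \<Longrightarrow> T v \<Longrightarrow> D (\<lambda>s. is_pair E M (t s) (u s) (v s))"
  by (rule D_subst3[of "is_pair E M"]) (unfold is_pair_def, (rule dfb)+)

lemma D_has_value [dfb]: "T t \<Longrightarrow> T u \<Longrightarrow> T v \<Longrightarrow> D (\<lambda>s. has_value E M (t s) (u s) (v s))"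
  by (rule D_subst3[of "has_value E M"]) (unfold has_value_def, (rule dfb)+)

lemma D_is_function [dfb]: "T t \<Longrightarrow> T u \<Longrightarrow> T v \<Longrightarrow> D (\<lambda>s. is_function E M (t s) (u s) (v s))"
  by (rule D_subst3[of "is_function E M"]) (unfold is_function_def, (rule dfb)+)

lemma D_is_injection [dfb]: "T t \<Longrightarrow> T u \<Longrightarrow> T v \<Longrightarrow> D (\<lambda>s. is_injection E M (t s) (u s) (v s))"
  by (rule D_subst3[of "is_injection E M"]) (unfold is_injection_def, (rule dfb)+)

lemma D_is_surjection [dfb]: "T t \<Longrightarrow> T u \<Longrightarrow> T v \<Longrightarrow> D (\<lambda>s. is_surjection E M (t s) (u s) (v s))"
  by (rule D_subst3[of "is_surjection E M"]) (unfold is_surjection_def, (rule dfb)+)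

lemma D_is_bijection [dfb]: "T t \<Longrightarrow> T u \<Longrightarrow> T v \<Longrightarrow> D (\<lambda>s. is_bijection E M (t s) (u s) (v s))"
  by (rule D_subst3[of "is_bijection E M"]) (unfold is_bijection_def, (rule dfb)+)

lemma D_is_transitive_set [dfb]: "T t \<Longrightarrow> D (\<lambda>s. is_transitive_set E M (t s))"
  by (rule dpred_app[of "is_transitive_set E M"]) (unfold dpred_def is_transitive_set_def, (rule dfb)+)

lemma D_wellordered_by_mem [dfb]: "T t \<Longrightarrow> D (\<lambda>s. wellordered_by_mem E M (t s))"
  by (rule dpred_app[of "wellordered_by_mem E M"]) (unfold dpred_def wellordered_by_mem_def, (rule dfb)+)

lemma D_is_ordinal [dfb]: "T t \<Longrightarrow> D (\<lambda>s. is_ordinal E M (t s))"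
  by (rule dpred_app[of "is_ordinal E M"]) (unfold dpred_def is_ordinal_def, (rule dfb)+)

lemma D_ord_le [dfb]: "T t \<Longrightarrow> T u \<Longrightarrow> D (\<lambda>s. ord_le E (t s) (u s))"
  by (rule drel_app[of "ord_le E"]) (unfold drel_def ord_le_def, (rule dfb)+)

lemma D_is_cardinal [dfb]: "T t \<Longrightarrow> D (\<lambda>s. is_cardinal E M (t s))"
  by (rule dpred_app[of "is_cardinal E M"]) (unfold dpred_def is_cardinal_def, (rule dfb)+)

lemma D_is_cofinal_map [dfb]: "T t \<Longrightarrow> T u \<Longrightarrow> T v \<Longrightarrow> D (\<lambda>s. is_cofinal_map E M (t s) (u s) (v s))"
  by (rule D_subst3[of "is_cofinal_map E M"]) (unfold is_cofinal_map_def, (rule dfb)+)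

lemma D_is_card_succ [dfb]: "T t \<Longrightarrow> T u \<Longrightarrow> D (\<lambda>s. is_card_succ E M (t s) (u s))"
  by (rule drel_app[of "is_card_succ E M"]) (unfold drel_def is_card_succ_def is_least_ordinal_def, (rule dfb)+)

lemma D_is_cf [dfb]: "T t \<Longrightarrow> T u \<Longrightarrow> D (\<lambda>s. is_cf E M (t s) (u s))"
  by (rule drel_app[of "is_cf E M"]) (unfold drel_def is_cf_def is_least_ordinal_def, (rule dfb)+)

lemma D_is_hartogs [dfb]: "T t \<Longrightarrow> T u \<Longrightarrow> D (\<lambda>s. is_hartogs E M (t s) (u s))"
  by (rule drel_app[of "is_hartogs E M"]) (unfold drel_def is_hartogs_def is_least_ordinal_def, (rule dfb)+)

lemma D_is_lindenbaum [dfb]: "T t \<Longrightarrow> T u \<Longrightarrow> D (\<lambda>s. is_lindenbaum E M (t s) (u s))"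
  by (rule drel_app[of "is_lindenbaum E M"]) (unfold drel_def is_lindenbaum_def is_least_ordinal_def, (rule dfb)+)

lemma T_pair [dfb]: "T t \<Longrightarrow> T u \<Longrightarrow> T (\<lambda>s. pair (t s) (u s))"
  by (rule T_subst2[of pair]) (unfold pair_def, (rule dfb)+)

lemma separation:
  assumes "dpred P" and "a \<in> M"
  obtains b where "b \<in> M" "El b = {x\<in>El a. P x}"
  using El_sep[OF assms] by (rule that[rotated]) simp

lemma replacement:
  assumes "dfn F" and "a \<in> M"
  obtains b where "b \<in> M" "El b = F ` El a"
  using El_img[OF assms] by (rule that[rotated]) simp

definition pfst :: "'v \<Rightarrow> 'v" where "pfst p = the_M (\<lambda>a. \<exists>b\<in>M. p = pair a b)"
definition psnd :: "'v \<Rightarrow> 'v" where "psnd p = the_M (\<lambda>b. \<exists>a\<in>M. p = pair a b)"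

lemma pfst_pair [simp]: "a \<in> M \<Longrightarrow> b \<in> M \<Longrightarrow> pfst (pair a b) = a"
  unfolding pfst_def by (rule the_M_eq) auto

lemma psnd_pair [simp]: "a \<in> M \<Longrightarrow> b \<in> M \<Longrightarrow> psnd (pair a b) = b"
  unfolding psnd_def by (rule the_M_eq) auto

lemma dfn_pfst: "dfn pfst" and dfn_psnd: "dfn psnd"
  unfolding dfn_def pfst_def psnd_def by (rule dfb)+

lemmas T_pfst [dfb] = dfn_app[OF dfn_pfst]
lemmas T_psnd [dfb] = dfn_app[OF dfn_psnd]

definition Unn :: "'v \<Rightarrow> 'v" where "Unn a = mkset (\<lambda>x. \<exists>y\<in>El a. x \<epsilon> y)"
definition Power :: "'v \<Rightarrow> 'v" where "Power a = mkset (\<lambda>x. is_subset E M x a)"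
definition prod :: "'v \<Rightarrow> 'v \<Rightarrow> 'v" where
  "prod a b = mkset (\<lambda>p. \<exists>x\<in>El a. \<exists>y\<in>El b. p = pair x y)"
text \<open>With both arguments equal this is the ordinal successor.\<close>

definition ins :: "'v \<Rightarrow> 'v \<Rightarrow> 'v" where "ins x a = mkset (\<lambda>z. z = x \<or> z \<epsilon> a)"

lemma set_ops_M [simp]: "Unn a \<in> M" "Power a \<in> M" "prod a b \<in> M" "ins x a \<in> M" "pfst p \<in> M" "psnd p \<in> M"
  by (simp_all add: Unn_def Power_def prod_def ins_def pfst_def psnd_def)

lemma T_ins [dfb]: "T t \<Longrightarrow> T u \<Longrightarrow> T (\<lambda>s. ins (t s) (u s))"
  by (rule T_subst2[of ins]) (unfold ins_def, (rule dfb)+)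

lemma El_Unn [simp]: "a \<in> M \<Longrightarrow> El (Unn a) = (\<Union>y\<in>El a. El y)"
proof -
  assume a: "a \<in> M"
  have "ax_union E M" using zf by (simp add: ZF_model_def)
  from this[unfolded ax_union_def, THEN bspec, OF a]
  obtain u where u: "u \<in> M" "\<forall>z\<in>M. z \<epsilon> u \<longleftrightarrow> (\<exists>y\<in>M. y \<epsilon> a \<and> z \<epsilon> y)"
    by (rule bexE)
  have "El (Unn a) = {x\<in>M. \<exists>y\<in>El a. x \<epsilon> y}"
    unfolding Unn_def using a u mem_M by (intro El_mkset[OF u(1)]) (metis mem_El)
  then show ?thesis using a mem_M by fastforce
qed

lemma El_Power [simp]: "a \<in> M \<Longrightarrow> El (Power a) = {x\<in>M. El x \<subseteq> El a}"
proof -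
  assume a: "a \<in> M"
  have "ax_power_set E M" using zf by (simp add: ZF_model_def)
  from this[unfolded ax_power_set_def, THEN bspec, OF a]
  obtain u where u: "u \<in> M" "\<forall>z\<in>M. z \<epsilon> u \<longleftrightarrow> is_subset E M z a"
    by (rule bexE)
  have "El (Power a) = {x\<in>M. is_subset E M x a}"
    unfolding Power_def using a u mem_M by (intro El_mkset[OF u(1)]) metis
  then show ?thesis by (simp add: is_subset_iff cong: conj_cong)
qed

lemma El_ins [simp]:
  assumes "x \<in> M" "a \<in> M"
  shows "El (ins x a) = insert x (El a)"
proof -
  obtain p where p: "p \<in> M" "El p = {x, x}" using ex_upair assms(1) by blast
  obtain q where q: "q \<in> M" "El q = {p, a}" using ex_upair[OF p(1) assms(2)] by blast
  have "x \<in> M" if "x \<epsilon> a" for x using that assms(2) mem_M by blast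
  moreover have "El (ins x a) = {z\<in>M. z = x \<or> z \<epsilon> a}"
    unfolding ins_def
    by (rule El_mkset[of "Unn q"]) (use p q assms mem_M in \<open>auto simp flip: mem_El\<close>)
  ultimately show ?thesis using assms by auto
qed

lemma El_prod [simp]:
  assumes a: "a \<in> M" and b: "b \<in> M"
  shows "El (prod a b) = (\<lambda>(x, y). pair x y) ` (El a \<times> El b)"
proof -
  \<comment> \<open>\<open>G x\<close> is the row of the product over \<open>x\<close>. Replacement
    collects the rows, and their union is the product.\<close>
  define G where "G x = mkset (\<lambda>p. \<exists>y\<in>El b. p = pair x y)" for x
  have "dfn G"
    unfolding dfn_def G_def using b by - (assumption | rule dfb T_const)+
  then obtain c where c: "c \<in> M" "El c = G ` El a"
    using replacement a by blast
  have G: "El (G x) = pair x ` El b" if "x \<in> M" for x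
  proof -
    have "dfn (pair x)"
      unfolding dfn_def using that by - (assumption | rule dfb T_const)+
    then show ?thesis unfolding G_def using El_img b by blast
  qed
  have "El (prod a b) = {p\<in>M. \<exists>x\<in>El a. \<exists>y\<in>El b. p = pair x y}"
    unfolding prod_def
  proof (rule El_mkset[of "Unn c"])
    fix p show "p \<epsilon> Unn c \<longleftrightarrow> p \<in> M \<and> (\<exists>x\<in>El a. \<exists>y\<in>El b. p = pair x y)"
    proof -
      have "p \<epsilon> Unn c \<longleftrightarrow> p \<in> (\<Union>x\<in>El a. El (G x))"
        using El_Unn[OF c(1)] c(2) by (simp flip: mem_El)
      also have "\<dots> \<longleftrightarrow> p \<in> (\<Union>x\<in>El a. pair x ` El b)"
        using G mem_M[OF _ a] by auto
      finally show ?thesis by auto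
    qed
  qed simp
  then show ?thesis by auto
qed

lemma mem_Power [simp]: "a \<in> M \<Longrightarrow> x \<epsilon> Power a \<longleftrightarrow> x \<in> M \<and> El x \<subseteq> El a"
  using El_Power[of a] by (simp add: El_def set_eq_iff)

lemma mem_ins [simp]: "x \<in> M \<Longrightarrow> a \<in> M \<Longrightarrow> z \<epsilon> ins x a \<longleftrightarrow> z = x \<or> z \<epsilon> a"
  using El_ins[of x a] by (auto simp: El_def set_eq_iff)

lemma mem_prod: "a \<in> M \<Longrightarrow> b \<in> M \<Longrightarrow> p \<epsilon> prod a b \<longleftrightarrow> (\<exists>x y. x \<epsilon> a \<and> y \<epsilon> b \<and> p = pair x y)"
  using El_prod[of a b] by (auto simp: El_def set_eq_iff image_iff)

lemma pair_in_prod [simp]: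
  assumes "a \<in> M" "b \<in> M" "x \<in> M" "y \<in> M"
  shows "pair x y \<epsilon> prod a b \<longleftrightarrow> x \<epsilon> a \<and> y \<epsilon> b"
  using assms mem_M by (auto simp: mem_prod)

lemma in_prodE:
  assumes "p \<epsilon> prod a b" "a \<in> M" "b \<in> M"
  obtains x y where "x \<in> M" "y \<in> M" "x \<epsilon> a" "y \<epsilon> b" "p = pair x y"
  using assms mem_M by (auto simp: mem_prod)

lemma is_product_iff:
  assumes "a \<in> M" "b \<in> M" "c \<in> M"
  shows "is_product E M a b c \<longleftrightarrow> c = prod a b"
proof -
  have "is_product E M a b c \<longleftrightarrow> (\<forall>p\<in>M. p \<epsilon> c \<longleftrightarrow> p \<epsilon> prod a b)"
    unfolding is_product_def mem_prod[OF assms(1,2)] using assms(1,2) mem_M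
    by (intro ball_cong refl) (metis is_pair_iff)
  also have "\<dots> \<longleftrightarrow> El c = El (prod a b)"
    using assms mem_M[of _ c] mem_M[of _ "prod a b"] by (auto simp del: El_prod)
  finally show ?thesis by (simp only: El_inject)
qed


subsection \<open>Functions of the model as definable functions\<close>

definition app :: "'v \<Rightarrow> 'v \<Rightarrow> 'v" where "app f x = the_M (\<lambda>y. has_value E M f x y)"

lemma app_M [simp]: "app f x \<in> M"
  by (simp add: app_def)

lemma T_app [dfb]: "T t \<Longrightarrow> T u \<Longrightarrow> T (\<lambda>s. app (t s) (u s))"
  by (rule T_subst2[of app]) (unfold app_def, (rule dfb)+)

lemma dfn_app_set: "f \<in> M \<Longrightarrow> dfn (app f)"
  unfolding dfn_def by (assumption | rule dfb T_const)+

lemma has_value_iff: "x \<in> M \<Longrightarrow> y \<in> M \<Longrightarrow> has_value E M f x y \<longleftrightarrow> pair x y \<epsilon> f"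
  by (auto simp: has_value_def is_pair_iff)

lemma function_app:
  assumes "is_function E M f a b" "f \<in> M" "a \<in> M" "b \<in> M" "x \<epsilon> a"
  shows "app f x \<epsilon> b" and "y \<in> M \<Longrightarrow> has_value E M f x y \<longleftrightarrow> y = app f x"
proof -
  have x: "x \<in> M" using assms mem_M by blast
  have "\<exists>!y. y \<in> M \<and> has_value E M f x y"
    using assms x by (simp add: is_function_def)
  then obtain z where z: "z \<in> M" "has_value E M f x z"
    and uniq: "\<And>y. y \<in> M \<Longrightarrow> has_value E M f x y \<Longrightarrow> y = z"
    by blast
  have eq: "app f x = z"
    unfolding app_def by (rule the_M_eq[where P = "has_value E M f x", OF z(2,1) uniq])
  show "has_value E M f x y \<longleftrightarrow> y = app f x" if "y \<in> M"
    using z uniq eq that by metis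
  have "pair x z \<epsilon> f" using z x by (simp add: has_value_iff)
  then obtain x' y' where "x' \<in> M" "y' \<in> M" "x' \<epsilon> a" "y' \<epsilon> b" "is_pair E M x' y' (pair x z)"
    using assms(1) unfolding is_function_def by (meson pair_M)
  then show "app f x \<epsilon> b"
    using x z eq by (simp add: is_pair_iff)
qed

lemma function_dom:
  assumes "is_function E M f a b" "x \<in> M" "y \<in> M" "has_value E M f x y"
  shows "x \<epsilon> a" "y \<epsilon> b"
proof -
  have "pair x y \<epsilon> f" using assms by (simp add: has_value_iff)
  then obtain x' y' where "x' \<in> M" "y' \<in> M" "x' \<epsilon> a" "y' \<epsilon> b" "is_pair E M x' y' (pair x y)"
    using assms(1) unfolding is_function_def by (meson pair_M)
  then show "x \<epsilon> a" "y \<epsilon> b"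
    using assms by (simp_all add: is_pair_iff)
qed

lemma graph:
  assumes "dfn F" "a \<in> M" "b \<in> M" "F ` El a \<subseteq> El b"
  obtains f where "f \<in> M" "is_function E M f a b"
    "\<And>x y. x \<in> M \<Longrightarrow> y \<in> M \<Longrightarrow> has_value E M f x y \<longleftrightarrow> x \<epsilon> a \<and> y = F x"
proof -
  have "dfn (\<lambda>x. pair x (F x))"
    unfolding dfn_def by (rule dfb dfn_app[OF assms(1)])+
  then obtain f where f: "f \<in> M" "El f = (\<lambda>x. pair x (F x)) ` El a"
    using replacement assms(2) by blast
  have mem: "p \<epsilon> f \<longleftrightarrow> (\<exists>x. x \<epsilon> a \<and> p = pair x (F x))" for p
    using f(2) by (auto simp: El_def set_eq_iff)
  have FM: "x \<in> M \<Longrightarrow> F x \<in> M" for x using dfn_M assms(1) by blast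
  have hv: "has_value E M f x y \<longleftrightarrow> x \<epsilon> a \<and> y = F x" if "x \<in> M" "y \<in> M" for x y
    using that FM assms(2) mem_M by (auto simp: has_value_iff mem)
  have "is_function E M f a b"
    unfolding is_function_def
  proof (intro conjI ballI impI)
    fix p assume "p \<in> M" "p \<epsilon> f"
    then obtain x where x: "x \<epsilon> a" "p = pair x (F x)" using mem by blast
    then have "x \<in> M" "F x \<epsilon> b" using assms(2,4) mem_M by (auto simp: image_subset_iff)
    then show "\<exists>x\<in>M. \<exists>y\<in>M. x \<epsilon> a \<and> y \<epsilon> b \<and> is_pair E M x y p"
      using x FM is_pair_iff pair_M by metis
  next
    fix x assume "x \<in> M" "x \<epsilon> a"
    then show "\<exists>!y. y \<in> M \<and> has_value E M f x y" using hv FM by metis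
  qed
  with f(1) hv show thesis using that by blast
qed

text \<open>Existence of a map is stated with class functions restricted to a set instead of sets of
  pairs. By replacement the restriction has a graph in \<open>M\<close>, so the meaning is the
  internal one; \<open>injection_iff\<close>, \<open>surjection_iff\<close> and
  \<open>bijection_iff\<close> record this.\<close>

definition emb :: "'v \<Rightarrow> 'v \<Rightarrow> bool" where
  "emb a b \<longleftrightarrow> (\<exists>F. dfn F \<and> F ` El a \<subseteq> El b \<and> inj_on F (El a))"

definition onto :: "'v \<Rightarrow> 'v \<Rightarrow> bool" where
  "onto a b \<longleftrightarrow> (\<exists>F. dfn F \<and> F ` El a = El b)"

definition eqp :: "'v \<Rightarrow> 'v \<Rightarrow> bool" where
  "eqp a b \<longleftrightarrow> (\<exists>F. dfn F \<and> bij_betw F (El a) (El b))"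

lemma is_function_dfn:
  assumes "is_function E M f a b" "f \<in> M" "a \<in> M" "b \<in> M"
  shows "dfn (app f)" "app f ` El a \<subseteq> El b"
    "x \<in> M \<Longrightarrow> y \<in> M \<Longrightarrow> has_value E M f x y \<longleftrightarrow> x \<epsilon> a \<and> y = app f x"
proof -
  show "dfn (app f)" using dfn_app_set[OF assms(2)] .
  show "app f ` El a \<subseteq> El b" using function_app(1)[OF assms] by auto
  show "x \<in> M \<Longrightarrow> y \<in> M \<Longrightarrow> has_value E M f x y \<longleftrightarrow> x \<epsilon> a \<and> y = app f x"
    using function_app(2)[OF assms] function_dom[OF assms(1)] by metis
qed

lemma graph_app:
  assumes "dfn F" "a \<in> M" "b \<in> M" "F ` El a \<subseteq> El b"
  obtains f where "f \<in> M" "is_function E M f a b" "\<forall>x. x \<epsilon> a \<longrightarrow> app f x = F x"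
proof -
  obtain f where f: "f \<in> M" "is_function E M f a b"
    "\<And>x y. x \<in> M \<Longrightarrow> y \<in> M \<Longrightarrow> has_value E M f x y \<longleftrightarrow> x \<epsilon> a \<and> y = F x"
    by (rule graph[OF assms]) blast
  have "app f x = F x" if "x \<epsilon> a" for x
  proof -
    have M: "x \<in> M" "F x \<in> M" using that assms(2) mem_M dfn_M[OF assms(1)] by blast+
    then show ?thesis using f(3)[OF M] is_function_dfn(3)[OF f(2,1) assms(2,3) M] that by simp
  qed
  then show thesis using that f(1,2) by blast
qed

lemma is_injection_iff:
  assumes "f \<in> M" "a \<in> M" "b \<in> M"
  shows "is_injection E M f a b \<longleftrightarrow> is_function E M f a b \<and> inj_on (app f) (El a)"
  unfolding is_injection_def
proof (rule conj_cong[OF refl])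
  assume "is_function E M f a b"
  note hv = is_function_dfn(3)[OF this assms]
  have "(\<forall>x\<in>M. \<forall>x'\<in>M. \<forall>y\<in>M. has_value E M f x y \<and> has_value E M f x' y \<longrightarrow> x = x') \<longleftrightarrow>
      (\<forall>x\<in>M. \<forall>x'\<in>M. \<forall>y\<in>M. (x \<epsilon> a \<and> y = app f x) \<and> x' \<epsilon> a \<and> y = app f x' \<longrightarrow> x = x')"
    using hv by simp
  also have "\<dots> \<longleftrightarrow> inj_on (app f) (El a)"
    unfolding inj_on_def using mem_M[OF _ assms(2)] by auto
  finally show "(\<forall>x\<in>M. \<forall>x'\<in>M. \<forall>y\<in>M. has_value E M f x y \<and> has_value E M f x' y \<longrightarrow> x = x') \<longleftrightarrow>
      inj_on (app f) (El a)" .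
qed

lemma is_surjection_iff:
  assumes "f \<in> M" "a \<in> M" "b \<in> M"
  shows "is_surjection E M f a b \<longleftrightarrow> is_function E M f a b \<and> app f ` El a = El b"
  unfolding is_surjection_def
proof (rule conj_cong[OF refl])
  assume fn: "is_function E M f a b"
  note hv = is_function_dfn(3)[OF this assms]
  have "(\<forall>y\<in>M. y \<epsilon> b \<longrightarrow> (\<exists>x\<in>M. x \<epsilon> a \<and> has_value E M f x y)) \<longleftrightarrow>
      (\<forall>y\<in>M. y \<epsilon> b \<longrightarrow> (\<exists>x\<in>M. x \<epsilon> a \<and> y = app f x))"
    using hv by (simp cong: bex_cong)
  also have "\<dots> \<longleftrightarrow> El b \<subseteq> app f ` El a"
    using mem_M[OF _ assms(2)] mem_M[OF _ assms(3)]
    unfolding subset_iff image_iff Bex_def Ball_def mem_El by blast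
  also have "\<dots> \<longleftrightarrow> app f ` El a = El b"
    using is_function_dfn(2)[OF fn assms] by blast
  finally show "(\<forall>y\<in>M. y \<epsilon> b \<longrightarrow> (\<exists>x\<in>M. x \<epsilon> a \<and> has_value E M f x y)) \<longleftrightarrow> app f ` El a = El b" .
qed

text \<open>Passing to a graph forgets \<open>F\<close> outside \<open>a\<close>, hence the
  condition that \<open>Q\<close> depends only on the values there.\<close>

lemma ex_function_iff:
  assumes "a \<in> M" "b \<in> M" and Q: "\<And>F G. (\<forall>x\<in>El a. F x = G x) \<Longrightarrow> Q F \<longleftrightarrow> Q G"
  shows "(\<exists>f\<in>M. is_function E M f a b \<and> Q (app f)) \<longleftrightarrow> (\<exists>F. dfn F \<and> F ` El a \<subseteq> El b \<and> Q F)"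
proof
  assume "\<exists>f\<in>M. is_function E M f a b \<and> Q (app f)"
  then show "\<exists>F. dfn F \<and> F ` El a \<subseteq> El b \<and> Q F"
    using is_function_dfn(1,2) assms(1,2) by blast
next
  assume "\<exists>F. dfn F \<and> F ` El a \<subseteq> El b \<and> Q F"
  then obtain F where F: "dfn F" "F ` El a \<subseteq> El b" "Q F" by blast
  obtain f where f: "f \<in> M" "is_function E M f a b" "\<forall>x. x \<epsilon> a \<longrightarrow> app f x = F x"
    by (rule graph_app[OF F(1) assms(1,2) F(2)])
  then have "Q (app f)" using Q[of "app f" F] F(3) by simp
  with f(1,2) show "\<exists>f\<in>M. is_function E M f a b \<and> Q (app f)" by blast
qed

lemma injection_iff:
  assumes "a \<in> M" "b \<in> M"
  shows "(\<exists>f\<in>M. is_injection E M f a b) \<longleftrightarrow> emb a b"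
proof -
  have "(\<exists>f\<in>M. is_injection E M f a b) \<longleftrightarrow> (\<exists>f\<in>M. is_function E M f a b \<and> inj_on (app f) (El a))"
    using is_injection_iff[OF _ assms] by simp
  also have "\<dots> \<longleftrightarrow> emb a b"
    unfolding emb_def by (rule ex_function_iff[OF assms]) (rule inj_on_cong, blast)
  finally show ?thesis .
qed

lemma surjection_iff:
  assumes "a \<in> M" "b \<in> M"
  shows "(\<exists>f\<in>M. is_surjection E M f a b) \<longleftrightarrow> onto a b"
proof -
  have "(\<exists>f\<in>M. is_surjection E M f a b) \<longleftrightarrow> (\<exists>f\<in>M. is_function E M f a b \<and> app f ` El a = El b)"
    using is_surjection_iff[OF _ assms] by simp
  also have "\<dots> \<longleftrightarrow> (\<exists>F. dfn F \<and> F ` El a \<subseteq> El b \<and> F ` El a = El b)"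
    by (rule ex_function_iff[OF assms]) (metis image_cong)
  also have "\<dots> \<longleftrightarrow> onto a b"
    unfolding onto_def by blast
  finally show ?thesis .
qed

lemma bijection_iff:
  assumes "a \<in> M" "b \<in> M"
  shows "(\<exists>f\<in>M. is_bijection E M f a b) \<longleftrightarrow> eqp a b"
proof -
  have "(\<exists>f\<in>M. is_bijection E M f a b) \<longleftrightarrow>
      (\<exists>f\<in>M. is_function E M f a b \<and> bij_betw (app f) (El a) (El b))"
    using is_injection_iff[OF _ assms] is_surjection_iff[OF _ assms]
    by (auto simp: is_bijection_def bij_betw_def)
  also have "\<dots> \<longleftrightarrow> (\<exists>F. dfn F \<and> F ` El a \<subseteq> El b \<and> bij_betw F (El a) (El b))"
    by (rule ex_function_iff[OF assms]) (rule bij_betw_cong, blast)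
  also have "\<dots> \<longleftrightarrow> eqp a b"
    unfolding eqp_def bij_betw_def by blast
  finally show ?thesis .
qed

lemma dfn_id: "dfn (\<lambda>x. x)"
  unfolding dfn_def by (rule dfb)

lemma emb_subset: "El a \<subseteq> El b \<Longrightarrow> emb a b"
  unfolding emb_def using dfn_id by (intro exI[of _ "\<lambda>x. x"]) auto

lemma emb_trans: assumes "emb a b" "emb b c" shows "emb a c"
proof -
  obtain F G where "dfn F" "F ` El a \<subseteq> El b" "inj_on F (El a)" "dfn G" "G ` El b \<subseteq> El c" "inj_on G (El b)"
    using assms unfolding emb_def by blast
  then show ?thesis
    unfolding emb_def using dfn_comp[of G F]
    by (intro exI[of _ "\<lambda>x. G (F x)"]) (auto simp: inj_on_def image_subset_iff)
qed

lemma onto_trans: assumes "onto a b" "onto b c" shows "onto a c"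
proof -
  obtain F G where "dfn F" "F ` El a = El b" "dfn G" "G ` El b = El c"
    using assms unfolding onto_def by blast
  then show ?thesis
    unfolding onto_def using dfn_comp[of G F] by (intro exI[of _ "\<lambda>x. G (F x)"]) (auto simp flip: image_image)
qed

lemma ex_left_inverse:
  assumes F: "dfn F" "inj_on F (El a)" and "a \<in> M"
  obtains G where "dfn G" "\<And>x. x \<epsilon> a \<Longrightarrow> G (F x) = x"
proof
  show "dfn (\<lambda>y. the_M (\<lambda>x. x \<epsilon> a \<and> F x = y))"
    unfolding dfn_def using \<open>a \<in> M\<close> by - (assumption | rule dfb T_const dfn_app[OF F(1)])+
  show "the_M (\<lambda>z. z \<epsilon> a \<and> F z = F x) = x" if "x \<epsilon> a" for x
    by (rule the_M_eq) (use that F(2) mem_M assms(3) in \<open>auto simp: inj_on_def\<close>)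
qed

lemma eqp_emb: "eqp a b \<Longrightarrow> emb a b"
  unfolding eqp_def emb_def bij_betw_def by blast

lemma eqp_onto: "eqp a b \<Longrightarrow> onto a b"
  unfolding eqp_def onto_def bij_betw_def by blast

lemma eqp_sym: assumes "eqp a b" "a \<in> M" shows "eqp b a"
proof -
  obtain F where F: "dfn F" "inj_on F (El a)" "F ` El a = El b"
    using assms unfolding eqp_def bij_betw_def by blast
  obtain G where G: "dfn G" "\<And>x. x \<epsilon> a \<Longrightarrow> G (F x) = x"
    by (rule ex_left_inverse[OF F(1,2) assms(2)]) blast
  have "bij_betw G (El b) (El a)"
    unfolding bij_betw_def F(3)[symmetric] using G(2) by (force simp: inj_on_def image_image)
  with G(1) show ?thesis unfolding eqp_def by blast
qed

lemma emb_imp_onto: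
  assumes "emb a b" "a \<in> M" "b \<in> M" "a \<noteq> emp"
  shows "onto b a"
proof -
  obtain F where F: "dfn F" "F ` El a \<subseteq> El b" "inj_on F (El a)"
    using assms unfolding emb_def by blast
  obtain G where G: "dfn G" "\<And>x. x \<epsilon> a \<Longrightarrow> G (F x) = x"
    by (rule ex_left_inverse[OF F(1,3) assms(2)]) blast
  obtain z where z: "z \<epsilon> a" using assms(4) by (auto simp: El_inject[symmetric])
  then have "z \<in> M" using assms mem_M by blast
  \<comment> \<open>\<open>z\<close> receives the points at which the left inverse gives nothing in
    \<open>a\<close>.\<close>
  define H where "H y = (if G y \<epsilon> a then G y else z)" for y
  have "dfn H"
    unfolding dfn_def H_def using \<open>z \<in> M\<close> assms(2)
    by - (assumption | rule dfb T_const dfn_app[OF G(1)])+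
  moreover have "H ` El b = El a"
  proof
    show "H ` El b \<subseteq> El a" using z by (auto simp: H_def)
    show "El a \<subseteq> H ` El b"
    proof
      fix x assume "x \<in> El a"
      then have "H (F x) = x" "F x \<in> El b" using G(2) F(2) by (auto simp: H_def image_subset_iff)
      then show "x \<in> H ` El b" by (metis imageI)
    qed
  qed
  ultimately show ?thesis unfolding onto_def by blast
qed

text \<open>A point is sent to its fibre; fibres of a surjection are nonempty and disjoint, hence
  distinct.\<close>

lemma onto_imp_emb_Power:
  assumes "onto a b" "a \<in> M" "b \<in> M"
  shows "emb b (Power a)"
proof -
  obtain F where F: "dfn F" "F ` El a = El b"
    using assms unfolding onto_def by blast
  define G where "G y = mkset (\<lambda>x. x \<epsilon> a \<and> F x = y)" for y
  have "dfn G"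
    unfolding dfn_def G_def using assms(2) by - (assumption | rule dfb T_const dfn_app[OF F(1)])+
  have G: "El (G y) = {x\<in>El a. F x = y}" if "y \<in> M" for y
    unfolding G_def
    by (rule El_sep) (unfold dpred_def, (rule dfb dfn_app[OF F(1)] T_const assms(2) that)+)
  have M: "y \<in> M" if "y \<in> El b" for y using that assms(3) mem_M by auto
  have "G ` El b \<subseteq> El (Power a)"
    using G M assms(2) dfn_M[OF \<open>dfn G\<close>] by auto
  moreover have "inj_on G (El b)"
  proof (rule inj_onI)
    fix y y' assume yy: "y \<in> El b" "y' \<in> El b" "G y = G y'"
    then obtain x where x: "x \<in> El a" "F x = y" using F(2) by (metis imageE)
    then have "x \<in> El (G y)" using G[OF M[OF yy(1)]] by blast
    then show "y = y'" unfolding yy(3) G[OF M[OF yy(2)]] using x(2) by simp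
  qed
  ultimately show ?thesis unfolding emb_def using \<open>dfn G\<close> by blast
qed

lemma emb_Power: assumes "a \<in> M" shows "emb a (Power a)"
proof -
  have "onto a a" unfolding onto_def using dfn_id by (intro exI[of _ "\<lambda>x. x"]) auto
  then show ?thesis using onto_imp_emb_Power assms by blast
qed


section \<open>Ordinals and collapse\<close>

lemma mem_no_3_cycle: "x \<epsilon> y \<Longrightarrow> y \<epsilon> z \<Longrightarrow> \<not> z \<epsilon> x"
  using wf_mem by (induction x arbitrary: y z rule: wfp_induct_rule) blast

text \<open>External foundation gives irreflexivity, least elements and, by excluding cycles of
  length 2 and 3, transitivity of membership. What remains of the definition is that the set is
  transitive and that its elements are pairwise comparable.\<close>

lemma is_ordinal_iff:
  assumes "a \<in> M"
  shows "is_ordinal E M a \<longleftrightarrow>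
    (\<forall>x y. x \<epsilon> a \<longrightarrow> y \<epsilon> x \<longrightarrow> y \<epsilon> a) \<and> (\<forall>x y. x \<epsilon> a \<longrightarrow> y \<epsilon> a \<longrightarrow> x \<epsilon> y \<or> x = y \<or> y \<epsilon> x)"
    (is "_ \<longleftrightarrow> ?t \<and> ?l")
proof
  assume o: "is_ordinal E M a"
  then have "?t"
    unfolding is_ordinal_def is_transitive_set_def is_subset_def using mem_M assms by metis
  moreover have ?l
    using o unfolding is_ordinal_def wellordered_by_mem_def using mem_M assms by metis
  ultimately show "?t \<and> ?l" by simp
next
  assume tl: "?t \<and> ?l"
  then have "is_transitive_set E M a"
    unfolding is_transitive_set_def is_subset_def by blast
  moreover have "wellordered_by_mem E M a"
    unfolding wellordered_by_mem_def
  proof (intro conjI ballI impI)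
    show "\<not> x \<epsilon> x" for x by simp
    show "x \<epsilon> z" if "x \<epsilon> a \<and> y \<epsilon> a \<and> z \<epsilon> a \<and> x \<epsilon> y \<and> y \<epsilon> z" for x y z
      using that tl mem_asym mem_no_3_cycle by metis
    show "x \<epsilon> y \<or> x = y \<or> y \<epsilon> x" if "x \<epsilon> a \<and> y \<epsilon> a" for x y
      using that tl by blast
    show "\<exists>m\<in>M. m \<epsilon> s \<and> (\<forall>y\<in>M. y \<epsilon> s \<longrightarrow> m = y \<or> m \<epsilon> y)"
      if s: "s \<in> M" "is_subset E M s a \<and> \<not> is_empty E M s" for s
    proof -
      have sub: "El s \<subseteq> El a" using s is_subset_iff by blast
      have "El s \<noteq> {}" using s mem_M by (auto simp: is_empty_def)
      then obtain m where m: "m \<in> El s" "\<And>y. y \<epsilon> m \<Longrightarrow> y \<notin> El s"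
        using wf_mem unfolding wfp_iff_ex_minimal by metis
      have "m = y \<or> m \<epsilon> y" if "y \<epsilon> s" for y
        using that m sub tl by (metis mem_El subsetD)
      then show ?thesis using m mem_M s(1) by (metis mem_El)
    qed
  qed
  ultimately show "is_ordinal E M a" unfolding is_ordinal_def by simp
qed

definition Ord :: "'v \<Rightarrow> bool" where "Ord a \<longleftrightarrow> a \<in> M \<and> is_ordinal E M a"

lemma Ord_M [simp]: "Ord a \<Longrightarrow> a \<in> M"
  by (simp add: Ord_def)

lemma Ord_iff: "Ord a \<longleftrightarrow> a \<in> M \<and> (\<forall>x y. x \<epsilon> a \<longrightarrow> y \<epsilon> x \<longrightarrow> y \<epsilon> a) \<and>
    (\<forall>x y. x \<epsilon> a \<longrightarrow> y \<epsilon> a \<longrightarrow> x \<epsilon> y \<or> x = y \<or> y \<epsilon> x)"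
  using is_ordinal_iff Ord_def by blast

lemma D_Ord [dfb]: "T t \<Longrightarrow> D (\<lambda>s. Ord (t s))"
  by (rule definable_cong[OF D_is_ordinal]) (auto simp: Ord_def definable_term_in)

lemma Ord_trans: "Ord a \<Longrightarrow> x \<epsilon> a \<Longrightarrow> y \<epsilon> x \<Longrightarrow> y \<epsilon> a"
  unfolding Ord_iff by blast

lemma Ord_mem: assumes "Ord a" "x \<epsilon> a" shows "Ord x"
  unfolding Ord_iff
proof (intro conjI allI impI)
  show "x \<in> M" using assms mem_M Ord_M by blast
  fix y z
  show "z \<epsilon> x" if "y \<epsilon> x" "z \<epsilon> y"
  proof -
    have "y \<epsilon> a" "z \<epsilon> a" using that assms Ord_trans by blast+
    then have "z \<epsilon> x \<or> z = x \<or> x \<epsilon> z" using assms Ord_iff by blast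
    then show ?thesis using that mem_asym mem_no_3_cycle by metis
  qed
  show "y \<epsilon> z \<or> y = z \<or> z \<epsilon> y" if "y \<epsilon> x" "z \<epsilon> x"
    using that assms unfolding Ord_iff by blast
qed

text \<open>Nested induction on both ordinals: if \<open>a\<close> and \<open>b\<close> were
  incomparable, each element of one would lie in the other, so they would be equal.\<close>

lemma Ord_linear: "Ord a \<Longrightarrow> Ord b \<Longrightarrow> a \<epsilon> b \<or> a = b \<or> b \<epsilon> a"
  using wf_mem
proof (induction a arbitrary: b rule: wfp_induct_rule)
  case (less a)
  note IHa = less.IH and a = less.prems(1)
  show ?case using wf_mem less.prems(2)
  proof (induction b rule: wfp_induct_rule)
    case (less b)
    show ?case
    proof (rule ccontr)
      assume n: "\<not> ?case"
      have "x \<epsilon> b" if "x \<epsilon> a" for x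
        using IHa[OF that Ord_mem[OF a that] less.prems] n that Ord_trans[OF a that] by blast
      moreover have "y \<epsilon> a" if "y \<epsilon> b" for y
        using less.IH[OF that Ord_mem[OF less.prems that]] n that Ord_trans[OF less.prems that] by blast
      ultimately have "El a = El b" by auto
      then show False using n El_inject by blast
    qed
  qed
qed

lemma ord_le_refl [simp]: "ord_le E a a"
  by (simp add: ord_le_def)

lemma not_ord_le: "Ord a \<Longrightarrow> Ord b \<Longrightarrow> \<not> ord_le E a b \<longleftrightarrow> b \<epsilon> a"
  unfolding ord_le_def using Ord_linear mem_asym mem_irrefl by blast

lemma ord_le_subset: "Ord a \<Longrightarrow> Ord b \<Longrightarrow> ord_le E a b \<longleftrightarrow> El a \<subseteq> El b"
proof
  assume "Ord b" "ord_le E a b"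
  then show "El a \<subseteq> El b" unfolding ord_le_def using Ord_trans by auto
next
  assume "Ord a" "Ord b" "El a \<subseteq> El b"
  then show "ord_le E a b" using not_ord_le mem_irrefl by (metis mem_El subsetD)
qed

lemma ord_le_mem_trans: "Ord b \<Longrightarrow> Ord c \<Longrightarrow> ord_le E a b \<Longrightarrow> b \<epsilon> c \<Longrightarrow> a \<epsilon> c"
  unfolding ord_le_def using Ord_trans by blast

lemma mem_ord_le_trans: "Ord c \<Longrightarrow> a \<epsilon> b \<Longrightarrow> ord_le E b c \<Longrightarrow> a \<epsilon> c"
  unfolding ord_le_def using Ord_trans by blast

lemma ord_le_trans: "Ord c \<Longrightarrow> ord_le E a b \<Longrightarrow> ord_le E b c \<Longrightarrow> ord_le E a c"
  unfolding ord_le_def using Ord_trans by blast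

lemma ord_le_antisym: "ord_le E a b \<Longrightarrow> ord_le E b a \<Longrightarrow> a = b"
  unfolding ord_le_def using mem_asym by blast

lemma Ord_transitive_set:
  assumes "a \<in> M" and "\<And>x. x \<epsilon> a \<Longrightarrow> Ord x" and "\<And>x. x \<epsilon> a \<Longrightarrow> El x \<subseteq> El a"
  shows "Ord a"
proof -
  have "y \<epsilon> a" if "x \<epsilon> a" "y \<epsilon> x" for x y using assms(3)[OF that(1)] that(2) by auto
  then show ?thesis unfolding Ord_iff using assms(1,2) Ord_linear by blast
qed

lemma Ord_emp [simp]: "Ord emp"
  by (simp add: Ord_iff)

lemma Ord_succ [simp]: assumes "Ord a" shows "Ord (ins a a)"
proof (rule Ord_transitive_set)
  show "Ord x" if "x \<epsilon> ins a a" for x using that assms Ord_mem by auto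
  show "El x \<subseteq> El (ins a a)" if "x \<epsilon> ins a a" for x using that assms Ord_trans by auto
qed simp

lemma mem_succ_iff: "Ord a \<Longrightarrow> x \<epsilon> ins a a \<longleftrightarrow> ord_le E x a"
  by (auto simp: ord_le_def)

lemma succ_le_iff: "Ord a \<Longrightarrow> Ord b \<Longrightarrow> ord_le E (ins a a) b \<longleftrightarrow> a \<epsilon> b"
  using not_ord_le[of "ins a a" b] not_ord_le[of b a] mem_succ_iff[of a b] Ord_succ by blast

lemma Ord_least:
  assumes "Ord a" "P a"
  obtains b where "Ord b" "P b" "\<And>c. Ord c \<Longrightarrow> P c \<Longrightarrow> ord_le E b c"
proof -
  have "{x. Ord x \<and> P x} \<noteq> {}" using assms by blast
  then obtain b where "Ord b" "P b" "\<And>y. y \<epsilon> b \<Longrightarrow> \<not> (Ord y \<and> P y)"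
    using wf_mem unfolding wfp_iff_ex_minimal by (metis (mono_tags, lifting) mem_Collect_eq)
  then show thesis using that not_ord_le by metis
qed

text \<open>The stand-in for choice: where a witness among ordinals has to be picked definably, the
  least one is taken. If no ordinal satisfies \<open>P\<close>, the value is the default of
  \<open>the_M\<close>.\<close>

definition lst :: "('v \<Rightarrow> bool) \<Rightarrow> 'v" where
  "lst P = the_M (\<lambda>a. Ord a \<and> P a \<and> (\<forall>b\<in>M. Ord b \<longrightarrow> P b \<longrightarrow> ord_le E a b))"

lemma T_lst [dfb]:
  assumes "D (\<lambda>s. P (\<lambda>n. s (Suc n)) (s 0))"
  shows "T (\<lambda>s. lst (P s))"
  unfolding lst_def by (intro dfb D_Suc2[where P = P] assms)

lemma lst:
  assumes "Ord a" "P a"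
  shows "Ord (lst P)" "P (lst P)" "\<And>c. Ord c \<Longrightarrow> P c \<Longrightarrow> ord_le E (lst P) c"
proof -
  obtain b where b: "Ord b" "P b" "\<And>c. Ord c \<Longrightarrow> P c \<Longrightarrow> ord_le E b c"
    by (rule Ord_least[of a P, OF assms]) blast
  have "lst P = b"
    unfolding lst_def
  proof (rule the_M_eq)
    show "Ord b \<and> P b \<and> (\<forall>c\<in>M. Ord c \<longrightarrow> P c \<longrightarrow> ord_le E b c)" "b \<in> M"
      using b by simp_all
    fix c assume "c \<in> M" and c: "Ord c \<and> P c \<and> (\<forall>d\<in>M. Ord d \<longrightarrow> P d \<longrightarrow> ord_le E c d)"
    then show "c = b"
      using b(1,2) b(3)[of c] by (intro ord_le_antisym) simp_all
  qed
  then show "Ord (lst P)" "P (lst P)" "\<And>c. Ord c \<Longrightarrow> P c \<Longrightarrow> ord_le E (lst P) c"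
    using b by simp_all
qed

text \<open>Burali-Forti: the ordinals in such a set would form an ordinal that belongs to
  itself.\<close>

lemma no_set_of_all_ordinals: assumes "a \<in> M" shows "\<exists>x. Ord x \<and> \<not> x \<epsilon> a"
proof (rule ccontr)
  assume n: "\<not> ?thesis"
  have "dpred Ord" unfolding dpred_def by (rule dfb)+
  then obtain b where b: "b \<in> M" "El b = {x\<in>El a. Ord x}"
    using separation assms by blast
  then have mem: "x \<epsilon> b \<longleftrightarrow> Ord x" for x
    using n by (auto simp: El_def set_eq_iff)
  have "Ord b"
    by (rule Ord_transitive_set) (use b(1) mem Ord_mem in auto)
  then show False using mem mem_irrefl by blast
qed

lemma Ord_max:
  assumes "Ord a" "Ord b"
  obtains c where "Ord c" "c = a \<or> c = b" "ord_le E a c" "ord_le E b c"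
  using that[of a] that[of b] assms not_ord_le[of a b] by (metis ord_le_def)

definition limit :: "'v \<Rightarrow> bool" where
  "limit a \<longleftrightarrow> Ord a \<and> a \<noteq> emp \<and> (\<forall>k. k \<epsilon> a \<longrightarrow> ins k k \<epsilon> a)"

lemma ex_limit: "\<exists>a. limit a"
proof -
  have "ax_infinity E M" using zf by (simp add: ZF_model_def)
  then obtain w where w: "w \<in> M" "\<exists>e\<in>M. is_empty E M e \<and> e \<epsilon> w"
    "\<forall>x\<in>M. x \<epsilon> w \<longrightarrow> (\<exists>y\<in>M. y \<epsilon> w \<and> (\<forall>z\<in>M. z \<epsilon> y \<longleftrightarrow> z \<epsilon> x \<or> z = x))"
    unfolding ax_infinity_def by metis
  have emp: "emp \<epsilon> w" using w(2) is_empty_iff by blast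
  have suc: "ins x x \<epsilon> w" if "x \<epsilon> w" for x
  proof -
    have "x \<in> M" using that w(1) mem_M by blast
    from w(3)[THEN bspec, OF this, THEN mp, OF that]
    obtain y where y: "y \<in> M" "y \<epsilon> w" "\<forall>z\<in>M. z \<epsilon> y \<longleftrightarrow> z \<epsilon> x \<or> z = x"
      by (elim bexE conjE)
    have "El y = El (ins x x)"
    proof (rule set_eqI)
      fix z show "z \<in> El y \<longleftrightarrow> z \<in> El (ins x x)"
        using y \<open>x \<in> M\<close> mem_M[of z y] mem_M[of z x] by auto
    qed
    then show ?thesis using y(2) El_inject by metis
  qed
  \<comment> \<open>The inductive set \<open>w\<close> may contain an ordinal without containing all
    its elements. Keeping only the ordinals included in \<open>w\<close> makes the result transitive
    and leaves it closed under successor.\<close>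
  have "dpred (\<lambda>x. Ord x \<and> (\<forall>y\<in>El x. y \<epsilon> w))"
    unfolding dpred_def using w(1) by - (assumption | rule dfb T_const)+
  then obtain b where b: "b \<in> M" "El b = {x\<in>El w. Ord x \<and> (\<forall>y\<in>El x. y \<epsilon> w)}"
    using separation w(1) by blast
  have mem: "x \<epsilon> b \<longleftrightarrow> x \<epsilon> w \<and> Ord x \<and> (\<forall>y. y \<epsilon> x \<longrightarrow> y \<epsilon> w)" for x
    using b(2) by (auto simp: El_def set_eq_iff)
  have "Ord b"
  proof (rule Ord_transitive_set[OF b(1)])
    fix x assume x: "x \<epsilon> b"
    then have x': "x \<epsilon> w" "Ord x" "\<And>y. y \<epsilon> x \<Longrightarrow> y \<epsilon> w" using mem[of x] by blast+
    show "Ord x" by (fact x'(2))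
    show "El x \<subseteq> El b"
    proof
      fix y assume "y \<in> El x"
      then have y: "y \<epsilon> x" by simp
      have "z \<epsilon> w" if "z \<epsilon> y" for z using x'(3) Ord_trans[OF x'(2) y that] by blast
      then show "y \<in> El b" using mem[of y] x'(3)[OF y] Ord_mem[OF x'(2) y] by simp
    qed
  qed
  moreover have "emp \<epsilon> b" using mem[of emp] emp by simp
  then have "b \<noteq> emp" by auto
  moreover have "ins k k \<epsilon> b" if "k \<epsilon> b" for k
  proof -
    have k: "k \<epsilon> w" "Ord k" "\<And>y. y \<epsilon> k \<Longrightarrow> y \<epsilon> w" using mem[of k] that by blast+
    then show ?thesis using mem[of "ins k k"] suc[OF k(1)] by auto
  qed
  ultimately have "limit b" unfolding limit_def by simp
  then show ?thesis ..
qed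

definition omega :: 'v where "omega = lst limit"

lemma limit_omega: "limit omega" and omega_le: "limit a \<Longrightarrow> ord_le E omega a"
proof -
  obtain a where "limit a" using ex_limit by blast
  then have "Ord a" by (simp add: limit_def)
  show "limit omega" unfolding omega_def using lst(2)[of a limit] \<open>limit a\<close> \<open>Ord a\<close> by blast
  show "limit c \<Longrightarrow> ord_le E omega c" for c
    unfolding omega_def using lst(3)[of a limit c] \<open>limit a\<close> \<open>Ord a\<close> limit_def by blast
qed

lemma Ord_omega [simp]: "Ord omega"
  using limit_omega by (simp add: limit_def)

lemma emp_in: "Ord a \<Longrightarrow> a \<noteq> emp \<Longrightarrow> emp \<epsilon> a"
  using Ord_linear[of emp a] by auto

text \<open>\<open>P\<close> is any HOL predicate, since the least counterexample comes from
  external foundation. It is not \<open>emp\<close>, and it is not a limit because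
  \<open>omega\<close> is the least limit, so it is a successor.\<close>

lemma omega_induct [consumes 1, case_names zero succ]:
  assumes "n \<epsilon> omega" "P emp" "\<And>k. k \<epsilon> omega \<Longrightarrow> P k \<Longrightarrow> P (ins k k)"
  shows "P n"
proof (rule ccontr)
  assume "\<not> P n"
  have "Ord n" using assms(1) Ord_mem Ord_omega by blast
  then obtain m where m: "Ord m" "m \<epsilon> omega \<and> \<not> P m" "\<And>c. Ord c \<Longrightarrow> c \<epsilon> omega \<and> \<not> P c \<Longrightarrow> ord_le E m c"
    using Ord_least[of n "\<lambda>m. m \<epsilon> omega \<and> \<not> P m"] assms(1) \<open>\<not> P n\<close> by blast
  have "\<not> limit m"
    using m(1,2) omega_le not_ord_le[of omega m] by auto
  moreover have "m \<noteq> emp" using m(2) assms(2) by blast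
  ultimately obtain k where k: "k \<epsilon> m" "\<not> ins k k \<epsilon> m"
    using m(1) unfolding limit_def by blast
  then have "Ord k" using m(1) Ord_mem by blast
  then have "ins k k = m"
    using k m(1) succ_le_iff[of k m] by (simp add: ord_le_def)
  moreover have "k \<epsilon> omega" using k(1) m(2) Ord_trans Ord_omega by blast
  moreover have "P k" using m(3)[OF \<open>Ord k\<close>] k(1) \<open>k \<epsilon> omega\<close> \<open>Ord k\<close> m(1) not_ord_le by blast
  ultimately show False using assms(3) m(2) by blast
qed

lemma wf_induct_El [consumes 2, case_names less]:
  assumes "wfp_on (El a) R" "x \<epsilon> a" "\<And>x. x \<epsilon> a \<Longrightarrow> (\<And>y. y \<epsilon> a \<Longrightarrow> R y x \<Longrightarrow> P y) \<Longrightarrow> P x"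
  shows "P x"
  using assms(1)
proof (induction x rule: wfp_on_induct)
  case in_set
  show ?case using assms(2) by simp
next
  case (less x)
  then show ?case using assms(3)[of x] by simp
qed

text \<open>Mostowski collapse. Foundation of \<open>R\<close> is only used externally, so no definability is needed for it.\<close>

lemma collapse:
  assumes R: "drel R" and a: "a \<in> M"
    and trans: "transp_on (El a) R"
    and wf: "wfp_on (El a) R"
  obtains F where "dfn F" "\<And>x. x \<epsilon> a \<Longrightarrow> El (F x) = F ` {y\<in>El a. R y x}"
proof -
  have tr: "R x z" if "x \<epsilon> a" "y \<epsilon> a" "z \<epsilon> a" "R x y" "R y z" for x y z
    using trans that unfolding transp_on_def by (metis mem_El)
  \<comment> \<open>An attempt is a set approximating the collapse: the arguments at which it has a
    value are closed under \<open>R\<close>-predecessors, and each value is the set of values at the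
    predecessors. That it is single-valued is a consequence, proved below as
    \<open>uniq\<close>.\<close>
  define attempt where "attempt f \<longleftrightarrow> (\<forall>y\<in>M. \<forall>v\<in>M. has_value E M f y v \<longrightarrow> y \<epsilon> a \<and>
      (\<forall>z\<in>El a. R z y \<longrightarrow> (\<exists>w\<in>M. has_value E M f z w)) \<and>
      (\<forall>w\<in>M. w \<epsilon> v \<longleftrightarrow> (\<exists>z\<in>El a. R z y \<and> has_value E M f z w)))" for f
  define A where "A x v \<longleftrightarrow> (\<exists>f\<in>M. attempt f \<and> has_value E M f x v)" for x v
  define F where "F x = the_M (A x)" for x
  have aM: "x \<in> M" if "x \<epsilon> a" for x using that a mem_M by blast
  have "dpred attempt"
    unfolding dpred_def attempt_def using a by - (assumption | rule dfb T_const drel_app[OF R])+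
  then have "drel A"
    unfolding drel_def A_def by - (rule dfb dpred_app[of attempt] | assumption)+
  then have dF: "dfn F"
    unfolding dfn_def F_def by - (rule dfb drel_app[of A] | assumption)+
  have irr: "\<not> R x x" if "x \<epsilon> a" for x
    using wf that by (induction x rule: wf_induct_El) blast
  have step: "x \<epsilon> a" "\<And>z. z \<epsilon> a \<Longrightarrow> R z x \<Longrightarrow> \<exists>w\<in>M. has_value E M f z w"
    "\<And>w. w \<in> M \<Longrightarrow> w \<epsilon> v \<longleftrightarrow> (\<exists>z. z \<epsilon> a \<and> R z x \<and> has_value E M f z w)"
    if "attempt f" "x \<in> M" "v \<in> M" "has_value E M f x v" for f x v
    using that unfolding attempt_def by (metis mem_El)+
  have uniq_sub: "El v \<subseteq> El v'" if h: "attempt f" "attempt g" "x \<epsilon> a" "v \<in> M" "v' \<in> M"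
    "has_value E M f x v" "has_value E M g x v'"
    "\<And>y w w'. y \<epsilon> a \<Longrightarrow> R y x \<Longrightarrow> w \<in> M \<Longrightarrow> w' \<in> M \<Longrightarrow> has_value E M f y w \<Longrightarrow> has_value E M g y w' \<Longrightarrow> w = w'"
    for f g x v v'
  proof
    fix w assume w: "w \<in> El v"
    have x: "x \<in> M" using h aM by blast
    have "w \<in> M" using w h mem_M by auto
    then obtain z where z: "z \<epsilon> a" "R z x" "has_value E M f z w"
      using step(3)[OF h(1) x h(4,6)] w by auto
    then obtain w' where w': "w' \<in> M" "has_value E M g z w'"
      using step(2)[OF h(2) x h(5,7)] by blast
    then have "w = w'" using h(8) z \<open>w \<in> M\<close> by blast
    then show "w \<in> El v'" using step(3)[OF h(2) x h(5,7) \<open>w \<in> M\<close>] z w' by auto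
  qed
  have uniq: "v = v'" if fg: "attempt f" "attempt g" and x: "x \<epsilon> a"
    and v: "v \<in> M" "v' \<in> M" "has_value E M f x v" "has_value E M g x v'" for f g x v v'
  proof -
    from wf x have "\<forall>v v'. v \<in> M \<longrightarrow> v' \<in> M \<longrightarrow> has_value E M f x v \<longrightarrow> has_value E M g x v' \<longrightarrow> v = v'"
    proof (induction x rule: wf_induct_El)
      case (less x)
      have IH: "w = w'" if "y \<epsilon> a" "R y x" "w \<in> M" "w' \<in> M" "has_value E M f y w" "has_value E M g y w'" for y w w'
        using less.IH[of y] that by auto
      have IH': "w = w'" if "y \<epsilon> a" "R y x" "w \<in> M" "w' \<in> M" "has_value E M g y w" "has_value E M f y w'" for y w w'
        using IH[OF that(1,2,4,3,6,5)] by simp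
      note x = less.hyps
      show ?case
      proof (intro allI impI)
        fix v v' assume v: "v \<in> M" "v' \<in> M" "has_value E M f x v" "has_value E M g x v'"
        have "El v \<subseteq> El v'" by (rule uniq_sub[OF fg x v IH])
        moreover have "El v' \<subseteq> El v" by (rule uniq_sub[OF fg(2,1) x v(2,1,4,3) IH'])
        ultimately show "v = v'" using El_inject by blast
      qed
    qed
    then show ?thesis using v by blast
  qed
  have A_uniq: "v = v'" if "A x v" "A x v'" "x \<epsilon> a" "v \<in> M" "v' \<in> M" for x v v'
    using that uniq unfolding A_def by blast
  have F_eq: "F x = v" if "A x v" "x \<epsilon> a" "v \<in> M" for x v
    unfolding F_def by (rule the_M_eq) (use that A_uniq in blast)+
  have FM: "F x \<in> M" for x by (simp add: F_def)
  have ex: "A x (F x)" if "x \<epsilon> a" for x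
  proof -
    from wf that show ?thesis
    proof (induction x rule: wf_induct_El)
      case (less x)
      have IH: "A y (F y)" if "y \<epsilon> a" "R y x" for y using less.IH[of y] that by simp
      note x = less.hyps
      have "dpred (\<lambda>y. R y x)"
        unfolding dpred_def using aM[OF x] by - (assumption | rule drel_app[OF R] dfb T_const)+
      then obtain p where p: "p \<in> M" "El p = {y\<in>El a. R y x}" using separation a by blast
      have memp: "y \<epsilon> p \<longleftrightarrow> y \<epsilon> a \<and> R y x" for y using p(2) by (auto simp: El_def set_eq_iff)
      obtain v where v: "v \<in> M" "El v = F ` El p" using replacement dF p(1) by blast
      have memv: "w \<epsilon> v \<longleftrightarrow> (\<exists>y. y \<epsilon> p \<and> w = F y)" for w using v(2) by (auto simp: El_def set_eq_iff)
      have "dfn (\<lambda>y. pair y (F y))"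
        unfolding dfn_def by (rule dfb dfn_app[OF dF])+
      then obtain f0 where f0: "f0 \<in> M" "El f0 = (\<lambda>y. pair y (F y)) ` El p"
        using replacement p(1) by blast
      have memf0: "q \<epsilon> f0 \<longleftrightarrow> (\<exists>y. y \<epsilon> p \<and> q = pair y (F y))" for q
        using f0(2) by (auto simp: El_def set_eq_iff)
      \<comment> \<open>\<open>F\<close> restricted to the predecessors of \<open>x\<close>,
        extended by the new value at \<open>x\<close>. Transitivity of \<open>R\<close> closes the
        domain under predecessors.\<close>
      define f where "f = ins (pair x v) f0"
      have hv: "has_value E M f y w \<longleftrightarrow> (y \<epsilon> p \<and> w = F y) \<or> (y = x \<and> w = v)" if "y \<in> M" "w \<in> M" for y w
        using that f0(1) v(1) aM[OF x] aM memp FM by (auto simp: has_value_iff f_def memf0)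
      have "attempt f"
        unfolding attempt_def
      proof (intro ballI impI)
        fix y w assume y: "y \<in> M" "w \<in> M" "has_value E M f y w"
        consider "y \<epsilon> p" "w = F y" | "y = x" "w = v" using hv y by blast
        then show "y \<epsilon> a \<and> (\<forall>z\<in>El a. R z y \<longrightarrow> (\<exists>w\<in>M. has_value E M f z w)) \<and>
          (\<forall>u\<in>M. u \<epsilon> w \<longleftrightarrow> (\<exists>z\<in>El a. R z y \<and> has_value E M f z u))"
        proof cases
          case 1
          then have ya: "y \<epsilon> a" "R y x" using memp by auto
          obtain g where g: "g \<in> M" "attempt g" "has_value E M g y (F y)"
            using IH[OF ya] unfolding A_def by blast
          note st = step[OF g(2) y(1) FM g(3)]
          have zp: "z \<epsilon> p" if "z \<epsilon> a" "R z y" for z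
            using tr[OF that(1) ya(1) x that(2) ya(2)] memp that by blast
          have gF: "has_value E M g z u \<longleftrightarrow> u = F z" if "z \<epsilon> a" "R z y" "u \<in> M" for z u
            using st(2)[OF that(1,2)] F_eq[OF _ that(1)] g(1,2) that(3) unfolding A_def by metis
          have fF: "has_value E M f z u \<longleftrightarrow> u = F z" if "z \<epsilon> a" "R z y" "u \<in> M" for z u
          proof -
            have "z \<epsilon> p" "z \<noteq> x" using zp that memp irr[OF x] by blast+
            then show ?thesis using hv aM that by blast
          qed
          show ?thesis
            using ya(1) fF FM st(3) gF unfolding 1(2) by (metis mem_El)
        next
          case 2
          have fF: "has_value E M f z u \<longleftrightarrow> u = F z" if "z \<epsilon> a" "R z x" "u \<in> M" for z u
            using hv aM that memp irr[OF x] by blast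
          show ?thesis unfolding 2
            using x fF FM memv memp by (metis mem_El)
        qed
      qed
      moreover have "has_value E M f x v" using hv aM[OF x] v(1) by blast
      ultimately have "A x v" unfolding A_def f_def by (meson set_ops_M)
      then show ?case using F_eq x v(1) by blast
    qed
  qed
  have "El (F x) = F ` {y\<in>El a. R y x}" if xa: "x \<epsilon> a" for x
  proof -
    obtain f where f: "f \<in> M" "attempt f" "has_value E M f x (F x)" using ex[OF xa] unfolding A_def by blast
    note st = step[OF f(2) aM[OF xa] FM f(3)]
    have gF: "has_value E M f z u \<longleftrightarrow> u = F z" if "z \<epsilon> a" "R z x" "u \<in> M" for z u
      using st(2)[OF that(1,2)] F_eq[OF _ that(1)] f(1,2) that(3) unfolding A_def by metis
    have "w \<epsilon> F x \<longleftrightarrow> (\<exists>z. z \<epsilon> a \<and> R z x \<and> w = F z)" for w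
      using st(3) gF FM mem_M by metis
    then show ?thesis by (auto simp: El_def)
  qed
  with dF show thesis using that by blast
qed

text \<open>Transitivity of \<open>R\<close> makes each value a transitive set of ordinals.
  Incomparable points may get the same value, since \<open>F\<close> is a rank function; injectivity
  is argued separately where it holds.\<close>

lemma collapse_Ord:
  assumes F: "\<And>x. x \<epsilon> a \<Longrightarrow> El (F x) = F ` {y\<in>El a. R y x}" "dfn F" and a: "a \<in> M"
    and trans: "transp_on (El a) R"
    and wf: "wfp_on (El a) R"
  shows "x \<epsilon> a \<Longrightarrow> Ord (F x)"
    and "\<exists>b. Ord b \<and> El b = F ` El a"
proof -
  have tr: "R x z" if "x \<epsilon> a" "y \<epsilon> a" "z \<epsilon> a" "R x y" "R y z" for x y z
    using trans that unfolding transp_on_def by (metis mem_El)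
  have mem: "u \<epsilon> F x \<longleftrightarrow> (\<exists>y. y \<epsilon> a \<and> R y x \<and> u = F y)" if "x \<epsilon> a" for x u
    using F(1)[OF that] by (auto simp: El_def set_eq_iff)
  have sub: "El (F y) \<subseteq> El (F x)" if yx: "y \<epsilon> a" "x \<epsilon> a" "R y x" for x y
  proof
    fix u assume "u \<in> El (F y)"
    then obtain z where z: "z \<epsilon> a" "R z y" "u = F z" using mem[OF yx(1)] by auto
    then have "R z x" using tr[OF z(1) yx(1,2) z(2) yx(3)] by simp
    then show "u \<in> El (F x)" using mem[OF yx(2)] z by auto
  qed
  have o: "Ord (F x)" if "x \<epsilon> a" for x
  proof -
    from wf that show ?thesis
    proof (induction x rule: wf_induct_El)
      case (less x)
      note x = less.hyps
      show ?case
      proof (rule Ord_transitive_set)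
        show "F x \<in> M" using dfn_M[OF F(2)] x a mem_M by blast
        fix u assume "u \<epsilon> F x"
        then obtain y where "y \<epsilon> a" "R y x" "u = F y" using mem[OF x] by blast
        then show "Ord u" "El u \<subseteq> El (F x)" using less.IH[of y] sub x by auto
      qed
    qed
  qed
  then show "x \<epsilon> a \<Longrightarrow> Ord (F x)" .
  obtain b where b: "b \<in> M" "El b = F ` El a" using replacement F(2) a by blast
  have memb: "u \<epsilon> b \<longleftrightarrow> (\<exists>y. y \<epsilon> a \<and> u = F y)" for u using b(2) by (auto simp: El_def set_eq_iff)
  have "Ord b"
  proof (rule Ord_transitive_set[OF b(1)])
    fix u assume "u \<epsilon> b"
    then obtain x where x: "x \<epsilon> a" "u = F x" using memb by blast
    then show "Ord u" using o by blast
    show "El u \<subseteq> El b"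
    proof
      fix w assume "w \<in> El u"
      then obtain y where "y \<epsilon> a" "w = F y" using mem[OF x(1)] x(2) by auto
      then show "w \<in> El b" using memb[of w] by auto
    qed
  qed
  with b(2) show "\<exists>b. Ord b \<and> El b = F ` El a" by blast
qed

lemma wfp_on_measure: "(\<And>x y. x \<in> A \<Longrightarrow> y \<in> A \<Longrightarrow> R x y \<Longrightarrow> g x \<epsilon> g y) \<Longrightarrow> wfp_on A R"
  unfolding wfp_on_iff_ex_minimal
proof (intro allI impI)
  fix B assume R: "\<And>x y. x \<in> A \<Longrightarrow> y \<in> A \<Longrightarrow> R x y \<Longrightarrow> g x \<epsilon> g y" and B: "B \<subseteq> A" "B \<noteq> {}"
  then have "g ` B \<noteq> {}" by blast
  then obtain m where "m \<in> g ` B" "\<And>y. y \<epsilon> m \<Longrightarrow> y \<notin> g ` B"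
    using wf_mem unfolding wfp_iff_ex_minimal by metis
  then show "\<exists>z\<in>B. \<forall>y. R y z \<longrightarrow> y \<notin> B" using R B by blast
qed


section \<open>Cardinals\<close>

lemma eqp_trans: assumes "eqp a b" "eqp b c" shows "eqp a c"
proof -
  obtain F G where "dfn F" "bij_betw F (El a) (El b)" "dfn G" "bij_betw G (El b) (El c)"
    using assms unfolding eqp_def by blast
  then have "dfn (\<lambda>x. G (F x))" "bij_betw (\<lambda>x. G (F x)) (El a) (El c)"
    using dfn_comp bij_betw_trans[of F "El a" "El b" G] by (auto simp: comp_def)
  then show ?thesis unfolding eqp_def by blast
qed

lemma eqp_refl: "eqp a a"
  unfolding eqp_def using dfn_id by (intro exI[of _ "\<lambda>x. x"]) (auto simp: bij_betw_def)

text \<open>The injection pulls the order of \<open>b\<close> back to \<open>k\<close>, and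
  \<open>c\<close> is the resulting order type. By induction \<open>F x\<close> is at most
  \<open>f x\<close>, which keeps \<open>c\<close> from exceeding \<open>b\<close>.\<close>

lemma emb_Ord_eqp:
  assumes "k \<in> M" "Ord b" "emb k b"
  obtains c where "Ord c" "ord_le E c b" "eqp k c"
proof -
  obtain f where f: "dfn f" "f ` El k \<subseteq> El b" "inj_on f (El k)"
    using assms(3) unfolding emb_def by blast
  have fb: "f x \<epsilon> b" if "x \<epsilon> k" for x using f(2) that by (auto simp: image_subset_iff)
  have fo: "Ord (f x)" if "x \<epsilon> k" for x using fb[OF that] assms(2) Ord_mem by blast
  define R where "R x y \<longleftrightarrow> f x \<epsilon> f y" for x y
  have dR: "drel R"
    unfolding drel_def R_def by (rule dfb dfn_app[OF f(1)])+
  have tr: "transp_on (El k) R"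
  proof (rule transp_onI)
    fix x y z assume "x \<in> El k" "y \<in> El k" "z \<in> El k" "R x y" "R y z"
    then show "R x z" unfolding R_def using Ord_trans[OF fo[of z]] by simp
  qed
  have wf: "wfp_on (El k) R" by (rule wfp_on_measure[of _ _ f]) (simp add: R_def)
  obtain F where F: "dfn F" "\<And>x. x \<epsilon> k \<Longrightarrow> El (F x) = F ` {y\<in>El k. R y x}"
    by (rule collapse[OF dR assms(1) tr wf]) blast
  note co = collapse_Ord[OF F(2,1) assms(1) tr wf]
  obtain c where c: "Ord c" "El c = F ` El k" using co(2) by blast
  have mem: "u \<epsilon> F x \<longleftrightarrow> (\<exists>y. y \<epsilon> k \<and> f y \<epsilon> f x \<and> u = F y)" if "x \<epsilon> k" for x u
    using F(2)[OF that] by (auto simp: El_def set_eq_iff R_def)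
  have le: "ord_le E (F x) (f x)" if "x \<epsilon> k" for x
    using wf that
  proof (induction x rule: wf_induct_El)
    case (less x)
    have "El (F x) \<subseteq> El (f x)"
    proof
      fix u assume "u \<in> El (F x)"
      then obtain y where y: "y \<epsilon> k" "f y \<epsilon> f x" "u = F y" using mem[OF less.hyps] by auto
      then show "u \<in> El (f x)"
        using less.IH[OF y(1)] ord_le_mem_trans[OF fo[OF y(1)] fo[OF less.hyps]] by (simp add: R_def)
    qed
    then show ?case using ord_le_subset co(1) fo less.hyps by blast
  qed
  have "El c \<subseteq> El b"
  proof
    fix u assume "u \<in> El c"
    then obtain x where x: "x \<epsilon> k" "u = F x" using c(2) by (metis imageE mem_El)
    then show "u \<in> El b" using ord_le_mem_trans[OF fo[OF x(1)] assms(2) le[OF x(1)] fb[OF x(1)]] by simp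
  qed
  then have "ord_le E c b" using ord_le_subset c(1) assms(2) by blast
  moreover have "inj_on F (El k)"
  proof (rule inj_onI)
    fix x y assume "x \<in> El k" "y \<in> El k" and eq: "F x = F y"
    then have xy: "x \<epsilon> k" "y \<epsilon> k" by auto
    have "\<not> f x \<epsilon> f y" using mem[OF xy(2), of "F x"] xy eq by auto
    moreover have "\<not> f y \<epsilon> f x" using mem[OF xy(1), of "F y"] xy eq by auto
    ultimately have "f x = f y" using Ord_linear fo xy by blast
    then show "x = y" using f(3) xy by (auto simp: inj_on_def)
  qed
  then have "eqp k c" unfolding eqp_def bij_betw_def using F(1) c(2) by blast
  ultimately show thesis using that c(1) by blast
qed

definition Card :: "'v \<Rightarrow> bool" where "Card k \<longleftrightarrow> k \<in> M \<and> is_cardinal E M k"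

lemma Card_iff: "Card k \<longleftrightarrow> Ord k \<and> (\<forall>a. a \<epsilon> k \<longrightarrow> \<not> eqp a k)"
proof (cases "k \<in> M")
  case True
  then have "is_cardinal E M k \<longleftrightarrow> is_ordinal E M k \<and> (\<forall>a\<in>M. a \<epsilon> k \<longrightarrow> \<not> eqp a k)"
    unfolding is_cardinal_def using bijection_iff by blast
  then show ?thesis using True mem_M unfolding Card_def Ord_def by blast
next
  case False
  then show ?thesis by (auto simp: Card_def Ord_def)
qed

lemma D_Card [dfb]: "T t \<Longrightarrow> D (\<lambda>s. Card (t s))"
  by (rule definable_cong[OF D_is_cardinal]) (auto simp: Card_def definable_term_in)

lemma Card_Ord [simp]: "Card k \<Longrightarrow> Ord k"
  by (simp add: Card_iff)

lemma Card_emb_le: assumes "Card k" "Ord b" "emb k b" shows "ord_le E k b"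
proof (rule ccontr)
  assume n: "\<not> ?thesis"
  have k: "Ord k" "k \<in> M" using assms(1) by auto
  obtain c where c: "Ord c" "ord_le E c b" "eqp k c" using emb_Ord_eqp[OF k(2) assms(2,3)] .
  have "b \<epsilon> k" using n not_ord_le k(1) assms(2) by blast
  then have "c \<epsilon> k" using ord_le_mem_trans[OF assms(2) k(1) c(2)] by blast
  moreover have "eqp c k" using eqp_sym c(3) k(2) by blast
  ultimately show False using assms(1) Card_iff by blast
qed

lemma ord_le_emb: "Ord a \<Longrightarrow> Ord b \<Longrightarrow> ord_le E a b \<Longrightarrow> emb a b"
  using ord_le_subset emb_subset by blast

lemma ex_card:
  assumes "Ord a" obtains k where "Card k" "ord_le E k a" "eqp a k" "emb a k" "emb k a"
proof -
  obtain k where k: "Ord k" "eqp a k" "\<And>c. Ord c \<Longrightarrow> eqp a c \<Longrightarrow> ord_le E k c"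
    by (rule Ord_least[of a "eqp a", OF assms eqp_refl]) blast
  have "Card k"
    unfolding Card_iff
  proof (intro conjI allI impI notI)
    show "Ord k" by (fact k(1))
    fix c assume c: "c \<epsilon> k" "eqp c k"
    then have "Ord c" using Ord_mem k(1) by blast
    moreover have "eqp k c" using c(2) eqp_sym \<open>Ord c\<close> by simp
    then have "eqp a c" using k(2) eqp_trans by blast
    ultimately have "ord_le E k c" using k(3) by blast
    then show False using not_ord_le[OF k(1) \<open>Ord c\<close>] c(1) by blast
  qed
  moreover have "ord_le E k a" using k(3)[OF assms eqp_refl] .
  ultimately show thesis using that k(2) eqp_emb eqp_sym assms by simp
qed

lemma onto_Ord_emb:
  assumes "onto a b" "Ord a" "b \<in> M" shows "emb b a"
proof -
  obtain F where F: "dfn F" "F ` El a = El b" using assms(1) unfolding onto_def by blast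
  define G where "G y = lst (\<lambda>x. x \<epsilon> a \<and> F x = y)" for y
  have "a \<in> M" using assms by simp
  then have "dfn G"
    unfolding dfn_def G_def by - (assumption | rule dfb T_const dfn_app[OF F(1)])+
  moreover have G: "G y \<epsilon> a \<and> F (G y) = y" if "y \<in> El b" for y
  proof -
    have "y \<in> F ` El a" using that F(2) by simp
    then obtain x where x: "x \<epsilon> a" "F x = y" by auto
    then have "Ord x" using assms(2) Ord_mem by blast
    then show ?thesis unfolding G_def using lst(2)[of x "\<lambda>x. x \<epsilon> a \<and> F x = y"] x by simp
  qed
  have "G ` El b \<subseteq> El a" using G by auto
  moreover have "inj_on G (El b)" by (rule inj_onI) (metis G)
  ultimately show ?thesis unfolding emb_def by blast
qed

lemma is_injection_dfn:
  assumes "is_injection E M f a b" "f \<in> M" "a \<in> M" "b \<in> M"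
  shows "app f ` El a \<subseteq> El b" "inj_on (app f) (El a)"
  using is_injection_iff[OF assms(2-4)] is_function_dfn(2)[OF _ assms(2-4)] assms(1) by blast+

text \<open>
  Hartogs' theorem. If every ordinal embedded into \<open>X\<close>, the pairs \<open>(r, x)\<close> with \<open>r\<close> a
  well-order of a subset of \<open>X\<close> copied from an ordinal and \<open>x\<close> in its field would form a set
  whose collapse hits every ordinal.
\<close>

lemma ex_Ord_not_emb:
  assumes X: "X \<in> M" shows "\<exists>a. Ord a \<and> \<not> emb a X"
proof (rule ccontr)
  assume "\<not> ?thesis"
  then have all: "emb a X" if "Ord a" for a using that by blast
  \<comment> \<open>\<open>r\<close> is the order of the ordinal \<open>a\<close> copied along
    \<open>f\<close> to a subset of \<open>X\<close>. Only \<open>r\<close> is kept as a code, since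
    it lies in a fixed power set whereas \<open>a\<close> and \<open>f\<close> have no such bound
    yet.\<close>
  define W where "W r a f \<longleftrightarrow> Ord a \<and> is_injection E M f a X \<and>
    (\<forall>p\<in>M. p \<epsilon> r \<longleftrightarrow> (\<exists>u\<in>El a. \<exists>v\<in>El a. u \<epsilon> v \<and> p = pair (app f u) (app f v)))" for r a f
  define good where "good q \<longleftrightarrow> (\<exists>a\<in>M. \<exists>f\<in>M. W (pfst q) a f \<and> (\<exists>u\<in>El a. psnd q = app f u))" for q
  have "dpred good"
    unfolding dpred_def good_def W_def using X by - (assumption | rule dfb T_const)+
  then obtain A where A: "A \<in> M" "El A = {q\<in>El (prod (Power (prod X X)) X). good q}"
    using separation[of good "prod (Power (prod X X)) X"] by auto
  define R where "R q q' \<longleftrightarrow> pfst q = pfst q' \<and> pair (psnd q) (psnd q') \<epsilon> pfst q" for q q'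
  have dR: "drel R"
    unfolding drel_def R_def by (rule dfb)+
  have inj: "v = u" if "W r a f" "f \<in> M" "u \<epsilon> a" "v \<epsilon> a" "app f v = app f u" for r a f u v
    using that is_injection_dfn(2)[of f a X] X unfolding W_def inj_on_def by auto
  have Wr: "pair y (app f u) \<epsilon> r \<longleftrightarrow> (\<exists>w. w \<epsilon> u \<and> y = app f w)"
    if W: "W r a f" "f \<in> M" "u \<epsilon> a" "y \<in> M" for r a f u y
  proof
    have a: "Ord a" using W unfolding W_def by blast
    have r: "p \<epsilon> r \<longleftrightarrow> (\<exists>u\<in>El a. \<exists>v\<in>El a. u \<epsilon> v \<and> p = pair (app f u) (app f v))" if "p \<in> M" for p
      using W(1) that unfolding W_def by blast
    show "\<exists>w. w \<epsilon> u \<and> y = app f w" if "pair y (app f u) \<epsilon> r"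
    proof -
      from that obtain w v where w: "w \<epsilon> a" "v \<epsilon> a" "w \<epsilon> v" "pair y (app f u) = pair (app f w) (app f v)"
        using r[OF pair_M] by auto
      then have "y = app f w" "app f v = app f u" using W(4) by auto
      then show ?thesis using inj[OF W(1,2,3) w(2)] w(3) by blast
    qed
    assume "\<exists>w. w \<epsilon> u \<and> y = app f w"
    then obtain w where w: "w \<epsilon> u" "y = app f w" by blast
    then have "w \<epsilon> a" using Ord_trans[OF a W(3)] by blast
    then have "\<exists>u'\<in>El a. \<exists>v\<in>El a. u' \<epsilon> v \<and> pair y (app f u) = pair (app f u') (app f v)"
      using w W(3) by (intro bexI[of _ w] bexI[of _ u]) simp_all
    then show "pair y (app f u) \<epsilon> r" using r[OF pair_M] by blast
  qed
  have memA: "q \<epsilon> A \<longleftrightarrow> q \<epsilon> prod (Power (prod X X)) X \<and> good q" for q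
    using A(2) by (auto simp: El_def set_eq_iff)
  have AE: "\<exists>r a f u. a \<in> M \<and> f \<in> M \<and> r \<in> M \<and> W r a f \<and> u \<epsilon> a \<and> q = pair r (app f u)" if "q \<epsilon> A" for q
  proof -
    have q: "q \<epsilon> prod (Power (prod X X)) X" "good q" using memA that by blast+
    obtain r x where rx: "r \<in> M" "x \<in> M" "q = pair r x" by (rule in_prodE[OF q(1) _ X]) (simp, blast)
    then obtain a f u where "a \<in> M" "f \<in> M" "W r a f" "u \<epsilon> a" "x = app f u"
      using q(2) unfolding good_def by auto
    then show ?thesis using rx by blast
  qed
  have tr: "transp_on (El A) R"
  proof (rule transp_onI)
    fix x y z assume "x \<in> El A" "y \<in> El A" "z \<in> El A" "R x y" "R y z"
    then have h: "x \<epsilon> A" "y \<epsilon> A" "z \<epsilon> A" "R x y" "R y z" by auto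
    obtain r a f u where z: "f \<in> M" "r \<in> M" "W r a f" "u \<epsilon> a" "z = pair r (app f u)"
      using AE[OF h(3)] by blast
    have a: "Ord a" using z(3) unfolding W_def by blast
    have "pfst y = r" "pair (psnd y) (app f u) \<epsilon> r" using h(5) z(2,5) unfolding R_def by auto
    then obtain w where w: "w \<epsilon> u" "psnd y = app f w" using Wr[OF z(3,1,4)] by auto
    then have wa: "w \<epsilon> a" using Ord_trans[OF a z(4)] by blast
    have "pfst x = r" "pair (psnd x) (app f w) \<epsilon> r" using h(4) \<open>pfst y = r\<close> w(2) unfolding R_def by auto
    then obtain v where v: "v \<epsilon> w" "psnd x = app f v" using Wr[OF z(3,1) wa] by auto
    have "v \<epsilon> u" using Ord_trans[OF Ord_mem[OF a z(4)] w(1) v(1)] .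
    then have "pair (psnd x) (app f u) \<epsilon> r" using Wr[OF z(3,1,4)] v(2) by auto
    then show "R x z" using \<open>pfst x = r\<close> z(2,5) unfolding R_def by auto
  qed
  have wf: "wfp_on (El A) R"
    unfolding wfp_on_iff_ex_minimal
  proof (intro allI impI)
    fix B assume B: "B \<subseteq> El A" "B \<noteq> {}"
    have BA: "q \<epsilon> A" if "q \<in> B" for q using subsetD[OF B(1) that] by simp
    obtain q where q: "q \<in> B" "q \<epsilon> A" using B(2) BA by blast
    obtain r a f u where z: "f \<in> M" "r \<in> M" "W r a f" "u \<epsilon> a" "q = pair r (app f u)"
      using AE[OF q(2)] by blast
    have a: "Ord a" using z(3) unfolding W_def by blast
    have "Ord u" using Ord_mem[OF a z(4)] .
    let ?P = "\<lambda>u. u \<epsilon> a \<and> pair r (app f u) \<in> B"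
    have "?P u" using z q by blast
    obtain v where v: "Ord v" "?P v" "\<And>c. Ord c \<Longrightarrow> ?P c \<Longrightarrow> ord_le E v c"
      by (rule Ord_least[of u ?P, OF \<open>Ord u\<close> \<open>?P u\<close>]) blast
    have "y \<notin> B" if y: "R y (pair r (app f v))" for y
    proof
      assume "y \<in> B"
      then obtain r' y' where y': "r' \<in> M" "y' \<in> M" "y = pair r' y'" using AE[OF BA] by (metis app_M)
      then have "r' = r" "pair y' (app f v) \<epsilon> r" using y z(2) unfolding R_def by auto
      then obtain w where w: "w \<epsilon> v" "y' = app f w" using Wr[OF z(3,1)] v(2) y'(2) by blast
      then have "?P w" using \<open>y \<in> B\<close> y' \<open>r' = r\<close> Ord_trans[OF a] v(2) by blast
      moreover have "Ord w" using Ord_mem[OF v(1) w(1)] .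
      ultimately show False using v(3) not_ord_le[OF v(1)] w(1) by blast
    qed
    then show "\<exists>z\<in>B. \<forall>y. R y z \<longrightarrow> y \<notin> B" using v(2) by blast
  qed
  obtain F where F: "dfn F" "\<And>x. x \<epsilon> A \<Longrightarrow> El (F x) = F ` {y\<in>El A. R y x}"
    by (rule collapse[OF dR A(1) tr wf]) blast
  obtain b where b: "b \<in> M" "El b = F ` El A" using replacement F(1) A(1) by blast
  have "x \<epsilon> b" if x: "Ord x" for x
  proof -
    \<comment> \<open>The successor is used so that \<open>x\<close> itself occurs as a position in
      the copied order.\<close>
    have a: "Ord (ins x x)" using x by simp
    obtain f where f: "f \<in> M" "is_injection E M f (ins x x) X"
      using all[OF a] injection_iff[of "ins x x" X] X by auto
    let ?P = "\<lambda>p. \<exists>u\<in>El (ins x x). \<exists>v\<in>El (ins x x). u \<epsilon> v \<and> p = pair (app f u) (app f v)"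
    have fX: "app f u \<epsilon> X" if "u \<epsilon> ins x x" for u
      using is_injection_dfn(1)[OF f(2,1) _ X] that by (auto simp: image_subset_iff)
    have "x \<in> M" using x by simp
    then have "dpred ?P"
      unfolding dpred_def using f(1) by - (assumption | rule dfb T_const)+
    then obtain r where r: "r \<in> M" "El r = {p\<in>El (prod X X). ?P p}"
      using separation[of ?P "prod X X"] by auto
    have memr: "p \<epsilon> r \<longleftrightarrow> p \<epsilon> prod X X \<and> ?P p" for p
    proof -
      have "p \<epsilon> r \<longleftrightarrow> p \<in> El r" by simp
      then show ?thesis unfolding r(2) by simp
    qed
    have "W r (ins x x) f"
      unfolding W_def
    proof (intro conjI ballI)
      fix p assume "p \<in> M"
      have "p \<epsilon> prod X X" if "?P p" using that fX X by auto
      then show "p \<epsilon> r \<longleftrightarrow> ?P p" using memr by blast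
    qed (use a f in auto)
    have inA: "pair r (app f u) \<epsilon> A" if "u \<epsilon> ins x x" for u
    proof -
      have "El r \<subseteq> El (prod X X)" using memr by auto
      then have "pair r (app f u) \<epsilon> prod (Power (prod X X)) X"
        using r(1) fX[OF that] X by simp
      moreover have "good (pair r (app f u))"
        unfolding good_def using \<open>W r (ins x x) f\<close> that f(1) r(1)
        by (intro bexI[of _ "ins x x"] bexI[of _ f]) auto
      ultimately show ?thesis using memA by blast
    qed
    \<comment> \<open>By induction the collapse undoes the copying and returns the ordinal
      \<open>u\<close>.\<close>
    have "F (pair r (app f u)) = u" if "u \<epsilon> ins x x" for u
      using wf_mem that
    proof (induction u rule: wfp_induct_rule)
      case (less u)
      have "y \<epsilon> A \<and> R y (pair r (app f u)) \<longleftrightarrow> (\<exists>w. w \<epsilon> u \<and> y = pair r (app f w))" for y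
      proof
        assume y: "y \<epsilon> A \<and> R y (pair r (app f u))"
        then obtain r' y' where y': "r' \<in> M" "y' \<in> M" "y = pair r' y'" using AE[of y] by (metis app_M)
        then have "r' = r" "pair y' (app f u) \<epsilon> r" using y r(1) unfolding R_def by auto
        then show "\<exists>w. w \<epsilon> u \<and> y = pair r (app f w)"
          using Wr[OF \<open>W r (ins x x) f\<close> f(1) less.prems y'(2)] y'(3) by auto
      next
        assume "\<exists>w. w \<epsilon> u \<and> y = pair r (app f w)"
        then obtain w where w: "w \<epsilon> u" "y = pair r (app f w)" by blast
        then have "pair (app f w) (app f u) \<epsilon> r"
          using Wr[OF \<open>W r (ins x x) f\<close> f(1) less.prems app_M] by blast
        then show "y \<epsilon> A \<and> R y (pair r (app f u))"
          using w inA[OF Ord_trans[OF a less.prems w(1)]] r(1) unfolding R_def by auto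
      qed
      then have eq: "{y\<in>El A. R y (pair r (app f u))} = (\<lambda>w. pair r (app f w)) ` El u"
        by auto
      have "El (F (pair r (app f u))) = (\<lambda>w. F (pair r (app f w))) ` El u"
        unfolding F(2)[OF inA[OF less.prems]] eq image_image ..
      also have "\<dots> = (\<lambda>w. w) ` El u"
        using less.IH Ord_trans[OF a less.prems] by (intro image_cong) auto
      finally show ?case by (simp add: El_inject)
    qed
    from this[of x] have "x = F (pair r (app f x))" using x by simp
    moreover have "pair r (app f x) \<in> El A" using inA[of x] x by simp
    ultimately have "x \<in> El b" unfolding b(2) by (rule image_eqI)
    then show ?thesis by simp
  qed
  then show False using no_set_of_all_ordinals[OF b(1)] by blast
qed

lemma ex_Card_not_emb:
  assumes "X \<in> M" "Ord b" obtains k where "Card k" "b \<epsilon> k" "\<not> emb k X"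
proof -
  obtain a where a: "Ord a" "\<not> emb a X" using ex_Ord_not_emb assms(1) by blast
  obtain m where m: "Ord m" "ord_le E a m" "ord_le E b m" by (rule Ord_max[OF a(1) assms(2)])
  \<comment> \<open>The cardinal of \<open>m\<close> may drop back to \<open>b\<close> or below.
    Exceeding \<open>m\<close> in size, and not merely in order, makes the cardinal \<open>k\<close>
    of \<open>c\<close> lie above \<open>b\<close>.\<close>
  obtain c where c: "Ord c" "\<not> emb c m" using ex_Ord_not_emb[of m] m(1) by auto
  obtain k where k: "Card k" "emb c k" by (rule ex_card[OF c(1)])
  have "\<not> emb k m" using c(2) k(2) emb_trans by blast
  then have mk: "m \<epsilon> k" using ord_le_emb[of k m] not_ord_le[of k m] k(1) m(1) by auto
  have "b \<epsilon> k" using ord_le_mem_trans[OF m(1) _ m(3) mk] k(1) by simp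
  moreover have "\<not> emb k X"
  proof
    assume "emb k X"
    moreover have "emb a k" using ord_le_emb[of a k] ord_le_mem_trans[OF m(1) _ m(2) mk] a(1) k(1) by (simp add: ord_le_def)
    ultimately show False using a(2) emb_trans by blast
  qed
  ultimately show thesis using that k(1) by blast
qed

section \<open>Successor cardinals\<close>

definition csucc :: "'v \<Rightarrow> 'v" where "csucc l = lst (\<lambda>k. Card k \<and> l \<epsilon> k)"

lemma csucc:
  assumes "Ord l"
  shows "Card (csucc l)" "l \<epsilon> csucc l" "\<And>c. Card c \<Longrightarrow> l \<epsilon> c \<Longrightarrow> ord_le E (csucc l) c"
proof -
  obtain k where k: "Card k" "l \<epsilon> k" by (rule ex_Card_not_emb[OF emp_M assms])
  then have h: "Ord k" "Card k \<and> l \<epsilon> k" by auto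
  note s = lst[where P = "\<lambda>k. Card k \<and> l \<epsilon> k", OF h]
  show "Card (csucc l)" "l \<epsilon> csucc l" unfolding csucc_def using s(2) by blast+
  show "ord_le E (csucc l) c" if "Card c" "l \<epsilon> c" for c
    unfolding csucc_def using s(3)[of c] that by simp
qed

lemma is_card_succ_iff:
  assumes "Ord l" "k \<in> M" shows "is_card_succ E M l k \<longleftrightarrow> k = csucc l"
proof -
  have c: "csucc l \<in> M" "is_cardinal E M (csucc l)" "is_ordinal E M (csucc l)"
    using csucc(1)[OF assms(1)] unfolding Card_def by (auto simp: is_cardinal_def)
  show ?thesis
  proof
    assume "is_card_succ E M l k"
    then have k: "is_cardinal E M k" "l \<epsilon> k"
      "\<And>b. b \<in> M \<Longrightarrow> is_ordinal E M b \<Longrightarrow> is_cardinal E M b \<Longrightarrow> l \<epsilon> b \<Longrightarrow> ord_le E k b"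
      unfolding is_card_succ_def is_least_ordinal_def by auto
    have "ord_le E (csucc l) k" using csucc(3)[OF assms(1), of k] k assms(2) by (simp add: Card_def)
    moreover have "ord_le E k (csucc l)" using k(3)[OF c(1,3,2) csucc(2)[OF assms(1)]] .
    ultimately show "k = csucc l" using ord_le_antisym by blast
  next
    assume "k = csucc l"
    then show "is_card_succ E M l k"
      unfolding is_card_succ_def is_least_ordinal_def
      using c csucc(2,3)[OF assms(1)] by (auto simp: Card_def)
  qed
qed

lemma emb_below_csucc:
  assumes "Card l" "a \<epsilon> csucc l" shows "emb a l"
proof -
  have l: "Ord l" using assms by simp
  have o: "Ord (csucc l)" using csucc(1)[OF l] by simp
  have a: "Ord a" using assms(2) o Ord_mem by blast
  obtain k where k: "Card k" "ord_le E k a" "emb a k" by (rule ex_card[OF a])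
  have "k \<epsilon> csucc l" using ord_le_mem_trans[OF a o k(2) assms(2)] .
  then have "\<not> l \<epsilon> k" using csucc(3)[OF l k(1)] not_ord_le[of "csucc l" k] o k(1) by auto
  then have "ord_le E k l" using not_ord_le[of k l] k(1) l by auto
  then show ?thesis using k ord_le_emb[of k l] l emb_trans by auto
qed

lemma Card_le_csucc: "Card l \<Longrightarrow> Card k \<Longrightarrow> k \<epsilon> csucc l \<Longrightarrow> ord_le E k l"
  using emb_below_csucc Card_emb_le by simp


subsection \<open>Finite ordinals\<close>

lemma succ_inject: "Ord x \<Longrightarrow> Ord y \<Longrightarrow> ins x x = ins y y \<Longrightarrow> x = y"
  using mem_ins[of x x x] mem_ins[of y y x] mem_ins[of x x y] mem_ins[of y y y] mem_asym Ord_M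
  by metis

lemma succ_neq_emp: "x \<in> M \<Longrightarrow> ins x x \<noteq> emp"
  using mem_ins[of x x x] not_mem_emp by metis

lemma succ_in_omega: "n \<epsilon> omega \<Longrightarrow> ins n n \<epsilon> omega"
  using limit_omega unfolding limit_def by blast

lemma emp_in_omega: "emp \<epsilon> omega"
  using limit_omega emp_in unfolding limit_def by blast

lemma Ord_in_omega: "n \<epsilon> omega \<Longrightarrow> Ord n"
  using Ord_mem Ord_omega by blast

lemma omega_not_emb: assumes "n \<epsilon> omega" shows "\<not> emb omega n"
  using assms
proof (induction n rule: omega_induct)
  case zero
  show ?case
  proof
    assume "emb omega emp"
    then obtain F where "F ` El omega \<subseteq> El emp" unfolding emb_def by blast
    then have "El omega = {}" by simp
    then show False using emp_in_omega by (metis empty_iff mem_El)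
  qed
next
  case (succ k)
  show ?case
  proof
    assume "emb omega (ins k k)"
    then obtain F where F: "dfn F" "F ` El omega \<subseteq> El (ins k k)" "inj_on F (El omega)"
      unfolding emb_def by blast
    have k: "k \<in> M" using succ.hyps Ord_in_omega by simp
    have Fk: "F x = k \<or> F x \<epsilon> k" if "x \<epsilon> omega" for x
      using F(2) that k by (auto simp: image_subset_iff)
    have inj: "x = y" if "F x = F y" "x \<epsilon> omega" "y \<epsilon> omega" for x y
      using F(3) that unfolding inj_on_def by auto
    \<comment> \<open>Shifting the argument by one frees the value \<open>F emp\<close>, which then
      replaces the forbidden value \<open>k\<close>.\<close>
    define G where "G x = (if F (ins x x) = k then F emp else F (ins x x))" for x
    have "dfn G"
      unfolding dfn_def G_def using k by - (assumption | rule dfb T_const dfn_app[OF F(1)])+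
    moreover have "G ` El omega \<subseteq> El k"
    proof
      fix y assume "y \<in> G ` El omega"
      then obtain x where x: "x \<epsilon> omega" "y = G x" by auto
      have sx: "ins x x \<epsilon> omega" using succ_in_omega x(1) .
      have "F emp \<noteq> k" if "F (ins x x) = k"
        using inj[of "ins x x" emp] that sx emp_in_omega succ_neq_emp[of x] Ord_in_omega[OF x(1)] by auto
      then show "y \<in> El k" using Fk[OF sx] Fk[OF emp_in_omega] x(2) unfolding G_def by auto
    qed
    moreover have "inj_on G (El omega)"
    proof (rule inj_onI)
      fix x y assume "x \<in> El omega" "y \<in> El omega" and eq: "G x = G y"
      then have xy: "x \<epsilon> omega" "y \<epsilon> omega" by auto
      have s: "ins x x \<epsilon> omega" "ins y y \<epsilon> omega" using xy succ_in_omega by auto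
      have o: "Ord x" "Ord y" using xy Ord_in_omega by auto
      have ne: "F (ins x x) \<noteq> F emp" "F (ins y y) \<noteq> F emp"
        using inj[OF _ s(1) emp_in_omega] inj[OF _ s(2) emp_in_omega] succ_neq_emp o by auto
      have "F (ins x x) = F (ins y y)"
        using eq ne unfolding G_def by (metis)
      then have "ins x x = ins y y" using inj s by blast
      then show "x = y" using succ_inject o by blast
    qed
    ultimately have "emb omega k" unfolding emb_def by blast
    then show False using succ.IH by blast
  qed
qed

definition fin :: "'v \<Rightarrow> bool" where "fin a \<longleftrightarrow> (\<exists>m. m \<epsilon> omega \<and> emb a m)"

lemma fin_ins: assumes "fin a" "a \<in> M" "x \<in> M" shows "fin (ins x a)"
proof -
  obtain m F where m: "m \<epsilon> omega" and F: "dfn F" "F ` El a \<subseteq> El m" "inj_on F (El a)"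
    using assms(1) unfolding fin_def emb_def by blast
  have mM: "m \<in> M" using m Ord_in_omega by simp
  define G where "G y = (if y \<epsilon> a then F y else m)" for y
  have Fm: "F y \<epsilon> m" if "y \<epsilon> a" for y using F(2) that by (auto simp: image_subset_iff)
  have "dfn G"
    unfolding dfn_def G_def using mM assms(2) by - (assumption | rule dfb T_const dfn_app[OF F(1)])+
  moreover have "G ` El (ins x a) \<subseteq> El (ins m m)"
    using Fm mM assms by (auto simp: G_def)
  moreover have "inj_on G (El (ins x a))"
  proof (rule inj_onI)
    fix y z assume "y \<in> El (ins x a)" "z \<in> El (ins x a)" and eq: "G y = G z"
    then have yz: "y = x \<or> y \<epsilon> a" "z = x \<or> z \<epsilon> a" using assms by auto
    have "y \<epsilon> a \<longleftrightarrow> z \<epsilon> a" using eq Fm[of y] Fm[of z] unfolding G_def by (metis mem_irrefl)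
    then show "y = z" using yz eq F(3) unfolding G_def inj_on_def by auto
  qed
  ultimately have "emb (ins x a) (ins m m)" unfolding emb_def by blast
  then show ?thesis unfolding fin_def using succ_in_omega m by blast
qed

lemma fin_prod: assumes "m \<epsilon> omega" "n \<epsilon> omega" shows "fin (prod m n)"
  using assms(1)
proof (induction m rule: omega_induct)
  case zero
  have "n \<in> M" using assms(2) Ord_in_omega by simp
  then have "El (prod emp n) = El emp" by simp
  then have "prod emp n = emp" using El_inject by blast
  then show ?case unfolding fin_def using emp_in_omega emb_subset[of emp emp] by auto
next
  case (succ k)
  note fk = succ.IH
  have M: "k \<in> M" "n \<in> M" using succ.hyps assms(2) Ord_in_omega by simp_all
  \<comment> \<open>The new row, with first coordinate \<open>k\<close>, is added pair by pair in an
    inner induction.\<close>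
  have "\<exists>B\<in>M. fin B \<and> El B = El (prod k n) \<union> pair k ` El j" if "j \<epsilon> omega" for j
    using that
  proof (induction j rule: omega_induct)
    case zero
    show ?case using fk by (intro bexI[of _ "prod k n"]) auto
  next
    case (succ j)
    from succ.IH obtain B where B: "B \<in> M" "fin B" "El B = El (prod k n) \<union> pair k ` El j" by blast
    have "j \<in> M" using succ.hyps Ord_in_omega by simp
    then have "El (ins (pair k j) B) = El (prod k n) \<union> pair k ` El (ins j j)"
      using B by simp
    then show ?case using fin_ins[OF B(2,1) pair_M] by (intro bexI[of _ "ins (pair k j) B"]) auto
  qed
  then obtain B where B: "B \<in> M" "fin B" "El B = El (prod k n) \<union> pair k ` El n" using assms(2) by blast
  have "El B = El (prod (ins k k) n)" unfolding B(3) using M by auto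
  then show ?case using B(2) El_inject by metis
qed

subsection \<open>Infinite cardinals\<close>

text \<open>Hilbert's hotel: if \<open>k\<close> were the successor of \<open>x\<close>, sending
  \<open>x\<close> to \<open>emp\<close>, shifting the natural numbers and fixing the rest would
  embed \<open>k\<close> into \<open>x\<close>.\<close>

lemma infinite_Card_limit:
  assumes "Card k" "ord_le E omega k" "x \<epsilon> k" shows "ins x x \<epsilon> k"
proof (rule ccontr)
  assume n: "\<not> ?thesis"
  have k: "Ord k" using assms by simp
  have x: "Ord x" "x \<in> M" using Ord_mem[OF k assms(3)] by auto
  have eq: "ins x x = k" using n succ_le_iff[OF x(1) k] assms(3) by (auto simp: ord_le_def)
  have "omega \<noteq> k" using n assms(3) succ_in_omega by blast
  then have "omega \<epsilon> ins x x" using assms(2) eq by (auto simp: ord_le_def)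
  then have ox: "ord_le E omega x" using mem_succ_iff x(1) by blast
  define F where "F y = (if y = x then emp else if y \<epsilon> omega then ins y y else y)" for y
  have oM: "omega \<in> M" by simp
  have "dfn F"
    unfolding dfn_def F_def using x(2) oM by - (assumption | rule dfb T_const)+
  moreover have "F ` El k \<subseteq> El x"
  proof
    fix z assume "z \<in> F ` El k"
    then obtain y where y: "y \<epsilon> ins x x" "z = F y" using eq by auto
    have "emp \<epsilon> x" using mem_ord_le_trans[OF x(1) emp_in_omega ox] .
    moreover have "ins y y \<epsilon> x" if "y \<epsilon> omega" using mem_ord_le_trans[OF x(1) succ_in_omega[OF that] ox] .
    ultimately show "z \<in> El x" using y x(2) unfolding F_def by auto
  qed
  moreover have "inj_on F (El k)"
  proof (rule inj_onI)
    fix y z assume yz: "y \<in> El k" "z \<in> El k" and e: "F y = F z"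
    have o: "Ord y" "Ord z" using yz k Ord_mem by auto
    show "y = z"
      using e succ_neq_emp[of y] succ_neq_emp[of z] succ_inject[OF o] o emp_in_omega
        succ_in_omega[of y] succ_in_omega[of z]
      unfolding F_def by (auto split: if_splits)
  qed
  ultimately have "emb k x" unfolding emb_def by blast
  then have "ord_le E k x" using Card_emb_le assms(1) x(1) by blast
  then show False using not_ord_le[OF k x(1)] assms(3) by blast
qed

lemma prod_emb:
  assumes "emb a a'" "emb b b'" and M: "a \<in> M" "b \<in> M" "a' \<in> M" "b' \<in> M"
  shows "emb (prod a b) (prod a' b')"
proof -
  obtain F where F: "dfn F" "F ` El a \<subseteq> El a'" "inj_on F (El a)" using assms(1) unfolding emb_def by blast
  obtain G where G: "dfn G" "G ` El b \<subseteq> El b'" "inj_on G (El b)" using assms(2) unfolding emb_def by blast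
  define H where "H p = pair (F (pfst p)) (G (psnd p))" for p
  have "dfn H"
    unfolding dfn_def H_def by (rule dfb dfn_app[OF F(1)] dfn_app[OF G(1)])+
  moreover have H: "H (pair x y) = pair (F x) (G y)" if "x \<in> M" "y \<in> M" for x y
    unfolding H_def using that by simp
  have "H ` El (prod a b) \<subseteq> El (prod a' b')"
  proof
    fix z assume "z \<in> H ` El (prod a b)"
    then obtain p where p: "p \<in> El (prod a b)" "z = H p" by blast
    then have "p \<epsilon> prod a b" by simp
    then obtain x y where xy: "x \<in> M" "y \<in> M" "x \<epsilon> a" "y \<epsilon> b" "p = pair x y"
      by (rule in_prodE[OF _ M(1,2)])
    have "F x \<epsilon> a'" "G y \<epsilon> b'" using F(2) G(2) xy by (auto simp: image_subset_iff)
    then have "pair (F x) (G y) \<epsilon> prod a' b'" using M mem_M by simp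
    then show "z \<in> El (prod a' b')" using p(2) xy(5) H[OF xy(1,2)] by simp
  qed
  moreover have "inj_on H (El (prod a b))"
  proof (rule inj_onI)
    fix p q assume "p \<in> El (prod a b)" "q \<in> El (prod a b)" and eq: "H p = H q"
    then have pq: "p \<epsilon> prod a b" "q \<epsilon> prod a b" by simp_all
    obtain x y where xy: "x \<in> M" "y \<in> M" "x \<epsilon> a" "y \<epsilon> b" "p = pair x y"
      by (rule in_prodE[OF pq(1) M(1,2)])
    obtain x' y' where xy': "x' \<in> M" "y' \<in> M" "x' \<epsilon> a" "y' \<epsilon> b" "q = pair x' y'"
      by (rule in_prodE[OF pq(2) M(1,2)])
    have "F x = F x'" "G y = G y'"
      using eq H[OF xy(1,2)] H[OF xy'(1,2)] xy(1,2,5) xy'(1,2,5) dfn_M[OF F(1)] dfn_M[OF G(1)] by auto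
    then have "x = x'" "y = y'" using F(3) G(3) xy xy' unfolding inj_on_def by auto
    then show "p = q" using xy xy' by simp
  qed
  ultimately show ?thesis unfolding emb_def by blast
qed

text \<open>Collapse Goedel's order on \<open>k \<times> k\<close>: a proper initial segment lies in a smaller square.\<close>

theorem Hessenberg:
  assumes "Card k" "ord_le E omega k" shows "emb (prod k k) k"
  using wf_mem assms
proof (induction k rule: wfp_induct_rule)
  case (less k)
  note IH = less.IH
  have k: "Card k" "Ord k" "k \<in> M" "ord_le E omega k" using less.prems by simp_all
  define A where "A = prod k k"
  have A: "A \<in> M" by (simp add: A_def)
  define mx where "mx p = (if pfst p \<epsilon> psnd p then psnd p else pfst p)" for p
  define R where "R p q \<longleftrightarrow> mx p \<epsilon> mx q \<or>
     (mx p = mx q \<and> (pfst p \<epsilon> pfst q \<or> (pfst p = pfst q \<and> psnd p \<epsilon> psnd q)))" for p q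
  have dR: "drel R"
    unfolding drel_def R_def mx_def by (rule dfb)+
  have AE: "pfst p \<epsilon> k" "psnd p \<epsilon> k" "p = pair (pfst p) (psnd p)" "mx p \<epsilon> k"
    "ord_le E (pfst p) (mx p)" "ord_le E (psnd p) (mx p)" if p: "p \<epsilon> A" for p
  proof -
    obtain x y where xy: "x \<in> M" "y \<in> M" "x \<epsilon> k" "y \<epsilon> k" "p = pair x y"
      by (rule in_prodE[OF p[unfolded A_def] k(3,3)])
    then show *: "pfst p \<epsilon> k" "psnd p \<epsilon> k" "p = pair (pfst p) (psnd p)" by simp_all
    then show "mx p \<epsilon> k" unfolding mx_def by simp
    have o: "Ord (pfst p)" "Ord (psnd p)" using * Ord_mem k(2) by blast+
    show "ord_le E (pfst p) (mx p)" "ord_le E (psnd p) (mx p)"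
      using Ord_linear[OF o] unfolding mx_def ord_le_def by auto
  qed
  have o: "Ord (pfst p)" "Ord (psnd p)" "Ord (mx p)" if "p \<epsilon> A" for p
    using AE[OF that] Ord_mem k(2) by blast+
  have tr: "transp_on (El A) R"
  proof (rule transp_onI)
    fix x y z assume h: "x \<in> El A" "y \<in> El A" "z \<in> El A" and "R x y" "R y z"
    then show "R x z"
      unfolding R_def using Ord_trans[OF o(1)[of z]] Ord_trans[OF o(2)[of z]] Ord_trans[OF o(3)[of z]]
      by (auto simp: h)
  qed
  have wf: "wfp_on (El A) R"
  proof -
    let ?e = "{(x, y). x \<epsilon> y}"
    have "wf ?e" using wf_mem by (simp add: wfp_def)
    then have "wf (inv_image (?e <*lex*> ?e <*lex*> ?e) (\<lambda>p. (mx p, pfst p, psnd p)))"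
      by (intro wf_inv_image wf_lex_prod)
    then have "wf {(p, q). R p q}"
      by (rule wf_subset) (auto simp: R_def)
    then have "wfp R" by (simp add: wfp_def)
    then show ?thesis by (rule wfp_on_subset) simp
  qed
  obtain F where F: "dfn F" "\<And>x. x \<epsilon> A \<Longrightarrow> El (F x) = F ` {y\<in>El A. R y x}"
    by (rule collapse[OF dR A tr wf]) blast
  note co = collapse_Ord[OF F(2,1) A tr wf]
  have mem: "u \<epsilon> F x \<longleftrightarrow> (\<exists>y. y \<epsilon> A \<and> R y x \<and> u = F y)" if "x \<epsilon> A" for x u
    using F(2)[OF that] by (auto simp: El_def set_eq_iff)
  have inj: "inj_on F (El A)"
  proof (rule inj_onI)
    fix p q assume "p \<in> El A" "q \<in> El A" and eq: "F p = F q"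
    then have pq: "p \<epsilon> A" "q \<epsilon> A" by auto
    have "\<not> R p q" using mem[OF pq(2), of "F p"] pq eq by auto
    moreover have "\<not> R q p" using mem[OF pq(1), of "F q"] pq eq by auto
    ultimately have "pfst p = pfst q \<and> psnd p = psnd q"
      using Ord_linear[OF o(1)[OF pq(1)] o(1)[OF pq(2)]] Ord_linear[OF o(2)[OF pq(1)] o(2)[OF pq(2)]]
        Ord_linear[OF o(3)[OF pq(1)] o(3)[OF pq(2)]] unfolding R_def by metis
    then show "p = q" using AE(3)[OF pq(1)] AE(3)[OF pq(2)] by simp
  qed
  obtain c where c: "Ord c" "El c = F ` El A" using co(2) by blast
  show ?case
  proof (cases "ord_le E c k")
    case True
    then have "F ` El A \<subseteq> El k" using c ord_le_subset k(2) by blast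
    then show ?thesis unfolding emb_def A_def[symmetric] using F(1) inj by blast
  next
    case False
    then have "k \<in> El c" using not_ord_le c(1) k(2) by simp
    then obtain p where p: "p \<epsilon> A" "k = F p" unfolding c(2) by auto
    \<comment> \<open>Everything before \<open>p\<close> has both coordinates at most
      \<open>mx p\<close>. So \<open>k\<close>, being the collapse of \<open>p\<close>, embeds into
      the square of \<open>g\<close>, and \<open>g\<close> is below \<open>k\<close> because an
      infinite cardinal is a limit.\<close>
    define g where "g = ins (mx p) (mx p)"
    have g: "g \<epsilon> k" unfolding g_def using infinite_Card_limit[OF k(1,4) AE(4)[OF p(1)]] .
    have og: "Ord g" using g k(2) Ord_mem by blast
    obtain G where G: "dfn G" "\<And>x. x \<epsilon> A \<Longrightarrow> G (F x) = x" by (rule ex_left_inverse[OF F(1) inj A]) blast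
    have kE: "\<exists>q. q \<epsilon> prod g g \<and> q \<epsilon> A \<and> u = F q" if u: "u \<epsilon> k" for u
    proof -
      obtain q where q: "q \<epsilon> A" "R q p" "u = F q" using mem[OF p(1)] p(2) u by blast
      have "ord_le E (mx q) (mx p)" using q(2) unfolding R_def ord_le_def by blast
      then have "ord_le E (pfst q) (mx p)" "ord_le E (psnd q) (mx p)"
        using ord_le_trans[OF o(3)[OF p(1)]] AE(5,6)[OF q(1)] by blast+
      then have "pfst q \<epsilon> g" "psnd q \<epsilon> g" unfolding g_def using mem_succ_iff[OF o(3)[OF p(1)]] by blast+
      then have "pair (pfst q) (psnd q) \<epsilon> prod g g" using og by simp
      then show ?thesis using AE(3)[OF q(1)] q by auto
    qed
    have "G ` El k \<subseteq> El (prod g g)"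
    proof
      fix z assume "z \<in> G ` El k"
      then obtain u where u: "u \<epsilon> k" "z = G u" by auto
      obtain q where "q \<epsilon> prod g g" "q \<epsilon> A" "u = F q" using kE[OF u(1)] by blast
      then show "z \<in> El (prod g g)" using u(2) G(2) by simp
    qed
    moreover have "inj_on G (El k)"
    proof (rule inj_onI)
      fix u v assume "u \<in> El k" "v \<in> El k" and eq: "G u = G v"
      then obtain q q' where q: "q \<epsilon> A" "u = F q" "q' \<epsilon> A" "v = F q'" using kE[of u] kE[of v] by auto
      then have "q = q'" using eq G(2)[OF q(1)] G(2)[OF q(3)] by simp
      then show "u = v" using q by simp
    qed
    ultimately have kg: "emb k (prod g g)" unfolding emb_def using G(1) by blast
    \<comment> \<open>Either way the square of \<open>g\<close> is too small to hold
      \<open>k\<close>: by the induction hypothesis for the cardinal of \<open>g\<close>, or because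
      it is finite.\<close>
    show ?thesis
    proof (cases "ord_le E omega g")
      case True
      obtain d where d: "Card d" "ord_le E d g" "emb g d" by (rule ex_card[OF og])
      have dk: "d \<epsilon> k" using ord_le_mem_trans[OF og k(2) d(2) g] .
      have "ord_le E omega d"
      proof (rule ccontr)
        assume "\<not> ?thesis"
        then have "d \<epsilon> omega" using not_ord_le[of omega d] d(1) by simp
        moreover have "emb omega d" using ord_le_emb[OF Ord_omega og True] d(3) emb_trans by blast
        ultimately show False using omega_not_emb by blast
      qed
      then have "emb (prod d d) d" using IH[OF dk d(1)] by blast
      moreover have "emb (prod g g) (prod d d)" using prod_emb[OF d(3,3)] og d(1) by simp
      ultimately have "emb k d" using kg emb_trans by blast
      then have "ord_le E k d" using Card_emb_le k(1) d(1) by simp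
      then show ?thesis using not_ord_le[of k d] k(2) d(1) dk by simp
    next
      case False
      then have "g \<epsilon> omega" using not_ord_le[of omega g] og by simp
      then obtain m where m: "m \<epsilon> omega" "emb (prod g g) m" using fin_prod unfolding fin_def by blast
      have "emb omega m" using ord_le_emb[OF Ord_omega k(2,4)] kg m(2) emb_trans by blast
      then show ?thesis using omega_not_emb m(1) by blast
    qed
  qed
qed


section \<open>Fibres\<close>

text \<open>\<open>pos x\<close> is the order type of the part of the \<open>Q\<close>-class of \<open>x\<close> below \<open>x\<close>.\<close>

lemma fibre_position:
  assumes l: "Ord l" and Q: "drel Q" "transp_on (El l) Q" "symp_on (El l) Q"
  obtains pos where "dfn pos"
    "\<forall>x. x \<epsilon> l \<longrightarrow> Ord (pos x)"
    "\<forall>x u. x \<epsilon> l \<longrightarrow> (u \<epsilon> pos x \<longleftrightarrow> (\<exists>y. y \<epsilon> l \<and> y \<epsilon> x \<and> Q y x \<and> u = pos y))"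
    "\<forall>x y. x \<epsilon> l \<longrightarrow> y \<epsilon> l \<longrightarrow> Q x y \<longrightarrow> pos x = pos y \<longrightarrow> x = y"
    "\<forall>x X F. x \<epsilon> l \<longrightarrow> X \<in> M \<longrightarrow> dfn F \<longrightarrow> (\<forall>y. y \<epsilon> l \<longrightarrow> Q y x \<longrightarrow> F y \<epsilon> X) \<longrightarrow>
       inj_on F {y\<in>El l. Q y x} \<longrightarrow> emb (pos x) X"
proof -
  have lM: "l \<in> M" using l by simp
  define R where "R x y \<longleftrightarrow> x \<epsilon> y \<and> Q x y" for x y
  have dR: "drel R"
    unfolding drel_def R_def by (rule dfb drel_app[OF Q(1)])+
  have tr: "transp_on (El l) R"
  proof (rule transp_onI)
    fix x y z assume h: "x \<in> El l" "y \<in> El l" "z \<in> El l" "R x y" "R y z"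
    then have "Q x z" using Q(2) unfolding transp_on_def R_def by blast
    moreover have "Ord z" using h(3) l Ord_mem by simp
    then have "x \<epsilon> z" using h(4,5) Ord_trans unfolding R_def by blast
    ultimately show "R x z" unfolding R_def by blast
  qed
  have wf: "wfp_on (El l) R" by (rule wfp_on_measure[of _ _ "\<lambda>x. x"]) (simp add: R_def)
  obtain pos where P: "dfn pos" "\<And>x. x \<epsilon> l \<Longrightarrow> El (pos x) = pos ` {y\<in>El l. R y x}"
    by (rule collapse[OF dR lM tr wf]) blast
  note co = collapse_Ord[OF P(2,1) lM tr wf]
  have mem: "u \<epsilon> pos x \<longleftrightarrow> (\<exists>y. y \<epsilon> l \<and> y \<epsilon> x \<and> Q y x \<and> u = pos y)" if "x \<epsilon> l" for x u
    using P(2)[OF that] by (auto simp: El_def set_eq_iff R_def)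
  have sym: "Q y x" if "x \<epsilon> l" "y \<epsilon> l" "Q x y" for x y
    using Q(3) that unfolding symp_on_def by (metis mem_El)
  have inj: "x = y" if h: "x \<epsilon> l" "y \<epsilon> l" "Q x y" "pos x = pos y" for x y
  proof -
    have "\<not> x \<epsilon> y" using mem[OF h(2), of "pos x"] h by auto
    moreover have "\<not> y \<epsilon> x" using mem[OF h(1), of "pos y"] h sym[OF h(1,2,3)] by auto
    moreover have "Ord x" "Ord y" using h l Ord_mem by blast+
    ultimately show ?thesis using Ord_linear by blast
  qed
  have emb: "emb (pos x) X" if h: "x \<epsilon> l" "X \<in> M" "dfn F" "\<forall>y. y \<epsilon> l \<longrightarrow> Q y x \<longrightarrow> F y \<epsilon> X"
    "inj_on F {y\<in>El l. Q y x}" for x X F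
  proof -
    have xM: "x \<in> M" using h(1) lM mem_M by blast
    \<comment> \<open>\<open>G\<close> inverts \<open>pos\<close> on the class of \<open>x\<close>;
      the description is unique there because positions separate the points of a class.\<close>
    define G where "G u = the_M (\<lambda>y. y \<epsilon> l \<and> Q y x \<and> pos y = u)" for u
    have "dfn G"
      unfolding dfn_def G_def using lM xM
      by - (assumption | rule dfb T_const dfn_app[OF P(1)] drel_app[OF Q(1)])+
    then have "dfn (\<lambda>u. F (G u))" using dfn_comp h(3) by blast
    have G: "G (pos y) = y" if y: "y \<epsilon> l" "Q y x" for y
      unfolding G_def
    proof (rule the_M_eq)
      show "y \<epsilon> l \<and> Q y x \<and> pos y = pos y" using y by simp
      show "y \<in> M" using y lM mem_M by blast
      fix z assume z: "z \<epsilon> l \<and> Q z x \<and> pos z = pos y"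
      then have "Q z y"
        using Q(2) sym[OF y(1) h(1) y(2)] y h(1) unfolding transp_on_def by (metis mem_El)
      then show "z = y" using inj z y by blast
    qed
    have GE: "\<exists>y. y \<epsilon> l \<and> Q y x \<and> u = pos y \<and> G u = y" if u: "u \<epsilon> pos x" for u
    proof -
      obtain y where "y \<epsilon> l" "Q y x" "u = pos y" using mem[OF h(1), of u] u by auto
      then show ?thesis using G[of y] by auto
    qed
    have "(\<lambda>u. F (G u)) ` El (pos x) \<subseteq> El X"
    proof
      fix z assume "z \<in> (\<lambda>u. F (G u)) ` El (pos x)"
      then obtain u where "u \<epsilon> pos x" "z = F (G u)" by auto
      then show "z \<in> El X" using GE[of u] h(4) by auto
    qed
    moreover have "inj_on (\<lambda>u. F (G u)) (El (pos x))"
    proof (rule inj_onI)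
      fix u v assume "u \<in> El (pos x)" "v \<in> El (pos x)" and eq: "F (G u) = F (G v)"
      then obtain y z where yz: "y \<epsilon> l" "Q y x" "u = pos y" "G u = y" "z \<epsilon> l" "Q z x" "v = pos z" "G v = z"
        using GE[of u] GE[of v] by auto
      then have "y = z" using eq h(5) unfolding inj_on_def by auto
      then show "u = v" using yz by simp
    qed
    ultimately show ?thesis unfolding emb_def using \<open>dfn (\<lambda>u. F (G u))\<close> by blast
  qed
  show thesis
  proof (rule that[of pos])
    show "dfn pos" by (fact P(1))
    show "\<forall>x. x \<epsilon> l \<longrightarrow> Ord (pos x)" using co(1) by simp
    show "\<forall>x u. x \<epsilon> l \<longrightarrow> (u \<epsilon> pos x \<longleftrightarrow> (\<exists>y. y \<epsilon> l \<and> y \<epsilon> x \<and> Q y x \<and> u = pos y))"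
      using mem by simp
    show "\<forall>x y. x \<epsilon> l \<longrightarrow> y \<epsilon> l \<longrightarrow> Q x y \<longrightarrow> pos x = pos y \<longrightarrow> x = y"
      by (intro allI impI) (rule inj)
    show "\<forall>x X F. x \<epsilon> l \<longrightarrow> X \<in> M \<longrightarrow> dfn F \<longrightarrow> (\<forall>y. y \<epsilon> l \<longrightarrow> Q y x \<longrightarrow> F y \<epsilon> X) \<longrightarrow>
       inj_on F {y\<in>El l. Q y x} \<longrightarrow> emb (pos x) X"
      by (intro allI impI) (rule emb)
  qed
qed

text \<open>Each fibre of \<open>H\<close> embeds into \<open>P\<close>, but by its own map, and
  these maps cannot be chosen simultaneously. Positions replace them: they stay below
  \<open>nu\<close>, since otherwise \<open>nu\<close> would embed into \<open>P\<close>, and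
  \<open>x\<close> is determined by \<open>H x\<close> together with \<open>pos x\<close>. Finally
  \<open>b\<close> times \<open>nu\<close> embeds into the square of \<open>k\<close>, hence into
  \<open>k\<close> by Hessenberg's theorem.\<close>

lemma fibres_bound:
  assumes P: "P \<in> M" "Ord nu" "\<not> emb nu P" and l: "Card l" and b: "Ord b"
    and H: "dfn H" "\<forall>x. x \<epsilon> l \<longrightarrow> H x \<epsilon> b"
    and fib: "\<forall>x. x \<epsilon> l \<longrightarrow> (\<exists>F. dfn F \<and> (\<forall>y. y \<epsilon> l \<longrightarrow> H y = H x \<longrightarrow> F y \<epsilon> P) \<and>
      inj_on F {y\<in>El l. H y = H x})"
    and k: "Card k" "ord_le E omega k" "emb b k" "emb nu k"
  shows "ord_le E l k"
proof -
  define Q where "Q x y \<longleftrightarrow> H x = H y" for x y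
  have Q: "drel Q" unfolding drel_def Q_def by (rule dfb dfn_app[OF H(1)])+
  have Qt: "transp_on (El l) Q" "symp_on (El l) Q"
    by (auto simp: transp_on_def symp_on_def Q_def)
  have lo: "Ord l" using l by simp
  obtain pos where p: "dfn pos" "\<forall>x. x \<epsilon> l \<longrightarrow> Ord (pos x)"
    "\<forall>x y. x \<epsilon> l \<longrightarrow> y \<epsilon> l \<longrightarrow> Q x y \<longrightarrow> pos x = pos y \<longrightarrow> x = y"
    "\<forall>x X F. x \<epsilon> l \<longrightarrow> X \<in> M \<longrightarrow> dfn F \<longrightarrow> (\<forall>y. y \<epsilon> l \<longrightarrow> Q y x \<longrightarrow> F y \<epsilon> X) \<longrightarrow>
       inj_on F {y\<in>El l. Q y x} \<longrightarrow> emb (pos x) X"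
    by (rule fibre_position[OF lo Q Qt]) blast
  have pnu: "pos x \<epsilon> nu" if x: "x \<epsilon> l" for x
  proof (rule ccontr)
    assume "\<not> ?thesis"
    moreover have po: "Ord (pos x)" using p(2) x by blast
    ultimately have "emb nu (pos x)" using not_ord_le[OF P(2) po] ord_le_emb[OF P(2) po] by blast
    moreover obtain F where "dfn F" "\<forall>y. y \<epsilon> l \<longrightarrow> H y = H x \<longrightarrow> F y \<epsilon> P" "inj_on F {y\<in>El l. H y = H x}"
      using fib x by blast
    then have "emb (pos x) P" using p(4)[rule_format, OF x P(1), of F] unfolding Q_def by simp
    ultimately show False using P(3) emb_trans by blast
  qed
  define G where "G x = pair (H x) (pos x)" for x
  have "dfn G" unfolding dfn_def G_def by (rule dfb dfn_app[OF H(1)] dfn_app[OF p(1)])+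
  have M: "b \<in> M" "nu \<in> M" "k \<in> M" using b P(2) k(1) by simp_all
  have GM: "H x \<in> M" "pos x \<in> M" "H x \<epsilon> b" if "x \<epsilon> l" for x
    using H(2) pnu[OF that] that M mem_M by blast+
  have "G ` El l \<subseteq> El (prod b nu)"
  proof
    fix z assume "z \<in> G ` El l"
    then obtain x where x: "x \<epsilon> l" "z = G x" by auto
    then show "z \<in> El (prod b nu)" using GM[OF x(1)] pnu[OF x(1)] M mem_M
      unfolding G_def by (simp del: El_prod)
  qed
  moreover have "inj_on G (El l)"
  proof (rule inj_onI)
    fix x y assume "x \<in> El l" "y \<in> El l" and eq: "G x = G y"
    then have xy: "x \<epsilon> l" "y \<epsilon> l" by auto
    then have "H x = H y" "pos x = pos y" using eq GM[OF xy(1)] GM[OF xy(2)] unfolding G_def by auto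
    then show "x = y" using p(3) xy unfolding Q_def by blast
  qed
  ultimately have "emb l (prod b nu)" unfolding emb_def using \<open>dfn G\<close> by blast
  moreover have "emb (prod b nu) (prod k k)" using prod_emb[OF k(3,4)] M by blast
  ultimately have "emb l k" using Hessenberg[OF k(1,2)] emb_trans by blast
  then show ?thesis using Card_emb_le l k(1) by simp
qed

section \<open>Hartogs and Lindenbaum numbers\<close>

lemma is_hartogs_iff:
  assumes "X \<in> M" "l \<in> M"
  shows "is_hartogs E M X l \<longleftrightarrow> Ord l \<and> \<not> emb l X \<and> (\<forall>b. Ord b \<longrightarrow> \<not> emb b X \<longrightarrow> ord_le E l b)"
proof -
  have "(\<exists>f\<in>M. is_injection E M f b X) \<longleftrightarrow> emb b X" if "b \<in> M" for b
    using injection_iff that assms(1) by blast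
  then show ?thesis
    unfolding is_hartogs_def is_least_ordinal_def Ord_def using assms(2) by auto
qed

lemma is_lindenbaum_iff:
  assumes "X \<in> M" "l \<in> M"
  shows "is_lindenbaum E M X l \<longleftrightarrow> Ord l \<and> l \<noteq> emp \<and> \<not> onto X l \<and>
    (\<forall>b. Ord b \<longrightarrow> b \<noteq> emp \<longrightarrow> \<not> onto X b \<longrightarrow> ord_le E l b)"
proof -
  have "(\<exists>f\<in>M. is_surjection E M f X b) \<longleftrightarrow> onto X b" if "b \<in> M" for b
    using surjection_iff that assms(1) by blast
  then show ?thesis
    unfolding is_lindenbaum_def is_least_ordinal_def Ord_def using assms(2) is_empty_iff by auto
qed

lemma hartogs_Card:
  assumes "X \<in> M" "l \<in> M" "is_hartogs E M X l" shows "Card l"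
proof -
  have l: "Ord l" "\<not> emb l X" "\<forall>b. Ord b \<longrightarrow> \<not> emb b X \<longrightarrow> ord_le E l b"
    using is_hartogs_iff assms by blast+
  show ?thesis
    unfolding Card_iff
  proof (intro conjI allI impI notI)
    show "Ord l" by (fact l(1))
    fix a assume a: "a \<epsilon> l" "eqp a l"
    then have o: "Ord a" using l(1) Ord_mem by blast
    then have "emb l a" using eqp_emb[OF eqp_sym[OF a(2)]] by simp
    then have "\<not> emb a X" using l(2) emb_trans by blast
    then have "ord_le E l a" using l(3) o by blast
    then show False using not_ord_le[OF l(1) o] a(1) by blast
  qed
qed

lemma lindenbaum_Card:
  assumes "X \<in> M" "l \<in> M" "is_lindenbaum E M X l" shows "Card l"
proof -
  have l: "Ord l" "l \<noteq> emp" "\<not> onto X l" "\<forall>b. Ord b \<longrightarrow> b \<noteq> emp \<longrightarrow> \<not> onto X b \<longrightarrow> ord_le E l b"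
    using is_lindenbaum_iff assms by blast+
  show ?thesis
    unfolding Card_iff
  proof (intro conjI allI impI notI)
    show "Ord l" by (fact l(1))
    fix a assume a: "a \<epsilon> l" "eqp a l"
    then have o: "Ord a" using l(1) Ord_mem by blast
    have al: "onto a l" using eqp_onto a(2) by blast
    have "a \<noteq> emp"
    proof
      assume "a = emp"
      then have "El l = {}" using al unfolding onto_def by auto
      then show False using l(2) El_inject El_emp by metis
    qed
    moreover have "\<not> onto X a" using al l(3) onto_trans by blast
    ultimately have "ord_le E l a" using l(4) o by blast
    then show False using not_ord_le[OF l(1) o] a(1) by blast
  qed
qed

lemma hartogs_le_lindenbaum:
  assumes "X \<in> M" "l \<in> M" "is_hartogs E M X l" "k \<in> M" "is_lindenbaum E M X k"
  shows "ord_le E l k"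
proof -
  have k: "Ord k" "k \<noteq> emp" "\<not> onto X k" using is_lindenbaum_iff assms by blast+
  have "\<not> emb k X" using emb_imp_onto[OF _ assms(4,1) k(2)] k(3) by blast
  then show ?thesis using is_hartogs_iff assms k(1) by blast
qed

text \<open>The cardinal \<open>l\<close> itself is the witness: a nonempty ordinal embeds into
  \<open>l\<close> exactly when \<open>l\<close> maps onto it, and these are the ordinals below
  \<open>csucc l\<close>.\<close>

lemma Suc_pairs_subset_Spec: "Suc_pairs E M \<subseteq> Spec_aleph E M"
proof
  fix p assume "p \<in> Suc_pairs E M"
  then obtain k l where kl: "p = (k, k)" "k \<in> M" "l \<in> M" "is_cardinal E M l" "is_card_succ E M l k"
    unfolding Suc_pairs_def by blast
  have l: "Card l" "Ord l" using kl unfolding Card_def by (simp_all add: is_cardinal_def Ord_def)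
  have k: "k = csucc l" using is_card_succ_iff l(2) kl(2,5) by blast
  have ck: "Card k" "Ord k" "l \<epsilon> k" unfolding k using csucc[OF l(2)] by simp_all
  have ne: "\<not> emb k l" using Card_emb_le[OF ck(1) l(2)] not_ord_le[OF ck(2) l(2)] ck(3) by blast
  have "is_hartogs E M l k"
    unfolding is_hartogs_iff[OF kl(3,2)]
  proof (intro conjI allI impI)
    fix b assume b: "Ord b" "\<not> emb b l"
    then have "\<not> b \<epsilon> k" using emb_below_csucc l(1) k by blast
    then show "ord_le E k b" using not_ord_le[OF ck(2) b(1)] by blast
  qed (use ck ne in auto)
  moreover have "is_lindenbaum E M l k"
    unfolding is_lindenbaum_iff[OF kl(3,2)]
  proof (intro conjI allI impI)
    show "k \<noteq> emp" using ck(3) by auto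
    show "\<not> onto l k" using onto_Ord_emb[OF _ l(2) kl(2)] ne by blast
    fix b assume b: "Ord b" "b \<noteq> emp" "\<not> onto l b"
    then have "\<not> emb b l" using emb_imp_onto[OF _ Ord_M kl(3)] by blast
    then have "\<not> b \<epsilon> k" using emb_below_csucc l(1) k by blast
    then show "ord_le E k b" using not_ord_le[OF ck(2) b(1)] by blast
  qed (use ck in auto)
  ultimately show "p \<in> Spec_aleph E M" unfolding Spec_aleph_def kl(1) using kl(2,3) by blast
qed

section \<open>Cofinality\<close>

definition cof :: "('v \<Rightarrow> 'v) \<Rightarrow> 'v \<Rightarrow> 'v \<Rightarrow> bool" where
  "cof d a m \<longleftrightarrow> (\<forall>x. x \<epsilon> a \<longrightarrow> d x \<epsilon> m) \<and> (\<forall>y. y \<epsilon> m \<longrightarrow> (\<exists>x. x \<epsilon> a \<and> ord_le E y (d x)))"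

lemma cofinal_map_iff:
  assumes M: "a \<in> M" "m \<in> M"
  shows "(\<exists>f\<in>M. is_cofinal_map E M f a m) \<longleftrightarrow> (\<exists>d. dfn d \<and> cof d a m)"
proof
  assume "\<exists>f\<in>M. is_cofinal_map E M f a m"
  then obtain f where f: "f \<in> M" "is_function E M f a m"
    "\<forall>b\<in>M. b \<epsilon> m \<longrightarrow> (\<exists>x\<in>M. \<exists>y\<in>M. x \<epsilon> a \<and> has_value E M f x y \<and> ord_le E b y)"
    unfolding is_cofinal_map_def by blast
  note fn = is_function_dfn[OF f(2,1) M]
  have "cof (app f) a m"
    unfolding cof_def
  proof (intro conjI allI impI)
    show "app f x \<epsilon> m" if "x \<epsilon> a" for x using fn(2) that by (auto simp: image_subset_iff)
    fix y assume "y \<epsilon> m"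
    then obtain x z where "x \<in> M" "z \<in> M" "x \<epsilon> a" "has_value E M f x z" "ord_le E y z"
      using f(3) mem_M[OF _ M(2)] by blast
    then show "\<exists>x. x \<epsilon> a \<and> ord_le E y (app f x)" using fn(3)[of x z] by blast
  qed
  then show "\<exists>d. dfn d \<and> cof d a m" using fn(1) by blast
next
  assume "\<exists>d. dfn d \<and> cof d a m"
  then obtain d where d: "dfn d" "cof d a m" by blast
  have "d ` El a \<subseteq> El m" using d(2) unfolding cof_def by auto
  then obtain f where f: "f \<in> M" "is_function E M f a m"
    "\<And>x y. x \<in> M \<Longrightarrow> y \<in> M \<Longrightarrow> has_value E M f x y \<longleftrightarrow> x \<epsilon> a \<and> y = d x"
    by (rule graph[OF d(1) M]) blast
  have "is_cofinal_map E M f a m"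
    unfolding is_cofinal_map_def
  proof (intro conjI ballI impI)
    show "is_function E M f a m" by (fact f(2))
    fix b assume "b \<epsilon> m"
    then obtain x where x: "x \<epsilon> a" "ord_le E b (d x)" using d(2) unfolding cof_def by blast
    then have "x \<in> M" "d x \<in> M" using mem_M[OF _ M(1)] dfn_M[OF d(1)] by blast+
    then show "\<exists>x\<in>M. \<exists>y\<in>M. x \<epsilon> a \<and> has_value E M f x y \<and> ord_le E b y"
      using f(3)[of x "d x"] x by blast
  qed
  then show "\<exists>f\<in>M. is_cofinal_map E M f a m" using f(1) by blast
qed

lemma is_cf_iff:
  assumes "m \<in> M" "t \<in> M"
  shows "is_cf E M m t \<longleftrightarrow> Ord t \<and> (\<exists>d. dfn d \<and> cof d t m) \<and>
    (\<forall>b d. Ord b \<longrightarrow> dfn d \<longrightarrow> cof d b m \<longrightarrow> ord_le E t b)"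
proof -
  have "(\<exists>f\<in>M. is_cofinal_map E M f a m) \<longleftrightarrow> (\<exists>d. dfn d \<and> cof d a m)" if "a \<in> M" for a
    using cofinal_map_iff that assms(1) by blast
  then show ?thesis
    unfolding is_cf_def is_least_ordinal_def Ord_def using assms(2) by auto
qed

lemma ex_cf: assumes "Ord m" obtains t where "t \<in> M" "is_cf E M m t"
proof -
  have c: "\<exists>d. dfn d \<and> cof d m m"
    using dfn_id unfolding cof_def by (intro exI[of _ "\<lambda>x. x"]) auto
  let ?P = "\<lambda>t. \<exists>d. dfn d \<and> cof d t m"
  obtain t where t: "Ord t" "?P t" "\<And>c. Ord c \<Longrightarrow> ?P c \<Longrightarrow> ord_le E t c"
    by (rule Ord_least[of m ?P, OF assms c]) blast
  have "t \<in> M" "m \<in> M" using t(1) assms by simp_all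
  moreover have "is_cf E M m t"
    unfolding is_cf_iff[OF \<open>m \<in> M\<close> \<open>t \<in> M\<close>] using t by blast
  ultimately show thesis using that by blast
qed

lemma cf_Card: assumes "m \<in> M" "t \<in> M" "is_cf E M m t" shows "Card t"
proof -
  obtain d where d: "Ord t" "dfn d" "cof d t m" "\<forall>b d. Ord b \<longrightarrow> dfn d \<longrightarrow> cof d b m \<longrightarrow> ord_le E t b"
    using is_cf_iff[OF assms(1,2)] assms(3) by blast
  show ?thesis
    unfolding Card_iff
  proof (intro conjI allI impI notI)
    show "Ord t" by (fact d(1))
    fix a assume a: "a \<epsilon> t" "eqp a t"
    then obtain F where F: "dfn F" "F ` El a = El t" unfolding eqp_def bij_betw_def by blast
    have o: "Ord a" using a d(1) Ord_mem by blast
    have "cof (\<lambda>x. d (F x)) a m"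
      unfolding cof_def
    proof (intro conjI allI impI)
      fix x assume "x \<epsilon> a"
      then have "F x \<in> El t" unfolding F(2)[symmetric] by simp
      then show "d (F x) \<epsilon> m" using d(3) unfolding cof_def by simp
    next
      fix y assume "y \<epsilon> m"
      then obtain z where z: "z \<epsilon> t" "ord_le E y (d z)" using d(3) unfolding cof_def by blast
      then have "z \<in> F ` El a" unfolding F(2) by simp
      then show "\<exists>x. x \<epsilon> a \<and> ord_le E y (d (F x))" using z(2) by auto
    qed
    then have "ord_le E t a" using d(4) o dfn_comp[OF d(2) F(1)] by blast
    then show False using not_ord_le[OF d(1) o] a(1) by blast
  qed
qed

text \<open>The surjection \<open>f\<close> is turned round without choice: \<open>x\<close> goes to
  the least \<open>a\<close> for which the slice at \<open>a\<close> hits \<open>x\<close>, together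
  with the set of all \<open>s\<close> that hit it there. The second component is a subset of
  \<open>S\<close>, which is where the power set comes from.\<close>

lemma SVC_injective:
  assumes "SVC E M"
  obtains S where "S \<in> M" "\<And>X. X \<in> M \<Longrightarrow> \<exists>h. Ord h \<and> emb X (prod h (Power S))"
proof -
  obtain S where S: "S \<in> M"
    and svc: "\<forall>X\<in>M. \<exists>h\<in>M. is_ordinal E M h \<and>
        (\<exists>c\<in>M. is_product E M h S c \<and> (\<exists>f\<in>M. is_surjection E M f c X))"
    using assms unfolding SVC_def by blast
  have "\<exists>h. Ord h \<and> emb X (prod h (Power S))" if X: "X \<in> M" for X
  proof -
    obtain h c where h: "h \<in> M" "is_ordinal E M h" and c: "c \<in> M" "is_product E M h S c"
      "\<exists>f\<in>M. is_surjection E M f c X"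
      using bspec[OF svc X] by blast
    have oh: "Ord h" using h unfolding Ord_def by blast
    have "c = prod h S" using is_product_iff[OF h(1) S c(1)] c(2) by blast
    then have "onto (prod h S) X" using surjection_iff[OF c(1) X] c(3) by blast
    then obtain f where f: "dfn f" "f ` El (prod h S) = El X" unfolding onto_def by blast
    define A where "A x = lst (\<lambda>a. a \<epsilon> h \<and> (\<exists>s\<in>El S. f (pair a s) = x))" for x
    define B where "B x = mkset (\<lambda>s. s \<epsilon> S \<and> f (pair (A x) s) = x)" for x
    have dA: "dfn A"
      unfolding dfn_def A_def using h(1) S by - (assumption | rule dfb T_const dfn_app[OF f(1)])+
    have dB: "dfn B"
      unfolding dfn_def B_def using S by - (assumption | rule dfb T_const dfn_app[OF f(1)] dfn_app[OF dA])+
    have A: "A x \<epsilon> h \<and> (\<exists>s\<in>El S. f (pair (A x) s) = x)" if x: "x \<epsilon> X" for x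
    proof -
      have "x \<in> f ` El (prod h S)" using x f(2) by simp
      then obtain p where p: "p \<in> El (prod h S)" "x = f p" by blast
      then have "p \<epsilon> prod h S" by simp
      then obtain a s where as: "a \<epsilon> h" "s \<epsilon> S" "p = pair a s" by (rule in_prodE[OF _ h(1) S]) blast
      then have *: "a \<epsilon> h \<and> (\<exists>s\<in>El S. f (pair a s) = x)" using p(2) by auto
      have "Ord a" using Ord_mem[OF oh as(1)] .
      then show ?thesis unfolding A_def using * by (rule lst(2))
    qed
    have xM: "x \<in> M" if "x \<epsilon> X" for x using that X mem_M by blast
    have AM: "A x \<in> M" if "x \<epsilon> X" for x using dfn_M[OF dA xM[OF that]] .
    have B: "El (B x) = {s\<in>El S. f (pair (A x) s) = x}" if x: "x \<epsilon> X" for x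
      unfolding B_def
      by (rule El_sep[OF _ S]) (unfold dpred_def, (rule dfb dfn_app[OF f(1)] T_const AM[OF x] xM[OF x])+)
    have BM: "B x \<in> M" if "x \<epsilon> X" for x using dfn_M[OF dB xM[OF that]] .
    define G where "G x = pair (A x) (B x)" for x
    have "dfn G" unfolding dfn_def G_def by (rule dfb dfn_app[OF dA] dfn_app[OF dB])+
    moreover have "G ` El X \<subseteq> El (prod h (Power S))"
    proof
      fix z assume "z \<in> G ` El X"
      then obtain x where x: "x \<epsilon> X" "z = G x" by auto
      have "B x \<epsilon> Power S" using B[OF x(1)] BM[OF x(1)] S by auto
      then show "z \<in> El (prod h (Power S))"
        unfolding x(2) G_def using A[OF x(1)] AM[OF x(1)] BM[OF x(1)] h(1) by (simp del: El_prod mem_Power)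
    qed
    moreover have "inj_on G (El X)"
    proof (rule inj_onI)
      fix x y assume "x \<in> El X" "y \<in> El X" and eq: "G x = G y"
      then have xy: "x \<epsilon> X" "y \<epsilon> X" by auto
      have e: "A x = A y" "B x = B y" using eq AM BM xy unfolding G_def by simp_all
      obtain s where s: "s \<epsilon> S" "f (pair (A x) s) = x" using A[OF xy(1)] by auto
      then have "s \<in> El (B x)" unfolding B[OF xy(1)] by simp
      then have "s \<in> El (B y)" unfolding e(2) .
      then have "f (pair (A y) s) = y" unfolding B[OF xy(2)] by simp
      then show "x = y" using s(2) unfolding e(1) by simp
    qed
    ultimately have "emb X (prod h (Power S))" unfolding emb_def by blast
    then show ?thesis using oh by blast
  qed
  then show thesis using that S by blast
qed

lemma pair_classI:
  assumes "drel R" "\<And>x y. (x, y) \<in> A \<longleftrightarrow> x \<in> M \<and> y \<in> M \<and> R x y"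
  shows "pair_class E M A"
proof -
  obtain p s where "range s \<subseteq> M"
    "\<And>x y. x \<in> M \<Longrightarrow> y \<in> M \<Longrightarrow> sat E M (s(0 := x, 1 := y)) p \<longleftrightarrow> R x y"
    by (rule drel_formula[OF assms(1)]) blast
  moreover from this have "A = {(x, y). x \<in> M \<and> y \<in> M \<and> sat E M (s(0 := x, 1 := y)) p}"
    using assms(2) by auto
  ultimately show ?thesis unfolding pair_class_def by blast
qed

lemma Card_emp: "Card emp"
  by (simp add: Card_iff)

lemma emp_le: "Ord a \<Longrightarrow> ord_le E emp a"
  using emp_in[of a] unfolding ord_le_def by blast

end

section \<open>The spectrum under small violations of choice\<close>

text \<open>\<open>seed\<close> is the injective form of the choice principle, reached from
  \<open>SVC\<close> by passing to a power set. \<open>nu\<close> is measured against one further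
  power set because it is subsets of \<open>S\<close> that have to be counted.\<close>

locale injective_seed = zf_universe E M for E :: "'v \<Rightarrow> 'v \<Rightarrow> bool" (infix "\<epsilon>" 50) and M +
  fixes S nu :: 'v
  assumes S: "S \<in> M"
    and seed: "\<And>X. X \<in> M \<Longrightarrow> \<exists>h. Ord h \<and> emb X (prod h S)"
    and nu: "Card nu" "ord_le E omega nu" "\<not> emb nu (Power S)"
begin

lemma nu_Ord [simp]: "Ord nu"
  using nu(1) by simp

text \<open>The larger of \<open>b\<close> and \<open>nu\<close> is still below \<open>m\<close>,
  hence so is its cardinal \<open>k\<close>, while \<open>fibres_bound\<close> would give
  \<open>m\<close> at most \<open>k\<close>. This pigeonhole principle covers singular
  \<open>m\<close> too, because the fibres are bounded uniformly by \<open>nu\<close>.\<close>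

lemma fibres_contradiction:
  assumes m: "Card m" "nu \<epsilon> m" "b \<epsilon> m"
    and H: "dfn H" "\<forall>x. x \<epsilon> m \<longrightarrow> H x \<epsilon> b"
    and fib: "\<forall>x. x \<epsilon> m \<longrightarrow> (\<exists>F. dfn F \<and> (\<forall>y. y \<epsilon> m \<longrightarrow> H y = H x \<longrightarrow> F y \<epsilon> Power S) \<and>
      inj_on F {y\<in>El m. H y = H x})"
  shows False
proof -
  have om: "Ord m" using m(1) by simp
  have ob: "Ord b" using Ord_mem om m(3) by blast
  obtain c where c: "Ord c" "c = b \<or> c = nu" "ord_le E b c" "ord_le E nu c"
    by (rule Ord_max[OF ob nu_Ord])
  have cm: "c \<epsilon> m" using c(2) m by blast
  obtain k where k: "Card k" "ord_le E k c" "emb c k" by (rule ex_card[OF c(1)])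
  have e: "emb b k" "emb nu k"
    using ord_le_emb[OF ob c(1,3)] ord_le_emb[OF nu_Ord c(1,4)] k(3) emb_trans by blast+
  have "ord_le E nu k" using Card_emb_le[OF nu(1) _ e(2)] k(1) by simp
  then have ok: "ord_le E omega k" using ord_le_trans[OF _ nu(2)] k(1) by simp
  have "ord_le E m k"
    by (rule fibres_bound[OF _ nu_Ord nu(3) m(1) ob H fib k(1) ok e]) simp
  moreover have "k \<epsilon> m" using ord_le_mem_trans[OF c(1) om k(2) cm] .
  ultimately show False using not_ord_le[of m k] om k(1) by simp
qed

text \<open>\<open>I\<close> identifies \<open>X\<close> with a subset of \<open>m\<close> times
  \<open>S\<close>. The last clause excludes empty sections, so that \<open>X\<close> maps onto
  \<open>m\<close>.\<close>

definition presents :: "('v \<Rightarrow> 'v) \<Rightarrow> 'v \<Rightarrow> 'v \<Rightarrow> bool" where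
  "presents I X m \<longleftrightarrow> X \<in> M \<and> Card m \<and> dfn I \<and> (\<forall>x. x \<epsilon> X \<longrightarrow> I x \<epsilon> prod m S) \<and> inj_on I (El X) \<and>
     (\<forall>a. a \<epsilon> m \<longrightarrow> (\<exists>x. x \<epsilon> X \<and> pfst (I x) = a))"

text \<open>The first coordinates that occur form a set of ordinals. Renumbering them by their
  cardinal removes the empty sections and makes the index set a cardinal.\<close>

lemma ex_presentation: assumes X: "X \<in> M" obtains I m where "presents I X m"
proof -
  obtain h J where h: "Ord h" and J: "dfn J" "J ` El X \<subseteq> El (prod h S)" "inj_on J (El X)"
    using seed[OF X] unfolding emb_def by blast
  have hM: "h \<in> M" using h by simp
  have JE: "\<exists>a s. a \<in> M \<and> s \<in> M \<and> a \<epsilon> h \<and> s \<epsilon> S \<and> J x = pair a s" if "x \<epsilon> X" for x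
  proof -
    have "x \<in> El X" using that by simp
    then have "J x \<in> El (prod h S)" using J(2) by blast
    then have *: "J x \<epsilon> prod h S" by simp
    show ?thesis by (rule in_prodE[OF * hM S]) blast
  qed
  have d: "dfn (\<lambda>x. pfst (J x))" using dfn_comp dfn_pfst J(1) by blast
  obtain b where b: "b \<in> M" "El b = (\<lambda>x. pfst (J x)) ` El X" by (rule replacement[OF d X])
  have "El b \<subseteq> El h" unfolding b(2) using JE by fastforce
  then have "emb b h" by (rule emb_subset)
  then obtain c where c: "Ord c" "eqp b c" using emb_Ord_eqp[OF b(1) h] by metis
  obtain m where m: "Card m" "eqp c m" by (rule ex_card[OF c(1)])
  obtain K where K: "dfn K" "inj_on K (El b)" "K ` El b = El m"
    using eqp_trans[OF c(2) m(2)] unfolding eqp_def bij_betw_def by blast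
  have mM: "m \<in> M" using m(1) by simp
  define I where "I x = pair (K (pfst (J x))) (psnd (J x))" for x
  have "dfn I" unfolding dfn_def I_def by (rule dfb dfn_app[OF J(1)] dfn_app[OF K(1)])+
  have inb: "pfst (J x) \<in> El b" if "x \<epsilon> X" for x unfolding b(2) using that by simp
  have inm: "K (pfst (J x)) \<epsilon> m" if "x \<epsilon> X" for x
  proof -
    have "K (pfst (J x)) \<in> El m" unfolding K(3)[symmetric] using inb[OF that] by (rule imageI)
    then show ?thesis by simp
  qed
  have KM: "K (pfst (J x)) \<in> M" for x using dfn_M[OF K(1)] by simp
  have "I x \<epsilon> prod m S" if x: "x \<epsilon> X" for x
  proof -
    have "psnd (J x) \<epsilon> S" using JE[OF x] by auto
    then show ?thesis unfolding I_def using inm[OF x] mM S KM by simp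
  qed
  moreover have "inj_on I (El X)"
  proof (rule inj_onI)
    fix x y assume "x \<in> El X" "y \<in> El X" and eq: "I x = I y"
    then have xy: "x \<epsilon> X" "y \<epsilon> X" by auto
    have "K (pfst (J x)) = K (pfst (J y))" "psnd (J x) = psnd (J y)"
      using eq KM unfolding I_def by simp_all
    moreover from this(1) have "pfst (J x) = pfst (J y)"
      using K(2) inb[OF xy(1)] inb[OF xy(2)] unfolding inj_on_def by blast
    ultimately have "J x = J y" using JE[OF xy(1)] JE[OF xy(2)] by auto
    then show "x = y" using J(3) xy unfolding inj_on_def by auto
  qed
  moreover have "\<exists>x. x \<epsilon> X \<and> pfst (I x) = a" if a: "a \<epsilon> m" for a
  proof -
    have "a \<in> K ` El b" using a K(3) by simp
    then obtain x where "x \<epsilon> X" "a = K (pfst (J x))" unfolding b(2) by auto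
    then show ?thesis unfolding I_def using KM by auto
  qed
  ultimately have "presents I X m" unfolding presents_def using X m(1) \<open>dfn I\<close> by blast
  then show thesis using that by blast
qed

section \<open>Sections of a presented set and its Lindenbaum number\<close>

context
  fixes I X m assumes pres: "presents I X m"
begin

lemma pres_facts: "X \<in> M" "Card m" "Ord m" "m \<in> M" "dfn I" "inj_on I (El X)"
  using pres unfolding presents_def by simp_all

lemma pres_inj: "x \<epsilon> X \<Longrightarrow> y \<epsilon> X \<Longrightarrow> I x = I y \<Longrightarrow> x = y"
  using pres_facts(6) unfolding inj_on_def by simp

lemma presE:
  assumes "x \<epsilon> X" obtains a s where "a \<in> M" "s \<in> M" "a \<epsilon> m" "s \<epsilon> S" "I x = pair a s"
proof -
  have "I x \<epsilon> prod m S" using pres assms unfolding presents_def by blast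
  then show thesis by (rule in_prodE[OF _ pres_facts(4) S]) (rule that)
qed

lemma pres_fst: "x \<epsilon> X \<Longrightarrow> pfst (I x) \<epsilon> m"
  by (auto elim!: presE)

definition sec :: "'v \<Rightarrow> 'v \<Rightarrow> bool" where "sec a s \<longleftrightarrow> (\<exists>x\<in>El X. I x = pair a s)"

lemma drel_sec: "drel sec"
  unfolding drel_def sec_def using pres_facts(1) by - (assumption | rule dfb T_const dfn_app[OF pres_facts(5)])+

lemma ex_sec: assumes "a \<epsilon> m" obtains s where "s \<in> M" "s \<epsilon> S" "sec a s"
proof -
  obtain x where x: "x \<epsilon> X" "pfst (I x) = a" using pres assms unfolding presents_def by blast
  obtain b s where s: "b \<in> M" "s \<in> M" "b \<epsilon> m" "s \<epsilon> S" "I x = pair b s" by (rule presE[OF x(1)])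
  then have "sec a s" unfolding sec_def using x by (intro bexI[of _ x]) auto
  then show thesis using that s by blast
qed

lemma onto_pres: "onto X m"
proof -
  have "dfn (\<lambda>x. pfst (I x))" using dfn_comp dfn_pfst pres_facts(5) by blast
  moreover have "(\<lambda>x. pfst (I x)) ` El X = El m"
  proof
    show "(\<lambda>x. pfst (I x)) ` El X \<subseteq> El m" using pres_fst by auto
    show "El m \<subseteq> (\<lambda>x. pfst (I x)) ` El X"
    proof
      fix a assume "a \<in> El m"
      then obtain x where "x \<epsilon> X" "pfst (I x) = a" using pres unfolding presents_def by auto
      then show "a \<in> (\<lambda>x. pfst (I x)) ` El X" by auto
    qed
  qed
  ultimately show ?thesis unfolding onto_def by blast
qed

text \<open>Each \<open>d\<close> below \<open>k\<close> is charged to the least index whose section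
  contains a point mapped to \<open>d\<close>. For a fixed index, \<open>d\<close> is determined by
  the set of such points, a nonempty subset of \<open>S\<close>; so the fibres of \<open>H\<close>
  embed into \<open>Power S\<close> and \<open>fibres_bound\<close> applies.\<close>

lemma onto_Card_bound:
  assumes k: "Card k" "onto X k" and c: "Card c" "ord_le E m c" "ord_le E nu c"
  shows "ord_le E k c"
proof -
  obtain g where g: "dfn g" "g ` El X = El k" using k(2) unfolding onto_def by blast
  note XM = pres_facts(1)
  define P where "P d a \<longleftrightarrow> (\<exists>x\<in>El X. g x = d \<and> pfst (I x) = a)" for d a
  define H where "H d = lst (P d)" for d
  have dH: "dfn H"
    unfolding dfn_def H_def P_def using XM
    by - (assumption | rule dfb T_const dfn_app[OF g(1)] dfn_app[OF pres_facts(5)])+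
  have PH: "P d (H d)" "H d \<epsilon> m" if d: "d \<epsilon> k" for d
  proof -
    have "d \<in> g ` El X" using d g(2) by simp
    then obtain x where x: "x \<epsilon> X" "g x = d" by auto
    obtain a s where a: "a \<in> M" "s \<in> M" "a \<epsilon> m" "s \<epsilon> S" "I x = pair a s" by (rule presE[OF x(1)])
    have "P d a" unfolding P_def using x a by auto
    moreover have "Ord a" using a(3) pres_facts(3) Ord_mem by blast
    ultimately show "P d (H d)" unfolding H_def by (rule lst(2)[rotated])
    then obtain y where y: "y \<epsilon> X" "pfst (I y) = H d" unfolding P_def by auto
    then show "H d \<epsilon> m" using pres_fst[OF y(1)] by simp
  qed
  have fib: "\<exists>F. dfn F \<and> (\<forall>y. y \<epsilon> k \<longrightarrow> H y = H d \<longrightarrow> F y \<epsilon> Power S) \<and> inj_on F {y\<in>El k. H y = H d}"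
    if d: "d \<epsilon> k" for d
  proof -
    have HM: "H d \<in> M" using PH(2)[OF d] pres_facts(4) mem_M by blast
    define F where "F y = mkset (\<lambda>s. s \<epsilon> S \<and> (\<exists>x\<in>El X. I x = pair (H d) s \<and> g x = y))" for y
    have dF: "dfn F"
      unfolding dfn_def F_def using XM S HM
      by - (assumption | rule dfb T_const dfn_app[OF g(1)] dfn_app[OF pres_facts(5)])+
    have F: "El (F y) = {s\<in>El S. \<exists>x\<in>El X. I x = pair (H d) s \<and> g x = y}" if y: "y \<in> M" for y
      unfolding F_def
      by (rule El_sep[OF _ S]) (unfold dpred_def,
        (rule dfb dfn_app[OF g(1)] dfn_app[OF pres_facts(5)] T_const S HM XM y)+)
    have kM: "y \<in> M" if "y \<epsilon> k" for y using that k(1) mem_M Card_Ord Ord_M by blast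
    have "F y \<epsilon> Power S" if y: "y \<epsilon> k" for y
      using F[OF kM[OF y]] dfn_M[OF dF kM[OF y]] S by auto
    moreover have "inj_on F {y\<in>El k. H y = H d}"
    proof (rule inj_onI)
      fix y z assume "y \<in> {y\<in>El k. H y = H d}" "z \<in> {y\<in>El k. H y = H d}" and eq: "F y = F z"
      then have yz: "y \<epsilon> k" "H y = H d" "z \<epsilon> k" by auto
      obtain x where x: "x \<epsilon> X" "g x = y" "pfst (I x) = H d" using PH(1)[OF yz(1)] yz(2) unfolding P_def by auto
      obtain a s where a: "a \<in> M" "s \<in> M" "a \<epsilon> m" "s \<epsilon> S" "I x = pair a s" by (rule presE[OF x(1)])
      then have "s \<in> El (F y)" unfolding F[OF kM[OF yz(1)]] using x by auto
      then have "s \<in> El (F z)" unfolding eq .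
      then obtain x' where x': "x' \<epsilon> X" "I x' = pair (H d) s" "g x' = z" unfolding F[OF kM[OF yz(3)]] by auto
      have "I x = I x'" using a x x' by auto
      then have "x = x'" using pres_inj x(1) x'(1) by blast
      then show "y = z" using x x' by simp
    qed
    ultimately show ?thesis using dF by blast
  qed
  have co: "Ord c" using c(1) by simp
  have e: "emb m c" "emb nu c" using ord_le_emb pres_facts(3) co c(2,3) nu_Ord by blast+
  have ow: "ord_le E omega c" using ord_le_trans[OF co nu(2) c(3)] .
  show ?thesis
    by (rule fibres_bound[OF _ nu_Ord nu(3) k(1) pres_facts(3) dH _ _ c(1) ow e]) (use PH(2) fib in simp_all)
qed

text \<open>The bound with \<open>c = m\<close> excludes a surjection onto \<open>csucc m\<close>,
  while \<open>X\<close> maps onto \<open>m\<close> and from there onto every nonempty smaller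
  ordinal and all others of size at most \<open>m\<close>.\<close>

lemma lindenbaum_large: assumes "ord_le E nu m" shows "is_lindenbaum E M X (csucc m)"
proof -
  have s: "Card (csucc m)" "m \<epsilon> csucc m" using csucc pres_facts(3) by blast+
  then have so: "Ord (csucc m)" "csucc m \<in> M" by simp_all
  show ?thesis
    unfolding is_lindenbaum_iff[OF pres_facts(1) so(2)]
  proof (intro conjI allI impI notI)
    show "Ord (csucc m)" by (fact so(1))
    show False if "csucc m = emp" using s(2) that by simp
    show False if "onto X (csucc m)"
      using onto_Card_bound[OF s(1) that pres_facts(2) ord_le_refl assms]
        not_ord_le[OF so(1) pres_facts(3)] s(2) by blast
    fix b assume b: "Ord b" "b \<noteq> emp" "\<not> onto X b"
    have "\<not> b \<epsilon> csucc m"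
    proof
      assume "b \<epsilon> csucc m"
      then have "emb b m" using emb_below_csucc pres_facts(2) by blast
      then have "onto m b" using emb_imp_onto[OF _ Ord_M[OF b(1)] pres_facts(4) b(2)] by blast
      then show False using onto_trans onto_pres b(3) by blast
    qed
    then show "ord_le E (csucc m) b" using not_ord_le so(1) b(1) by blast
  qed
qed

text \<open>With fewer than \<open>nu\<close> indices the bound is taken with \<open>c = nu\<close>.
  The exact value stays open, so these sets are later handled by size alone.\<close>

lemma lindenbaum_small:
  assumes "m \<epsilon> nu" "k \<in> M" "is_lindenbaum E M X k" shows "ord_le E k (csucc nu)"
proof -
  have s: "Card (csucc nu)" "nu \<epsilon> csucc nu" using csucc nu_Ord by blast+
  have so: "Ord (csucc nu)" using s(1) by simp
  have "\<not> onto X (csucc nu)"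
  proof
    assume "onto X (csucc nu)"
    then have "ord_le E (csucc nu) nu"
      using onto_Card_bound[OF s(1) _ nu(1)] assms(1) by (simp add: ord_le_def)
    then show False using not_ord_le[OF so nu_Ord] s(2) by blast
  qed
  moreover have "csucc nu \<noteq> emp" using s(2) by auto
  ultimately show ?thesis using is_lindenbaum_iff[OF pres_facts(1) assms(2)] assms(3) so by blast
qed

section \<open>Classes of indices with equal sections\<close>

definition same :: "'v \<Rightarrow> 'v \<Rightarrow> bool" where "same a b \<longleftrightarrow> (\<forall>s\<in>El S. sec a s \<longleftrightarrow> sec b s)"

lemma same_props: "drel same" "transp_on (El m) same" "symp_on (El m) same"
proof -
  show "drel same"
    unfolding drel_def same_def using S by - (assumption | rule dfb T_const drel_app[OF drel_sec])+
  show "transp_on (El m) same" "symp_on (El m) same"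
    by (auto simp: transp_on_def symp_on_def same_def)
qed

text \<open>The section itself serves as the name of a class; hence the set of classes embeds into
  \<open>Power S\<close>.\<close>

lemma ex_section_code:
  obtains F where "dfn F" "\<And>a. a \<epsilon> m \<Longrightarrow> F a \<epsilon> Power S"
    "\<And>a b. a \<epsilon> m \<Longrightarrow> b \<epsilon> m \<Longrightarrow> F a = F b \<longleftrightarrow> same a b"
proof -
  define F where "F a = mkset (\<lambda>s. s \<epsilon> S \<and> sec a s)" for a
  have dF: "dfn F"
    unfolding dfn_def F_def using S by - (assumption | rule dfb T_const drel_app[OF drel_sec])+
  have mM: "a \<in> M" if "a \<epsilon> m" for a using that pres_facts(4) mem_M by blast
  have F: "El (F a) = {s\<in>El S. sec a s}" if a: "a \<epsilon> m" for a
    unfolding F_def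
    by (rule El_sep[OF _ S]) (unfold dpred_def, (rule dfb drel_app[OF drel_sec] T_const mM[OF a])+)
  show thesis
  proof (rule that[OF dF])
    show "F a \<epsilon> Power S" if "a \<epsilon> m" for a using F[OF that] dfn_M[OF dF mM[OF that]] S by auto
    show "F a = F b \<longleftrightarrow> same a b" if ab: "a \<epsilon> m" "b \<epsilon> m" for a b
      unfolding El_inject[symmetric] F[OF ab(1)] F[OF ab(2)] same_def by blast
  qed
qed

text \<open>Indices with equal sections share their points, so a single \<open>s\<close> from the
  section of \<open>a\<close> serves the whole class, and \<open>b\<close> is lifted to the point
  with code \<open>pair b s\<close>.\<close>

lemma ex_fibre_lift:
  assumes "a \<epsilon> m"
  obtains F where "dfn F" "\<forall>b. b \<epsilon> m \<longrightarrow> same b a \<longrightarrow> F b \<epsilon> X" "inj_on F {b\<in>El m. same b a}"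
proof -
  obtain s where s: "s \<in> M" "s \<epsilon> S" "sec a s" by (rule ex_sec[OF assms])
  define F where "F b = the_M (\<lambda>x. x \<epsilon> X \<and> I x = pair b s)" for b
  have dF: "dfn F"
    unfolding dfn_def F_def using s(1) pres_facts(1)
    by - (assumption | rule dfb T_const dfn_app[OF pres_facts(5)])+
  have F: "F b \<epsilon> X \<and> I (F b) = pair b s" if b: "b \<epsilon> m" "same b a" for b
  proof -
    have "sec b s" using b(2) s(2,3) unfolding same_def by simp
    then obtain x where x: "x \<epsilon> X" "I x = pair b s" unfolding sec_def by auto
    have "F b = x" unfolding F_def
    proof (rule the_M_eq)
      show "x \<epsilon> X \<and> I x = pair b s" using x by simp
      show "x \<in> M" using x(1) pres_facts(1) mem_M by blast
      show "y = x" if "y \<epsilon> X \<and> I y = pair b s" for y using that pres_inj x by simp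
    qed
    then show ?thesis using x by simp
  qed
  show thesis
  proof (rule that[OF dF])
    show "\<forall>b. b \<epsilon> m \<longrightarrow> same b a \<longrightarrow> F b \<epsilon> X" using F by simp
    show "inj_on F {b\<in>El m. same b a}"
    proof (rule inj_onI)
      fix b c assume "b \<in> {b\<in>El m. same b a}" "c \<in> {b\<in>El m. same b a}" and eq: "F b = F c"
      then have bc: "b \<epsilon> m" "same b a" "c \<epsilon> m" "same c a" by auto
      have "pair b s = pair c s" using F[OF bc(1,2)] F[OF bc(3,4)] eq by simp
      then show "b = c" using bc pres_facts(4) mem_M s(1) by simp
    qed
  qed
qed

text \<open>Positions are unbounded in \<open>m\<close> once \<open>m\<close> exceeds
  \<open>nu\<close>: different indices in the same position have different sections, so if all
  positions were below some \<open>b\<close>, the fibres of \<open>pos\<close> would embed into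
  \<open>Power S\<close>, against the pigeonhole principle. A position embeds into \<open>X\<close>
  through the lift of its class.\<close>

lemma ex_position:
  obtains pos where "dfn pos"
    "\<And>a. a \<epsilon> m \<Longrightarrow> Ord (pos a)"
    "\<And>a u. a \<epsilon> m \<Longrightarrow> u \<epsilon> pos a \<longleftrightarrow> (\<exists>b. b \<epsilon> m \<and> b \<epsilon> a \<and> same b a \<and> u = pos b)"
    "\<And>a b. a \<epsilon> m \<Longrightarrow> b \<epsilon> m \<Longrightarrow> same a b \<Longrightarrow> pos a = pos b \<Longrightarrow> a = b"
    "\<And>a. a \<epsilon> m \<Longrightarrow> emb (pos a) X"
    "\<And>b. nu \<epsilon> m \<Longrightarrow> b \<epsilon> m \<Longrightarrow> \<exists>a. a \<epsilon> m \<and> ord_le E b (pos a)"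
proof -
  obtain pos where p: "dfn pos"
    "\<forall>x. x \<epsilon> m \<longrightarrow> Ord (pos x)"
    "\<forall>x u. x \<epsilon> m \<longrightarrow> (u \<epsilon> pos x \<longleftrightarrow> (\<exists>y. y \<epsilon> m \<and> y \<epsilon> x \<and> same y x \<and> u = pos y))"
    "\<forall>x y. x \<epsilon> m \<longrightarrow> y \<epsilon> m \<longrightarrow> same x y \<longrightarrow> pos x = pos y \<longrightarrow> x = y"
    "\<forall>x X F. x \<epsilon> m \<longrightarrow> X \<in> M \<longrightarrow> dfn F \<longrightarrow> (\<forall>y. y \<epsilon> m \<longrightarrow> same y x \<longrightarrow> F y \<epsilon> X) \<longrightarrow>
       inj_on F {y\<in>El m. same y x} \<longrightarrow> emb (pos x) X"
    by (rule fibre_position[OF pres_facts(3) same_props])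
  have unbounded: "\<exists>a. a \<epsilon> m \<and> ord_le E b (pos a)" if m: "nu \<epsilon> m" "b \<epsilon> m" for b
  proof (rule ccontr)
    assume n: "\<not> ?thesis"
    have ob: "Ord b" using m(2) pres_facts(3) Ord_mem by blast
    have H: "\<forall>a. a \<epsilon> m \<longrightarrow> pos a \<epsilon> b" using n p(2) not_ord_le[OF ob] by blast
    obtain F where F: "dfn F" "\<And>a. a \<epsilon> m \<Longrightarrow> F a \<epsilon> Power S"
      "\<And>a b. a \<epsilon> m \<Longrightarrow> b \<epsilon> m \<Longrightarrow> F a = F b \<longleftrightarrow> same a b" by (rule ex_section_code) blast
    have fib: "\<forall>x. x \<epsilon> m \<longrightarrow> (\<exists>F. dfn F \<and> (\<forall>y. y \<epsilon> m \<longrightarrow> pos y = pos x \<longrightarrow> F y \<epsilon> Power S) \<and>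
      inj_on F {y\<in>El m. pos y = pos x})"
    proof (intro allI impI exI conjI)
      show "dfn F" by (fact F(1))
      show "F y \<epsilon> Power S" if "y \<epsilon> m" for y using F(2) that .
      show "inj_on F {y\<in>El m. pos y = pos x}" for x
      proof (rule inj_onI)
        fix y z assume "y \<in> {y\<in>El m. pos y = pos x}" "z \<in> {y\<in>El m. pos y = pos x}" and eq: "F y = F z"
        then have yz: "y \<epsilon> m" "z \<epsilon> m" "pos y = pos z" by auto
        then have "same y z" using F(3)[OF yz(1,2)] eq by blast
        then show "y = z" using p(4) yz by blast
      qed
    qed
    show False by (rule fibres_contradiction[OF pres_facts(2) m p(1) H fib])
  qed
  show thesis
  proof (rule that[OF p(1)])
    show "emb (pos a) X" if a: "a \<epsilon> m" for a
    proof -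
      obtain F where F: "dfn F" "\<forall>b. b \<epsilon> m \<longrightarrow> same b a \<longrightarrow> F b \<epsilon> X" "inj_on F {b\<in>El m. same b a}"
        by (rule ex_fibre_lift[OF a])
      then show ?thesis using p(5)[rule_format, OF a pres_facts(1) F(1)] by simp
    qed
    show "\<exists>a. a \<epsilon> m \<and> ord_le E b (pos a)" if "nu \<epsilon> m" "b \<epsilon> m" for b using unbounded that .
  qed (use p(2-4) in simp_all)
qed

text \<open>Every ordinal below \<open>m\<close> embeds into some position, and positions embed into
  \<open>X\<close>.\<close>

lemma hartogs_lower:
  assumes "nu \<epsilon> m" "l \<in> M" "is_hartogs E M X l" shows "ord_le E m l"
proof (rule ccontr)
  assume n: "\<not> ?thesis"
  have l: "Ord l" "\<not> emb l X" using is_hartogs_iff[OF pres_facts(1) assms(2)] assms(3) by blast+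
  have lm: "l \<epsilon> m" using n not_ord_le pres_facts(3) l(1) by blast
  obtain pos where p: "\<And>a. a \<epsilon> m \<Longrightarrow> Ord (pos a)" "\<And>a. a \<epsilon> m \<Longrightarrow> emb (pos a) X"
    "\<And>b. nu \<epsilon> m \<Longrightarrow> b \<epsilon> m \<Longrightarrow> \<exists>a. a \<epsilon> m \<and> ord_le E b (pos a)"
    by (rule ex_position) blast
  obtain a where a: "a \<epsilon> m" "ord_le E l (pos a)" using p(3)[OF assms(1) lm] by blast
  have "emb l (pos a)" using ord_le_emb[OF l(1) p(1)[OF a(1)] a(2)] .
  then show False using p(2)[OF a(1)] l(2) emb_trans by blast
qed

end

end

section \<open>Small cofinality and choiceless sequences\<close>

context injective_seed
begin

text \<open>
  \<open>Z\<close> codes a decreasing \<open>t\<close>-sequence of nonempty subsets of \<open>S\<close> without a choice function.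
\<close>

definition choiceless :: "'v \<Rightarrow> 'v \<Rightarrow> bool" where
  "choiceless t Z \<longleftrightarrow> (\<forall>j\<in>El t. \<exists>s\<in>El S. pair j s \<epsilon> Z) \<and>
     (\<forall>j\<in>El t. \<forall>i\<in>El j. \<forall>s\<in>El S. pair j s \<epsilon> Z \<longrightarrow> pair i s \<epsilon> Z) \<and>
     \<not> (\<exists>c\<in>M. \<forall>j\<in>El t. app c j \<epsilon> S \<and> pair j (app c j) \<epsilon> Z)"

lemma D_choiceless [dfb]: "T t \<Longrightarrow> T u \<Longrightarrow> D (\<lambda>s. choiceless (t s) (u s))"
  by (rule drel_app[of choiceless]) (unfold drel_def choiceless_def, (rule dfb T_const S)+)

text \<open>By minimality of the length \<open>t\<close>, the part of \<open>d\<close> below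
  \<open>j\<close> is not cofinal.\<close>

lemma cof_bounded_below:
  assumes "Ord m" "Ord t" "dfn d" "cof d t m" "\<forall>b d. Ord b \<longrightarrow> dfn d \<longrightarrow> cof d b m \<longrightarrow> ord_le E t b" "j \<epsilon> t"
  obtains b where "b \<epsilon> m" "\<And>i. i \<epsilon> j \<Longrightarrow> d i \<epsilon> b"
proof -
  have o: "Ord j" using assms(2,6) Ord_mem by blast
  have "\<not> cof d j m" using assms(3,5,6) o not_ord_le[OF assms(2) o] by blast
  moreover have dm: "d i \<epsilon> m" if "i \<epsilon> j" for i
    using that Ord_trans[OF assms(2,6)] assms(4) unfolding cof_def by blast
  ultimately obtain b where b: "b \<epsilon> m" "\<And>i. i \<epsilon> j \<Longrightarrow> \<not> ord_le E b (d i)"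
    unfolding cof_def by blast
  have "d i \<epsilon> b" if "i \<epsilon> j" for i
    using not_ord_le[of b "d i"] b(2)[OF that] Ord_mem[OF assms(1)] b(1) dm[OF that] by blast
  then show thesis using that b(1) by blast
qed

text \<open>If \<open>m\<close> does not embed into \<open>X\<close>, the positions in each single
  class are bounded in \<open>m\<close>, because an unbounded class would realise every position and
  lift to a copy of \<open>m\<close>. All positions together are unbounded, so the bounds of the
  classes are cofinal, and there are too few classes for \<open>t\<close> to reach
  \<open>nu\<close>.\<close>

lemma cf_below_nu:
  assumes pres: "presents I X m" and m: "nu \<epsilon> m" "\<not> emb m X" and t: "t \<in> M" "is_cf E M m t"
  shows "t \<epsilon> nu" and "\<exists>Z\<in>M. choiceless t Z"
proof -
  note pf = pres_facts[OF pres]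
  let ?same = "same I X"
  let ?sec = "sec I X"
  note dsec = drel_sec[OF pres] and dsame = same_props(1)[OF pres]
  have mM: "a \<in> M" "Ord a" if "a \<epsilon> m" for a using that pf mem_M Ord_mem by blast+
  have same_sym: "?same b a" if "?same a b" for a b
    using that unfolding same_def[OF pres] by blast
  have same_refl: "?same a a" for a
    unfolding same_def[OF pres] by blast
  have same_trans: "?same a c" if "?same a b" "?same b c" for a b c
    using that unfolding same_def[OF pres] by blast
  obtain pos where p: "dfn pos" "\<And>a. a \<epsilon> m \<Longrightarrow> Ord (pos a)"
    "\<And>a u. a \<epsilon> m \<Longrightarrow> u \<epsilon> pos a \<longleftrightarrow> (\<exists>b. b \<epsilon> m \<and> b \<epsilon> a \<and> ?same b a \<and> u = pos b)"
    "\<And>a b. a \<epsilon> m \<Longrightarrow> b \<epsilon> m \<Longrightarrow> ?same a b \<Longrightarrow> pos a = pos b \<Longrightarrow> a = b"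
    "\<And>b. nu \<epsilon> m \<Longrightarrow> b \<epsilon> m \<Longrightarrow> \<exists>a. a \<epsilon> m \<and> ord_le E b (pos a)"
    by (rule ex_position[OF pres]) blast
  \<comment> \<open>The positions occurring in a class form an initial segment of the
    ordinals.\<close>
  have down: "\<exists>b. b \<epsilon> m \<and> ?same b a \<and> pos b = u" if a: "a \<epsilon> m" "ord_le E u (pos a)" for a u
  proof (cases "u = pos a")
    case True
    then show ?thesis using a same_refl by blast
  next
    case False
    then have "u \<epsilon> pos a" using a(2) unfolding ord_le_def by blast
    then obtain b where "b \<epsilon> m" "?same b a" "u = pos b" using p(3)[OF a(1), of u] by auto
    then show ?thesis by auto
  qed
  have bounded: "\<exists>b. b \<epsilon> m \<and> (\<forall>y. y \<epsilon> m \<longrightarrow> ?same y a \<longrightarrow> pos y \<epsilon> b)" if a: "a \<epsilon> m" for a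
  proof (rule ccontr)
    assume n: "\<not> ?thesis"
    have ex: "\<exists>y. y \<epsilon> m \<and> ?same y a \<and> pos y = b" if b: "b \<epsilon> m" for b
    proof -
      obtain y where y: "y \<epsilon> m" "?same y a" "\<not> pos y \<epsilon> b" using n b by blast
      then have "ord_le E b (pos y)" using not_ord_le[OF mM(2)[OF b] p(2)[OF y(1)]] by blast
      then obtain z where "z \<epsilon> m" "?same z y" "pos z = b" using down[OF y(1)] by blast
      then show ?thesis using same_trans y(2) by blast
    qed
    obtain F where F: "dfn F" "\<forall>b. b \<epsilon> m \<longrightarrow> ?same b a \<longrightarrow> F b \<epsilon> X" "inj_on F {b\<in>El m. ?same b a}"
      by (rule ex_fibre_lift[OF pres a])
    define G where "G b = lst (\<lambda>y. y \<epsilon> m \<and> ?same y a \<and> pos y = b)" for b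
    have dG: "dfn G"
      unfolding dfn_def G_def using pf(4) mM(1)[OF a]
      by - (assumption | rule dfb T_const drel_app[OF dsame] dfn_app[OF p(1)])+
    have G: "G b \<epsilon> m \<and> ?same (G b) a \<and> pos (G b) = b" if b: "b \<epsilon> m" for b
    proof -
      obtain y where y: "y \<epsilon> m \<and> ?same y a \<and> pos y = b" using ex[OF b] by blast
      then have "Ord y" using mM(2) by blast
      then show ?thesis unfolding G_def using y by (rule lst(2))
    qed
    have "(\<lambda>b. F (G b)) ` El m \<subseteq> El X" using G F(2) by auto
    moreover have "inj_on (\<lambda>b. F (G b)) (El m)"
    proof (rule inj_onI)
      fix b c assume "b \<in> El m" "c \<in> El m" and eq: "F (G b) = F (G c)"
      then have g: "G b \<epsilon> m \<and> ?same (G b) a \<and> pos (G b) = b" "G c \<epsilon> m \<and> ?same (G c) a \<and> pos (G c) = c"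
        using G by simp_all
      then have "G b = G c" using F(3) eq unfolding inj_on_def by simp
      then show "b = c" using g by metis
    qed
    ultimately have "emb m X" unfolding emb_def using dfn_comp[OF F(1) dG] by blast
    then show False using m(2) by blast
  qed
  obtain d where d: "Ord t" "dfn d" "cof d t m" "\<forall>b d. Ord b \<longrightarrow> dfn d \<longrightarrow> cof d b m \<longrightarrow> ord_le E t b"
    using is_cf_iff[OF pf(4) t(1)] t(2) by blast
  show "t \<epsilon> nu"
  proof -
    \<comment> \<open>Least representatives turn the classes into a set \<open>A\<close> of
      ordinals. The section codes embed \<open>A\<close> into \<open>Power S\<close>, which forces
      the equinumerous ordinal \<open>c\<close> below \<open>nu\<close>.\<close>
    define r where "r a = lst (\<lambda>b. b \<epsilon> m \<and> ?same b a)" for a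
    have dr: "dfn r"
      unfolding dfn_def r_def using pf(4) by - (assumption | rule dfb T_const drel_app[OF dsame])+
    have r: "r a \<epsilon> m \<and> ?same (r a) a" if a: "a \<epsilon> m" for a
    proof -
      have "a \<epsilon> m \<and> ?same a a" using a same_refl by blast
      with mM(2)[OF a] show ?thesis unfolding r_def by (rule lst(2))
    qed
    have r_eq: "r a = r b" if "?same a b" for a b
    proof -
      have "(\<lambda>c. c \<epsilon> m \<and> ?same c a) = (\<lambda>c. c \<epsilon> m \<and> ?same c b)"
        using that same_sym same_trans by blast
      then show ?thesis unfolding r_def by simp
    qed
    obtain A where A: "A \<in> M" "El A = r ` El m" by (rule replacement[OF dr pf(4)])
    have Am: "El A \<subseteq> El m" unfolding A(2) using r by auto
    obtain c where c: "Ord c" "eqp A c" using emb_Ord_eqp[OF A(1) pf(3) emb_subset[OF Am]] by metis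
    obtain F where F: "dfn F" "\<And>a. a \<epsilon> m \<Longrightarrow> F a \<epsilon> Power S"
      "\<And>a b. a \<epsilon> m \<Longrightarrow> b \<epsilon> m \<Longrightarrow> F a = F b \<longleftrightarrow> ?same a b" by (rule ex_section_code[OF pres]) blast
    have "inj_on F (El A)"
    proof (rule inj_onI)
      fix a b assume "a \<in> El A" "b \<in> El A" and eq: "F a = F b"
      then obtain a' b' where ab: "a' \<epsilon> m" "a = r a'" "b' \<epsilon> m" "b = r b'" unfolding A(2) by auto
      then have rr: "r a' \<epsilon> m" "?same (r a') a'" "r b' \<epsilon> m" "?same (r b') b'" using r by auto
      then have "?same (r a') (r b')" using F(3) eq ab by auto
      then have "?same a' b'" using rr same_sym same_trans by blast
      then show "a = b" using r_eq ab by simp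
    qed
    moreover have "F ` El A \<subseteq> El (Power S)"
    proof
      fix z assume "z \<in> F ` El A"
      then obtain a where "a \<in> El A" "z = F a" by blast
      moreover then have "a \<epsilon> m" using Am by (metis mem_El subsetD)
      ultimately show "z \<in> El (Power S)" using F(2)[of a] by (simp del: El_Power mem_Power)
    qed
    ultimately have "emb A (Power S)" unfolding emb_def using F(1) by blast
    then have "emb c (Power S)" using eqp_emb[OF eqp_sym[OF c(2) A(1)]] emb_trans by blast
    then have "\<not> ord_le E nu c" using ord_le_emb[OF nu_Ord c(1)] nu(3) emb_trans by blast
    then have cnu: "c \<epsilon> nu" using not_ord_le[OF nu_Ord c(1)] by blast
    obtain K where K: "dfn K" "K ` El c = El A"
      using eqp_sym[OF c(2) A(1)] unfolding eqp_def bij_betw_def by blast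
    \<comment> \<open>The least strict bound for the positions in the class of \<open>a\<close>.
      Over the representatives these bounds are cofinal in \<open>m\<close>, which gives a cofinal
      map of length \<open>c\<close>.\<close>
    define v where "v a = lst (\<lambda>b. b \<epsilon> m \<and> (\<forall>y\<in>M. y \<epsilon> m \<longrightarrow> ?same y a \<longrightarrow> pos y \<epsilon> b))" for a
    have dv: "dfn v"
      unfolding dfn_def v_def using pf(4) by - (assumption | rule dfb T_const drel_app[OF dsame] dfn_app[OF p(1)])+
    have v: "v a \<epsilon> m \<and> (\<forall>y\<in>M. y \<epsilon> m \<longrightarrow> ?same y a \<longrightarrow> pos y \<epsilon> v a)" if a: "a \<epsilon> m" for a
    proof -
      obtain b where b: "b \<epsilon> m \<and> (\<forall>y\<in>M. y \<epsilon> m \<longrightarrow> ?same y a \<longrightarrow> pos y \<epsilon> b)" using bounded[OF a] by blast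
      then have "Ord b" using mM(2) by blast
      then show ?thesis unfolding v_def using b by (rule lst(2))
    qed
    have "cof (\<lambda>z. v (K z)) c m"
      unfolding cof_def
    proof (intro conjI allI impI)
      fix z assume "z \<epsilon> c"
      then have "K z \<in> El A" unfolding K(2)[symmetric] by simp
      then have "K z \<epsilon> m" using Am by (metis mem_El subsetD)
      then show "v (K z) \<epsilon> m" using v by blast
    next
      fix b assume b: "b \<epsilon> m"
      obtain a where a: "a \<epsilon> m" "ord_le E b (pos a)" using p(5)[OF m(1) b] by blast
      have "r a \<in> K ` El c" unfolding K(2) A(2) using a(1) by simp
      then obtain z where z: "z \<epsilon> c" "r a = K z" by auto
      have ra: "r a \<epsilon> m" "?same a (r a)" using r[OF a(1)] same_sym by blast+
      then have "pos a \<epsilon> v (r a)" using v[OF ra(1)] a(1) mM(1)[OF a(1)] by blast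
      moreover have "Ord (v (r a))" using v[OF ra(1)] mM(2) by blast
      ultimately have "b \<epsilon> v (r a)" using ord_le_mem_trans[OF p(2)[OF a(1)] _ a(2)] by blast
      then show "\<exists>z. z \<epsilon> c \<and> ord_le E b (v (K z))" using z unfolding ord_le_def by auto
    qed
    then have "ord_le E t c" using d(4) c(1) dfn_comp[OF dv K(1)] by blast
    then show "t \<epsilon> nu" using ord_le_mem_trans[OF c(1) nu_Ord _ cnu] by blast
  qed
  show "\<exists>Z\<in>M. choiceless t Z"
  proof -
    \<comment> \<open>Stage \<open>j\<close> is the union of the sections of those indices whose
      position reaches \<open>d i\<close> for every \<open>i\<close> up to \<open>j\<close>. Asking
      for all these \<open>i\<close> makes the stages decrease although \<open>d\<close> may fail to
      be monotone.\<close>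
    define Zp where "Zp j s \<longleftrightarrow> (\<exists>a\<in>El m. ?sec a s \<and> (\<forall>i\<in>El t. ord_le E i j \<longrightarrow> ord_le E (d i) (pos a)))" for j s
    have "dpred (\<lambda>q. Zp (pfst q) (psnd q))"
      unfolding dpred_def Zp_def using pf(4) t(1)
      by - (assumption | rule dfb T_const drel_app[OF dsec] dfn_app[OF p(1)] dfn_app[OF d(2)])+
    then obtain Z where Z: "Z \<in> M" "El Z = {q\<in>El (prod t S). Zp (pfst q) (psnd q)}"
      using separation[of "\<lambda>q. Zp (pfst q) (psnd q)" "prod t S"] by auto
    have tM: "j \<in> M" "Ord j" if "j \<epsilon> t" for j using that d(1) Ord_mem t(1) mem_M by blast+
    have SM: "s \<in> M" if "s \<epsilon> S" for s using that S mem_M by blast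
    have memZ: "pair j s \<epsilon> Z \<longleftrightarrow> Zp j s" if js: "j \<epsilon> t" "s \<epsilon> S" for j s
    proof -
      have "pair j s \<epsilon> Z \<longleftrightarrow> pair j s \<in> El Z" by simp
      also have "\<dots> \<longleftrightarrow> Zp j s"
        unfolding Z(2) using js tM(1)[OF js(1)] SM[OF js(2)] t(1) S by (simp del: El_prod)
      finally show ?thesis .
    qed
    have "choiceless t Z"
      unfolding choiceless_def
    proof (intro conjI ballI impI notI)
      fix j assume "j \<in> El t"
      then have j: "j \<epsilon> t" by simp
      \<comment> \<open>Nonemptiness of the stage: the values of \<open>d\<close> before
        \<open>j\<close> have a bound in \<open>m\<close>, and some position reaches both this bound
        and \<open>d j\<close>.\<close>
      obtain b where b: "b \<epsilon> m" "\<And>i. i \<epsilon> j \<Longrightarrow> d i \<epsilon> b" by (rule cof_bounded_below[OF pf(3) d j]) blast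
      have dj: "d j \<epsilon> m" using d(3) j unfolding cof_def by blast
      obtain b' where b': "Ord b'" "b' = b \<or> b' = d j" "ord_le E b b'" "ord_le E (d j) b'"
        by (rule Ord_max[OF mM(2)[OF b(1)] mM(2)[OF dj]])
      have "b' \<epsilon> m" using b'(2) b(1) dj by blast
      then obtain a where a: "a \<epsilon> m" "ord_le E b' (pos a)" using p(5)[OF m(1)] by blast
      obtain s where s: "s \<in> M" "s \<epsilon> S" "?sec a s" by (rule ex_sec[OF pres a(1)])
      have po: "Ord (pos a)" using p(2)[OF a(1)] .
      have "ord_le E (d i) (pos a)" if "ord_le E i j" for i
      proof -
        have "ord_le E (d i) b'"
        proof (cases "i = j")
          case True
          then show ?thesis using b'(4) by simp
        next
          case False
          then have "d i \<epsilon> b" using that b(2) unfolding ord_le_def by blast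
          then show ?thesis using mem_ord_le_trans[OF b'(1) _ b'(3)] unfolding ord_le_def by blast
        qed
        then show ?thesis using ord_le_trans[OF po _ a(2)] by blast
      qed
      then have "Zp j s" unfolding Zp_def using a(1) s(3) by auto
      then show "\<exists>s\<in>El S. pair j s \<epsilon> Z" using memZ[OF j s(2)] s(2) by auto
    next
      fix j i s assume "j \<in> El t" "i \<in> El j" "s \<in> El S" and z: "pair j s \<epsilon> Z"
      then have h: "j \<epsilon> t" "i \<epsilon> j" "s \<epsilon> S" by auto
      have it: "i \<epsilon> t" using Ord_trans[OF d(1) h(1,2)] .
      have "ord_le E i' j" if "ord_le E i' i" for i'
        using ord_le_trans[OF tM(2)[OF h(1)] that] h(2) unfolding ord_le_def by blast
      then have "Zp i s" using z unfolding memZ[OF h(1,3)] Zp_def by blast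
      then show "pair i s \<epsilon> Z" using memZ[OF it h(3)] by blast
    next
      assume "\<exists>c\<in>M. \<forall>j\<in>El t. app c j \<epsilon> S \<and> pair j (app c j) \<epsilon> Z"
      then obtain c where c: "c \<in> M" "\<And>j. j \<epsilon> t \<Longrightarrow> app c j \<epsilon> S \<and> pair j (app c j) \<epsilon> Z" by auto
      \<comment> \<open>A choice function would embed \<open>m\<close> into \<open>X\<close>. The
        \<open>s\<close> chosen at stage \<open>jj b\<close> lies in the section of an index of
        position at least \<open>b\<close>; moving down inside its class yields an index
        \<open>yy b\<close> of position exactly \<open>b\<close> with the same section, and
        \<open>xx b\<close> is the point coded by \<open>yy b\<close> and \<open>s\<close>.
        Different \<open>b\<close> give different positions, hence different points.\<close>
      define jj where "jj b = lst (\<lambda>j. j \<epsilon> t \<and> ord_le E b (d j))" for b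
      have djj: "dfn jj"
        unfolding dfn_def jj_def using t(1) by - (assumption | rule dfb T_const dfn_app[OF d(2)])+
      have jj: "jj b \<epsilon> t \<and> ord_le E b (d (jj b))" if b: "b \<epsilon> m" for b
      proof -
        obtain j where j: "j \<epsilon> t \<and> ord_le E b (d j)" using d(3) b unfolding cof_def by blast
        then have "Ord j" using tM(2) by blast
        then show ?thesis unfolding jj_def using j by (rule lst(2))
      qed
      define yy where "yy b = lst (\<lambda>a. a \<epsilon> m \<and> pos a = b \<and> ?sec a (app c (jj b)))" for b
      have dyy: "dfn yy"
        unfolding dfn_def yy_def using pf(4) c(1)
        by - (assumption | rule dfb T_const dfn_app[OF djj] dfn_app[OF p(1)] drel_app[OF dsec])+
      have yy: "yy b \<epsilon> m \<and> pos (yy b) = b \<and> ?sec (yy b) (app c (jj b))" if b: "b \<epsilon> m" for b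
      proof -
        have j: "jj b \<epsilon> t" "ord_le E b (d (jj b))" using jj[OF b] by blast+
        have cS: "app c (jj b) \<epsilon> S" using c(2)[OF j(1)] by blast
        have "Zp (jj b) (app c (jj b))" using c(2)[OF j(1)] memZ[OF j(1) cS] by blast
        then obtain a where a: "a \<epsilon> m" "?sec a (app c (jj b))" "ord_le E (d (jj b)) (pos a)"
          unfolding Zp_def using j(1) by auto
        have "ord_le E b (pos a)" using ord_le_trans[OF p(2)[OF a(1)] j(2) a(3)] .
        then obtain y where y: "y \<epsilon> m" "?same y a" "pos y = b" using down[OF a(1)] by blast
        have "?sec y (app c (jj b))" using y(2) a(2) cS unfolding same_def[OF pres] by simp
        then have *: "y \<epsilon> m \<and> pos y = b \<and> ?sec y (app c (jj b))" using y by blast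
        have "Ord y" using mM(2)[OF y(1)] .
        then show ?thesis unfolding yy_def using * by (rule lst(2))
      qed
      define xx where "xx b = the_M (\<lambda>x. x \<epsilon> X \<and> I x = pair (yy b) (app c (jj b)))" for b
      have dxx: "dfn xx"
        unfolding dfn_def xx_def using pf(1) c(1)
        by - (assumption | rule dfb T_const dfn_app[OF djj] dfn_app[OF dyy] dfn_app[OF pf(5)])+
      have xx: "xx b \<epsilon> X \<and> I (xx b) = pair (yy b) (app c (jj b))" if b: "b \<epsilon> m" for b
      proof -
        obtain x where x: "x \<epsilon> X" "I x = pair (yy b) (app c (jj b))"
          using yy[OF b] unfolding sec_def[OF pres] by auto
        have "xx b = x" unfolding xx_def
        proof (rule the_M_eq)
          show "x \<epsilon> X \<and> I x = pair (yy b) (app c (jj b))" using x by simp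
          show "x \<in> M" using x(1) pf(1) mem_M by blast
          show "y = x" if "y \<epsilon> X \<and> I y = pair (yy b) (app c (jj b))" for y
            using that pres_inj[OF pres] x by simp
        qed
        then show ?thesis using x by simp
      qed
      have "xx ` El m \<subseteq> El X" using xx by auto
      moreover have "inj_on xx (El m)"
      proof (rule inj_onI)
        fix b b' assume "b \<in> El m" "b' \<in> El m" and eq: "xx b = xx b'"
        then have h: "b \<epsilon> m" "b' \<epsilon> m" by auto
        have "pair (yy b) (app c (jj b)) = pair (yy b') (app c (jj b'))" using xx[OF h(1)] xx[OF h(2)] eq by simp
        moreover have "yy b \<in> M" "yy b' \<in> M" using yy[OF h(1)] yy[OF h(2)] mM(1) by blast+
        ultimately have "yy b = yy b'" by simp
        then show "b = b'" using yy[OF h(1)] yy[OF h(2)] by metis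
      qed
      ultimately have "emb m X" unfolding emb_def using dxx by blast
      then show False using m(2) by blast
    qed
    then show ?thesis using Z(1) by blast
  qed
qed

text \<open>The section of \<open>X\<close> over \<open>b\<close> is stage \<open>jj b\<close> of
  the sequence, where \<open>jj b\<close> is the first \<open>j\<close> whose \<open>d j\<close>
  reaches \<open>b\<close>. An ordinal below \<open>m\<close> embeds because a point of a late stage
  lies in all earlier ones; an embedding of \<open>m\<close> would have to meet arbitrarily late
  stages and so produce a choice function.\<close>

lemma ex_set_with_cofinality:
  assumes m: "Card m" "nu \<epsilon> m" and t: "t \<in> M" "is_cf E M m t" and Z: "Z \<in> M" "choiceless t Z"
  obtains X where "X \<in> M" "is_hartogs E M X m" "is_lindenbaum E M X (csucc m)"
proof -
  have om: "Ord m" "m \<in> M" using m(1) by simp_all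
  have mM: "a \<in> M" "Ord a" if "a \<epsilon> m" for a using that om mem_M Ord_mem by blast+
  obtain d where d: "Ord t" "dfn d" "cof d t m" "\<forall>b d. Ord b \<longrightarrow> dfn d \<longrightarrow> cof d b m \<longrightarrow> ord_le E t b"
    using is_cf_iff[OF om(2) t(1)] t(2) by blast
  have tM: "j \<in> M" "Ord j" if "j \<epsilon> t" for j using that d(1) Ord_mem t(1) mem_M by blast+
  have SM: "s \<in> M" if "s \<epsilon> S" for s using that S mem_M by blast
  have Z1: "\<exists>s. s \<epsilon> S \<and> pair j s \<epsilon> Z" if "j \<epsilon> t" for j
  proof -
    have "\<forall>j\<in>El t. \<exists>s\<in>El S. pair j s \<epsilon> Z" using Z(2) unfolding choiceless_def by (elim conjE)
    from bspec[OF this, of j] show ?thesis using that by auto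
  qed
  have Z2: "pair i s \<epsilon> Z" if "j \<epsilon> t" "ord_le E i j" "s \<epsilon> S" "pair j s \<epsilon> Z" for i j s
  proof (cases "i = j")
    case True
    then show ?thesis using that(4) by simp
  next
    case False
    then have "i \<epsilon> j" using that(2) unfolding ord_le_def by simp
    moreover have "\<forall>j\<in>El t. \<forall>i\<in>El j. \<forall>s\<in>El S. pair j s \<epsilon> Z \<longrightarrow> pair i s \<epsilon> Z"
      using Z(2) unfolding choiceless_def by (elim conjE)
    ultimately show ?thesis using that(1,3,4) by (metis mem_El)
  qed
  define jj where "jj b = lst (\<lambda>j. j \<epsilon> t \<and> ord_le E b (d j))" for b
  have djj: "dfn jj"
    unfolding dfn_def jj_def using t(1) by - (assumption | rule dfb T_const dfn_app[OF d(2)])+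
  have jj: "jj b \<epsilon> t" "ord_le E b (d (jj b))" "\<And>j. j \<epsilon> t \<Longrightarrow> ord_le E b (d j) \<Longrightarrow> ord_le E (jj b) j" if b: "b \<epsilon> m" for b
  proof -
    obtain j where j: "j \<epsilon> t \<and> ord_le E b (d j)" using d(3) b unfolding cof_def by blast
    then have "Ord j" using tM(2) by blast
    note l = lst[where P = "\<lambda>j. j \<epsilon> t \<and> ord_le E b (d j)", OF this j]
    show "jj b \<epsilon> t" "ord_le E b (d (jj b))" unfolding jj_def using l(2) by blast+
    show "ord_le E (jj b) i" if "i \<epsilon> t" "ord_le E b (d i)" for i
      unfolding jj_def using l(3)[of i] that tM(2) by simp
  qed
  have "dpred (\<lambda>p. pair (jj (pfst p)) (psnd p) \<epsilon> Z)"
    unfolding dpred_def using Z(1) by - (assumption | rule dfb T_const dfn_app[OF djj])+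
  then obtain X where X: "X \<in> M" "El X = {p\<in>El (prod m S). pair (jj (pfst p)) (psnd p) \<epsilon> Z}"
    using separation[of "\<lambda>p. pair (jj (pfst p)) (psnd p) \<epsilon> Z" "prod m S"] by auto
  have memX: "pair b s \<epsilon> X \<longleftrightarrow> b \<epsilon> m \<and> s \<epsilon> S \<and> pair (jj b) s \<epsilon> Z" if bs: "b \<in> M" "s \<in> M" for b s
  proof -
    have "pair b s \<epsilon> X \<longleftrightarrow> pair b s \<in> El X" by simp
    also have "\<dots> \<longleftrightarrow> b \<epsilon> m \<and> s \<epsilon> S \<and> pair (jj b) s \<epsilon> Z"
      unfolding X(2) using bs om(2) S by (simp del: El_prod)
    finally show ?thesis .
  qed
  have XE: "\<exists>b s. b \<in> M \<and> s \<in> M \<and> p = pair b s" "p \<epsilon> prod m S" if "p \<epsilon> X" for p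
  proof -
    have "p \<in> El X" using that by simp
    then show *: "p \<epsilon> prod m S" unfolding X(2) by simp
    show "\<exists>b s. b \<in> M \<and> s \<in> M \<and> p = pair b s" by (rule in_prodE[OF * om(2) S]) blast
  qed
  have "presents (\<lambda>x. x) X m"
    unfolding presents_def
  proof (intro conjI allI impI)
    fix a assume a: "a \<epsilon> m"
    obtain s where s: "s \<epsilon> S" "pair (jj a) s \<epsilon> Z" using Z1 jj(1)[OF a] by blast
    then have "pair a s \<epsilon> X" using memX[OF mM(1)[OF a] SM[OF s(1)]] a by blast
    then show "\<exists>x. x \<epsilon> X \<and> pfst x = a" using mM(1)[OF a] SM[OF s(1)] by (intro exI[of _ "pair a s"]) simp
  qed (use X(1) m(1) dfn_id XE in auto)
  then have "is_lindenbaum E M X (csucc m)" using lindenbaum_large m(2) by (simp add: ord_le_def)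
  moreover have "is_hartogs E M X m"
    unfolding is_hartogs_iff[OF X(1) om(2)]
  proof (intro conjI allI impI)
    show "Ord m" by (fact om(1))
    show "\<not> emb m X"
    proof
      assume "emb m X"
      then obtain g where g: "dfn g" "g ` El m \<subseteq> El X" "inj_on g (El m)" unfolding emb_def by blast
      have gE: "pfst (g y) \<epsilon> m \<and> psnd (g y) \<epsilon> S \<and> pair (jj (pfst (g y))) (psnd (g y)) \<epsilon> Z \<and>
          g y = pair (pfst (g y)) (psnd (g y))" if "y \<epsilon> m" for y
      proof -
        have gX: "g y \<epsilon> X" using g(2) that by (auto simp: image_subset_iff)
        then obtain b s where bs: "b \<in> M" "s \<in> M" "g y = pair b s" using XE(1) by blast
        then show ?thesis using gX memX[OF bs(1,2)] by auto
      qed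
      \<comment> \<open>The indices met by \<open>g\<close> are unbounded: over a single index
        \<open>g\<close> amounts to an injection into \<open>S\<close>, and by the pigeonhole
        principle such fibres over an ordinal smaller than \<open>m\<close> cannot exhaust
        \<open>m\<close>.\<close>
      have unb: "\<exists>y. y \<epsilon> m \<and> (\<forall>i\<in>El j. d i \<epsilon> pfst (g y))" if j: "j \<epsilon> t" for j
      proof (rule ccontr)
        assume n: "\<not> ?thesis"
        obtain b where b: "b \<epsilon> m" "\<And>i. i \<epsilon> j \<Longrightarrow> d i \<epsilon> b" by (rule cof_bounded_below[OF om(1) d j]) blast
        \<comment> \<open>The bound \<open>b\<close> may be attained, whereas the pigeonhole
          principle wants a strict one; its successor is still below the infinite cardinal
          \<open>m\<close>.\<close>
        have sb: "ins b b \<epsilon> m"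
        proof (rule infinite_Card_limit[OF m(1) _ b(1)])
          show "ord_le E omega m" using ord_le_mem_trans[OF nu_Ord om(1) nu(2) m(2)] by (simp add: ord_le_def)
        qed
        have dH: "dfn (\<lambda>y. pfst (g y))" using dfn_comp[OF dfn_pfst g(1)] .
        have H: "\<forall>y. y \<epsilon> m \<longrightarrow> pfst (g y) \<epsilon> ins b b"
        proof (intro allI impI)
          fix y assume y: "y \<epsilon> m"
          have o: "Ord (pfst (g y))" using gE[OF y] mM(2) by blast
          have "\<not> b \<epsilon> pfst (g y)" using n y b(2) Ord_trans[OF o] by auto
          then have "ord_le E (pfst (g y)) b" using not_ord_le[OF o mM(2)[OF b(1)]] by blast
          then show "pfst (g y) \<epsilon> ins b b" using mem_succ_iff[OF mM(2)[OF b(1)]] by blast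
        qed
        \<comment> \<open>The fibres land in \<open>S\<close>; \<open>e\<close> moves them into
          \<open>Power S\<close>, the target demanded by the pigeonhole principle.\<close>
        obtain e where e: "dfn e" "e ` El S \<subseteq> El (Power S)" "inj_on e (El S)"
          using emb_Power[OF S] unfolding emb_def by blast
        have "\<forall>x. x \<epsilon> m \<longrightarrow> (\<exists>F. dfn F \<and> (\<forall>y. y \<epsilon> m \<longrightarrow> pfst (g y) = pfst (g x) \<longrightarrow> F y \<epsilon> Power S) \<and>
            inj_on F {y\<in>El m. pfst (g y) = pfst (g x)})"
        proof (intro allI impI exI conjI)
          show "dfn (\<lambda>y. e (psnd (g y)))" using dfn_comp[OF e(1) dfn_comp[OF dfn_psnd g(1)]] .
          show "e (psnd (g y)) \<epsilon> Power S" if y: "y \<epsilon> m" for y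
          proof -
            have "psnd (g y) \<in> El S" using gE[OF y] by simp
            then have "e (psnd (g y)) \<in> El (Power S)" using e(2) by blast
            then show ?thesis unfolding mem_El .
          qed
          show "inj_on (\<lambda>y. e (psnd (g y))) {y\<in>El m. pfst (g y) = pfst (g x)}" for x
          proof (rule inj_onI)
            fix y z assume "y \<in> {y\<in>El m. pfst (g y) = pfst (g x)}" "z \<in> {y\<in>El m. pfst (g y) = pfst (g x)}"
              and eq: "e (psnd (g y)) = e (psnd (g z))"
            then have yz: "y \<epsilon> m" "z \<epsilon> m" "pfst (g y) = pfst (g z)" by auto
            have "psnd (g y) = psnd (g z)" using e(3) eq gE[OF yz(1)] gE[OF yz(2)] unfolding inj_on_def by simp
            then have "g y = g z" using gE[OF yz(1)] gE[OF yz(2)] yz(3) by metis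
            then show "y = z" using g(3) yz unfolding inj_on_def by simp
          qed
        qed
        then show False by (rule fibres_contradiction[OF m sb dH H])
      qed
      define yy where "yy j = lst (\<lambda>y. y \<epsilon> m \<and> (\<forall>i\<in>El j. d i \<epsilon> pfst (g y)))" for j
      have dyy: "dfn yy"
        unfolding dfn_def yy_def using om(2) by - (assumption | rule dfb T_const dfn_app[OF d(2)] dfn_app[OF g(1)])+
      have yy: "yy j \<epsilon> m \<and> (\<forall>i\<in>El j. d i \<epsilon> pfst (g (yy j)))" if j: "j \<epsilon> t" for j
      proof -
        obtain y where y: "y \<epsilon> m \<and> (\<forall>i\<in>El j. d i \<epsilon> pfst (g y))" using unb[OF j] by blast
        then have "Ord y" using mM(2) by blast
        then show ?thesis unfolding yy_def using y by (rule lst(2))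
      qed
      \<comment> \<open>The index met at \<open>yy j\<close> lies beyond \<open>d i\<close> for all
        \<open>i\<close> before \<open>j\<close>, so its stage is \<open>j\<close> or later. The
        second coordinate belongs to that stage and, since stages decrease, to stage
        \<open>j\<close>.\<close>
      define cc where "cc j = psnd (g (yy j))" for j
      have dcc: "dfn cc" unfolding cc_def using dfn_comp[OF dfn_psnd dfn_comp[OF g(1) dyy]] .
      have cc: "cc j \<epsilon> S \<and> pair j (cc j) \<epsilon> Z" if j: "j \<epsilon> t" for j
      proof -
        have y: "yy j \<epsilon> m" "\<And>i. i \<epsilon> j \<Longrightarrow> d i \<epsilon> pfst (g (yy j))" using yy[OF j] by auto
        let ?b = "pfst (g (yy j))"
        have b: "?b \<epsilon> m" "cc j \<epsilon> S" "pair (jj ?b) (cc j) \<epsilon> Z" using gE[OF y(1)] unfolding cc_def by blast+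
        have "\<not> jj ?b \<epsilon> j"
        proof
          assume "jj ?b \<epsilon> j"
          then have "d (jj ?b) \<epsilon> ?b" using y(2) by blast
          moreover have "Ord (d (jj ?b))" using d(3) jj(1)[OF b(1)] mM(2) unfolding cof_def by blast
          ultimately show False using jj(2)[OF b(1)] not_ord_le[OF mM(2)[OF b(1)]] by blast
        qed
        then have "ord_le E j (jj ?b)" using not_ord_le[OF tM(2)[OF j] tM(2)[OF jj(1)[OF b(1)]]] by blast
        then show ?thesis using Z2[OF jj(1)[OF b(1)] _ b(2,3)] b(2) by blast
      qed
      have "cc ` El t \<subseteq> El S" using cc by auto
      then obtain f where f: "f \<in> M" "is_function E M f t S" "\<forall>j. j \<epsilon> t \<longrightarrow> app f j = cc j"
        by (rule graph_app[OF dcc t(1) S])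
      from f(3) have "\<forall>j\<in>El t. app f j \<epsilon> S \<and> pair j (app f j) \<epsilon> Z" using cc by simp
      then show False using Z(2) f(1) unfolding choiceless_def by blast
    qed
    fix b assume b: "Ord b" "\<not> emb b X"
    have "\<not> b \<epsilon> m"
    proof
      assume bm: "b \<epsilon> m"
      have j: "jj b \<epsilon> t" "ord_le E b (d (jj b))" using jj[OF bm] by blast+
      \<comment> \<open>One point of the stage of \<open>b\<close> serves every \<open>x\<close>
        below \<open>b\<close>, since \<open>jj x\<close> is at most \<open>jj b\<close> and stages
        decrease.\<close>
      obtain s where s: "s \<epsilon> S" "pair (jj b) s \<epsilon> Z" using Z1[OF j(1)] by blast
      have sM: "s \<in> M" using SM[OF s(1)] .
      have "pair x s \<epsilon> X" if x: "x \<epsilon> b" for x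
      proof -
        have xm: "x \<epsilon> m" using Ord_trans[OF om(1) bm x] .
        have "Ord (d (jj b))" using d(3) j(1) mM(2) unfolding cof_def by blast
        then have "ord_le E x (d (jj b))" using mem_ord_le_trans[OF _ x j(2)] unfolding ord_le_def by blast
        then have "ord_le E (jj x) (jj b)" using jj(3)[OF xm j(1)] by blast
        then have "pair (jj x) s \<epsilon> Z" using Z2[OF j(1) _ s] by blast
        then show ?thesis using memX[OF mM(1)[OF xm] sM] xm s(1) by blast
      qed
      then have "(\<lambda>x. pair x s) ` El b \<subseteq> El X" by auto
      moreover have "inj_on (\<lambda>x. pair x s) (El b)"
      proof (rule inj_onI)
        fix x y assume "x \<in> El b" "y \<in> El b" and eq: "pair x s = pair y s"
        then have "x \<in> M" "y \<in> M" using mem_M[OF _ mM(1)[OF bm]] by auto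
        then show "x = y" using eq sM by simp
      qed
      moreover have "dfn (\<lambda>x. pair x s)"
        unfolding dfn_def using sM by - (assumption | rule dfb T_const)+
      ultimately have "emb b X" unfolding emb_def by blast
      then show False using b(2) by blast
    qed
    then show "ord_le E m b" using not_ord_le[OF om(1) b(1)] by blast
  qed
  ultimately show thesis using that X(1) by blast
qed

text \<open>A Lindenbaum number beyond \<open>csucc nu\<close> forces more than \<open>nu\<close>
  indices: fewer are excluded by \<open>lindenbaum_small\<close>, and exactly \<open>nu\<close>
  would give the value \<open>csucc nu\<close>. Then \<open>k\<close> is \<open>csucc m\<close> and
  \<open>l\<close> is a cardinal between \<open>m\<close> and \<open>csucc m\<close>, so it is one
  of the two ends.\<close>

lemma Spec_dichotomy:
  assumes "X \<in> M" "l \<in> M" "k \<in> M" "is_hartogs E M X l" "is_lindenbaum E M X k"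
    and "csucc nu \<epsilon> k"
  shows "(\<exists>m. Card m \<and> l = csucc m \<and> k = csucc m) \<or>
    (Card l \<and> k = csucc l \<and> nu \<epsilon> l \<and> (\<exists>t\<in>M. is_cf E M l t \<and> t \<epsilon> nu \<and> (\<exists>Z\<in>M. choiceless t Z)))"
proof -
  obtain I m where pres: "presents I X m" by (rule ex_presentation[OF assms(1)])
  note pf = pres_facts[OF pres]
  have cl: "Card l" "Ord l" and ck: "Card k" "Ord k"
    using hartogs_Card assms(1-4) lindenbaum_Card assms(5) Card_Ord by blast+
  have sn: "Ord (csucc nu)" using csucc(1)[OF nu_Ord] by simp
  have "\<not> ord_le E k (csucc nu)" using not_ord_le[OF ck(2) sn] assms(6) by blast
  then have "\<not> m \<epsilon> nu" using lindenbaum_small[OF pres _ assms(3,5)] by blast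
  then have nm: "ord_le E nu m" using not_ord_le[OF nu_Ord pf(3)] by blast
  have s: "Card (csucc m)" "Ord (csucc m)" using csucc(1)[OF pf(3)] by simp_all
  have km: "k = csucc m"
  proof -
    have "csucc m \<in> M" using s(2) by simp
    note li = lindenbaum_large[OF pres nm, unfolded is_lindenbaum_iff[OF assms(1) this]]
    note lk = assms(5)[unfolded is_lindenbaum_iff[OF assms(1,3)]]
    show ?thesis by (rule ord_le_antisym) (use li lk in blast)+
  qed
  have "m \<noteq> nu" using km assms(6) by auto
  then have m: "nu \<epsilon> m" using nm unfolding ord_le_def by auto
  have ml: "ord_le E m l" by (rule hartogs_lower[OF pres m assms(2,4)])
  have lk: "ord_le E l k" using hartogs_le_lindenbaum assms(1-5) by blast
  show ?thesis
  proof (cases "l = k")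
    case True
    then show ?thesis using km pf(2) by blast
  next
    case False
    then have "l \<epsilon> csucc m" using lk km unfolding ord_le_def by blast
    then have "ord_le E l m" using Card_le_csucc pf(2) cl(1) by blast
    then have lm: "l = m" using ml ord_le_antisym by blast
    obtain t where t: "t \<in> M" "is_cf E M m t" by (rule ex_cf[OF pf(3)])
    have "\<not> emb m X" using assms(4) lm is_hartogs_iff[OF assms(1,2)] by blast
    then have "t \<epsilon> nu" "\<exists>Z\<in>M. choiceless t Z" using cf_below_nu[OF pres m _ t] by blast+
    then show ?thesis using lm km t m cl(1) by blast
  qed
qed

end

theorem mainTheorem2:
  fixes E :: "'v \<Rightarrow> 'v \<Rightarrow> bool" and M :: "'v set"
  assumes "membership_universe E"
    and "transitive_class E M"
    and "ZF_model E M"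
    and "SVC E M"
  shows "\<exists>\<phi>\<in>M. \<exists>\<psi>\<in>M. \<exists>\<chi>\<^sub>0\<in>M. \<exists>\<Omega>\<in>M. \<exists>\<psi>'\<in>M. \<exists>\<chi>\<in>M. \<exists>C\<in>M. \<exists>\<DD> \<CC>.
    is_cardinal E M \<phi> \<and> is_cardinal E M \<psi> \<and> is_cardinal E M \<chi>\<^sub>0 \<and> is_cardinal E M \<Omega> \<and>
    ord_le E \<phi> \<psi> \<and> ord_le E \<psi> \<chi>\<^sub>0 \<and> ord_le E \<chi>\<^sub>0 \<Omega> \<and>
    is_cardinal E M \<psi>' \<and> ord_le E \<psi> \<psi>' \<and>
    is_cardinal E M \<chi> \<and> ord_le E \<chi>\<^sub>0 \<chi> \<and> (\<exists>k\<in>M. is_card_succ E M \<chi>\<^sub>0 k \<and> ord_le E \<chi> k) \<and>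
    (\<forall>\<mu>\<in>M. E \<mu> C \<longrightarrow> is_cardinal E M \<mu> \<and> ord_le E \<phi> \<mu> \<and> E \<mu> \<chi>\<^sub>0) \<and>
    pair_class E M \<DD> \<and> pair_class E M \<CC> \<and>
    \<DD> \<subseteq> {(l, k). l \<in> M \<and> k \<in> M \<and> is_cardinal E M l \<and> is_cardinal E M k \<and>
                  ord_le E \<psi> l \<and> ord_le E l k \<and> ord_le E k \<chi> \<and> ord_le E \<psi>' k} \<and>
    \<CC> \<subseteq> {(l, k) \<in> cf_pairs E M C. E l \<Omega>} \<and>
    Spec_aleph E M = Suc_pairs E M \<union> \<DD> \<union> \<CC> \<union> {(l, k) \<in> cf_pairs E M C. ord_le E \<Omega> l}"
proof -
  interpret zf_universe E M using assms(1-3) by unfold_locales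
  obtain S0 where S0: "S0 \<in> M" "\<And>X. X \<in> M \<Longrightarrow> \<exists>h. Ord h \<and> emb X (prod h (Power S0))"
    by (rule SVC_injective[OF assms(4)]) blast
  define S where "S = Power S0"
  have SM: "S \<in> M" unfolding S_def by simp
  \<comment> \<open>\<open>nu\<close> is taken above \<open>omega\<close> so that Hessenberg's
    theorem applies to every cardinal from \<open>nu\<close> on.\<close>
  obtain nu where nu: "Card nu" "E omega nu" "\<not> emb nu (Power S)"
    by (rule ex_Card_not_emb[of "Power S" omega]) auto
  interpret injective_seed E M S nu
    using SM S0(2) nu unfolding S_def by unfold_locales (auto simp: ord_le_def)
  define W where "W = csucc nu"
  have W: "Card W" "Ord W" "W \<in> M" "E nu W"
    unfolding W_def using csucc(1,2)[OF nu_Ord] by simp_all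
  have "dpred (\<lambda>t. Card t \<and> (\<exists>Z\<in>M. choiceless t Z))"
    unfolding dpred_def by (rule dfb)+
  then obtain C where C: "C \<in> M" "El C = {t\<in>El nu. Card t \<and> (\<exists>Z\<in>M. choiceless t Z)}"
    by (rule separation[where a = nu]) (use nu(1) in auto)
  have memC: "E t C \<longleftrightarrow> E t nu \<and> Card t \<and> (\<exists>Z\<in>M. choiceless t Z)" for t
    using C(2) by (auto simp: El_def set_eq_iff)
  define spec where "spec l k \<longleftrightarrow> (\<exists>X\<in>M. is_hartogs E M X l \<and> is_lindenbaum E M X k)" for l k
  define cfp where "cfp l k \<longleftrightarrow> is_cardinal E M l \<and> is_card_succ E M l k \<and> (\<exists>m\<in>M. is_cf E M l m \<and> E m C)" for l k
  have ds: "drel spec" unfolding drel_def spec_def by (rule dfb)+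
  have dc: "drel cfp" unfolding drel_def cfp_def using C(1) by - (assumption | rule dfb T_const)+
  have Spec: "(l, k) \<in> Spec_aleph E M \<longleftrightarrow> l \<in> M \<and> k \<in> M \<and> spec l k" for l k
    unfolding Spec_aleph_def spec_def by simp
  have cf: "(l, k) \<in> cf_pairs E M C \<longleftrightarrow> l \<in> M \<and> k \<in> M \<and> cfp l k" for l k
    unfolding cf_pairs_def cfp_def by simp
  \<comment> \<open>Both classes are cut out of the spectrum, so they add nothing foreign to it.
    \<open>DD\<close> takes every pair whose second entry is at most \<open>W\<close>, whatever its
    form.\<close>
  define DD where "DD = {(l, k). l \<in> M \<and> k \<in> M \<and> spec l k \<and> ord_le E k W}"
  define CC where "CC = {(l, k). l \<in> M \<and> k \<in> M \<and> spec l k \<and> cfp l k \<and> E l W}"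
  have "drel (\<lambda>l k. spec l k \<and> ord_le E k W)"
    unfolding drel_def using W(3) by - (assumption | rule dfb T_const drel_app[OF ds])+
  then have pD: "pair_class E M DD" by (rule pair_classI) (auto simp: DD_def)
  have "drel (\<lambda>l k. spec l k \<and> cfp l k \<and> E l W)"
    unfolding drel_def using W(3) by - (assumption | rule dfb T_const drel_app[OF ds] drel_app[OF dc])+
  then have pC: "pair_class E M CC" by (rule pair_classI) (auto simp: CC_def)
  have D_sub: "DD \<subseteq> {(l, k). l \<in> M \<and> k \<in> M \<and> is_cardinal E M l \<and> is_cardinal E M k \<and>
      ord_le E emp l \<and> ord_le E l k \<and> ord_le E k W \<and> ord_le E emp k}"
  proof
    fix p assume "p \<in> DD"
    then obtain l k X where p: "p = (l, k)" "l \<in> M" "k \<in> M" "ord_le E k W" "X \<in> M"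
      "is_hartogs E M X l" "is_lindenbaum E M X k"
      unfolding DD_def spec_def by auto
    have c: "Card l" "Card k" using hartogs_Card lindenbaum_Card p by blast+
    have "ord_le E l k" using hartogs_le_lindenbaum p by blast
    moreover have "ord_le E emp l" "ord_le E emp k" using emp_le c Card_Ord by blast+
    moreover have "is_cardinal E M l" "is_cardinal E M k" using c unfolding Card_def by blast+
    ultimately show "p \<in> {(l, k). l \<in> M \<and> k \<in> M \<and> is_cardinal E M l \<and> is_cardinal E M k \<and>
      ord_le E emp l \<and> ord_le E l k \<and> ord_le E k W \<and> ord_le E emp k}" using p(1-4) by simp
  qed
  have C_sub: "CC \<subseteq> {(l, k) \<in> cf_pairs E M C. E l W}"
    unfolding CC_def using cf by auto
  have eq: "Spec_aleph E M = Suc_pairs E M \<union> DD \<union> CC \<union> {(l, k) \<in> cf_pairs E M C. ord_le E W l}"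
  proof
    show "Spec_aleph E M \<subseteq> Suc_pairs E M \<union> DD \<union> CC \<union> {(l, k) \<in> cf_pairs E M C. ord_le E W l}"
    proof
      fix p assume "p \<in> Spec_aleph E M"
      then obtain l k where p: "p = (l, k)" "l \<in> M" "k \<in> M" "spec l k" using Spec by (cases p) auto
      then obtain X where X: "X \<in> M" "is_hartogs E M X l" "is_lindenbaum E M X k" unfolding spec_def by blast
      have ok: "Ord k" using lindenbaum_Card[OF X(1) p(3) X(3)] by simp
      show "p \<in> Suc_pairs E M \<union> DD \<union> CC \<union> {(l, k) \<in> cf_pairs E M C. ord_le E W l}"
      proof (cases "ord_le E k W")
        case True
        then show ?thesis using p unfolding DD_def by simp
      next
        case False
        then have "E (csucc nu) k" using not_ord_le[OF ok W(2)] unfolding W_def by blast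
        from Spec_dichotomy[OF X(1) p(2,3) X(2,3) this] show ?thesis
        proof (elim disjE exE conjE bexE)
          fix m assume m: "Card m" "l = csucc m" "k = csucc m"
          have "m \<in> M" "is_cardinal E M m" using m(1) unfolding Card_def by blast+
          moreover have "is_card_succ E M m k" using is_card_succ_iff[OF Card_Ord[OF m(1)] p(3)] m(3) by blast
          ultimately have "p \<in> Suc_pairs E M" unfolding Suc_pairs_def using p(1,3) m by auto
          then show ?thesis by blast
        next
          fix t Z assume l: "Card l" "k = csucc l" "E nu l" and t: "t \<in> M" "is_cf E M l t" "E t nu"
            and Z: "Z \<in> M" "choiceless t Z"
          have "Card t" using cf_Card[OF p(2) t(1,2)] .
          then have "E t C" using memC t(3) Z by blast
          moreover have "is_card_succ E M l k" using is_card_succ_iff[OF Card_Ord[OF l(1)] p(3)] l(2) by blast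
          moreover have "is_cardinal E M l" using l(1) unfolding Card_def by blast
          ultimately have "cfp l k" unfolding cfp_def using t by blast
          \<comment> \<open>A cardinal above \<open>nu\<close> is at least \<open>csucc nu\<close>,
            so the pair lies in the part of the spectrum governed by cofinality alone.\<close>
          moreover have "ord_le E W l" unfolding W_def using csucc(3)[OF nu_Ord l(1,3)] .
          ultimately show ?thesis using p(1-3) cf by simp
        qed
      qed
    qed
    show "Suc_pairs E M \<union> DD \<union> CC \<union> {(l, k) \<in> cf_pairs E M C. ord_le E W l} \<subseteq> Spec_aleph E M"
    proof (intro Un_least)
      show "Suc_pairs E M \<subseteq> Spec_aleph E M" by (rule Suc_pairs_subset_Spec)
      show "DD \<subseteq> Spec_aleph E M" "CC \<subseteq> Spec_aleph E M" unfolding DD_def CC_def using Spec by auto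
      show "{(l, k) \<in> cf_pairs E M C. ord_le E W l} \<subseteq> Spec_aleph E M"
      proof
        fix p assume "p \<in> {(l, k) \<in> cf_pairs E M C. ord_le E W l}"
        then obtain l k where p: "p = (l, k)" "l \<in> M" "k \<in> M" "cfp l k" "ord_le E W l" using cf by (cases p) auto
        then obtain t where l: "is_cardinal E M l" "is_card_succ E M l k" and t: "t \<in> M" "is_cf E M l t" "E t C"
          unfolding cfp_def by blast
        have cl: "Card l" using l(1) p(2) unfolding Card_def by blast
        have k: "k = csucc l" using is_card_succ_iff[OF Card_Ord[OF cl] p(3)] l(2) by blast
        \<comment> \<open>From \<open>W\<close> on every cardinal exceeds \<open>nu\<close>, the
          range in which a choiceless sequence can be spread over \<open>l\<close>.\<close>
        have nl: "E nu l" using mem_ord_le_trans[OF Card_Ord[OF cl] W(4) p(5)] .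
        obtain Z where Z: "Z \<in> M" "choiceless t Z" using memC t(3) by blast
        obtain X where "X \<in> M" "is_hartogs E M X l" "is_lindenbaum E M X (csucc l)"
          by (rule ex_set_with_cofinality[OF cl nl t(1,2) Z])
        then show "p \<in> Spec_aleph E M" using p(1-3) k Spec unfolding spec_def by blast
      qed
    qed
  qed
  have cards: "is_cardinal E M emp" "is_cardinal E M W"
    using Card_emp W(1) unfolding Card_def by blast+
  have le: "ord_le E emp W" "ord_le E W W" "ord_le E emp emp" using emp_le[OF W(2)] by simp_all
  have succ: "\<exists>k\<in>M. is_card_succ E M W k \<and> ord_le E W k"
  proof (intro bexI conjI)
    show M: "csucc W \<in> M" using csucc(1)[OF W(2)] by simp
    show "is_card_succ E M W (csucc W)" using is_card_succ_iff[OF W(2) M] by blast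
    show "ord_le E W (csucc W)" using csucc(2)[OF W(2)] unfolding ord_le_def by blast
  qed
  have Cm: "\<forall>\<mu>\<in>M. E \<mu> C \<longrightarrow> is_cardinal E M \<mu> \<and> ord_le E emp \<mu> \<and> E \<mu> W"
  proof (intro ballI impI)
    fix \<mu> assume "E \<mu> C"
    then have \<mu>: "E \<mu> nu" "Card \<mu>" using memC by blast+
    moreover have "E \<mu> W" using Ord_trans[OF W(2,4) \<mu>(1)] .
    moreover have "ord_le E emp \<mu>" using emp_le[OF Card_Ord[OF \<mu>(2)]] .
    ultimately show "is_cardinal E M \<mu> \<and> ord_le E emp \<mu> \<and> E \<mu> W" unfolding Card_def by blast
  qed
  show ?thesis
    by (rule bexI[OF _ emp_M], rule bexI[OF _ emp_M], rule bexI[OF _ W(3)], rule bexI[OF _ W(3)],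
        rule bexI[OF _ emp_M], rule bexI[OF _ W(3)], rule bexI[OF _ C(1)], rule exI[of _ DD],
        rule exI[of _ CC]) (intro conjI cards le succ Cm pD pC D_sub C_sub eq)
qed

end
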